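(* Let $f\colon M^2\to(\mathbf{R}^3,g_0)$ be a front with unit normal vector field $\nu$, $p$ a generic swallowtail, and $\Delta$ a sufficiently small domain consisting of regular points sufficiently close to $p$. Then the Gaussian curvature is unbounded and changes sign between the two sides along the singular curve. Moreover, $\mathrm{sgn}_0(\nu)\,\mathrm{sgn}_\Delta(\nu)$ coincides with the sign of the Gaussian curvature on $\Delta$.
   Context: All objects are $C^\infty$; $M^2$ is an oriented $2$-manifold and $g_0$ is the Euclidean metric. A smooth map $f\colon M^2\to\mathbf{R}^3$ is a front if there is a unit vector field $\nu$ along $f$ with $g_0(f_*X,\nu)=0$ for all $X\in TM^2$ and such that $(f,\nu)\colon M^2\to\mathbf{R}^3\times S^2$ is an immersion. Singular points are the points where $f$ is not an immersion; a nonzero vector in the kernel of $f_*$ at a singular point is a null vector. A cuspidal edge (resp. swallowtail) is a singular point at which $f$ is locally diffeomorphic (by diffeomorphism germs of source and target) to $(u,v)\mapsto(u^2,u^3,v)$ (resp. $(u,v)\mapsto(3u^4+u^2v,4u^3+2uv,v)$) at $(0,0)$. Near a swallowtail $p$ the singular set is a regular curve in $M^2$ (the singular curve), all of whose points other than $p$ are cuspidal edges. A null curve is a regular curve $\sigma$ in $M^2$ such that $\sigma'$ is a null vector at each singular point. The second fundamental form is $h(X,Y)=-g_0(f_*X,D_Y\nu)$, with $D$ the flat connection. A swallowtail $p$ is generic if $h$ does not vanish at $p$. The Gaussian curvature is that of $f^*g_0$ on regular points. The limiting tangent plane at $p$ is the plane through $f(p)$ perpendicular to $\nu(p)$. The half-space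 containing the singular curve at a generic swallowtail $p$ is the half-space $H\subset\mathbf{R}^3$ bounded by the limiting tangent plane such that (the image under $f$ of) any null curve at $p$ lies in $H$ near $p$. $\mathrm{sgn}_0(\nu)=1$ (resp. $-1$) if $\nu$ points (resp. does not point) into $H$. Outward normal: the image of a small neighborhood of a cuspidal edge locally separates $\mathbf{R}^3$ into two components, the thin one corresponding to $\{y^2<x^3\}$ in the normal form (with coordinates $(x,y,z)$ on the target); at regular points near the cuspidal edge the outward normal is the unit normal of the surface pointing away from the thin component. For a small domain $\Delta$ of regular points near the swallowtail (lying on one side of the singular curve), $\mathrm{sgn}_\Delta(\nu)=1$ (resp. $-1$) if $\nu$ is (resp. is not) the outward normal on $\Delta$, with respect to the cuspidal edges adjacent to $\Delta$.
   Formalization: The half-space H containing every null curve at p need not exist at a generic swallowtail, so sgn_0 may be undefined; the final sign claim is stated for every H having the defining property, without asserting that one exists. The curvature claims are unconditional. *)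

theory Defs
  imports "HOL-Analysis.Analysis"
begin

section \<open>Smooth maps and oriented surfaces\<close>

text \<open>The following two predicates are meant for open sets \<open>S\<close> only; the class \<open>C\<^sup>k\<close> is described
  by iterated directional derivatives in fixed directions.\<close>

primrec Ck_on :: "nat \<Rightarrow> 'a::real_normed_vector set \<Rightarrow> ('a \<Rightarrow> 'b::real_normed_vector) \<Rightarrow> bool" where
  "Ck_on 0 S f \<longleftrightarrow> continuous_on S f"
| "Ck_on (Suc k) S f \<longleftrightarrow>
     (\<forall>x\<in>S. f differentiable (at x)) \<and>
     (\<forall>v. Ck_on k S (\<lambda>x. frechet_derivative f (at x) v))"

definition smooth_on :: "'a::real_normed_vector set \<Rightarrow> ('a \<Rightarrow> 'b::real_normed_vector) \<Rightarrow> bool" where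
  "smooth_on S f \<longleftrightarrow> (\<forall>k. Ck_on k S f)"

definition diffeomorphism_on ::
  "'a::real_normed_vector set \<Rightarrow> ('a \<Rightarrow> 'b::real_normed_vector) \<Rightarrow> bool" where
  "diffeomorphism_on V \<Phi> \<longleftrightarrow>
     open V \<and> open (\<Phi> ` V) \<and> inj_on \<Phi> V \<and> smooth_on V \<Phi> \<and> smooth_on (\<Phi> ` V) (inv_into V \<Phi>)"

text \<open>A chart is a pair of its domain and its coordinate map, whose values outside the domain are
  irrelevant. The surface is the whole type \<open>'m\<close>, and its smooth structure and orientation
  are given by an atlas.\<close>

type_synonym 'm chart = "'m set \<times> ('m \<Rightarrow> real^2)"

definition in_chart :: "'m set \<Rightarrow> ('m \<Rightarrow> real^2) \<Rightarrow> ('m \<Rightarrow> 'b) \<Rightarrow> real^2 \<Rightarrow> 'b" where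
  "in_chart U \<phi> F = F \<circ> inv_into U \<phi>"

definition oriented_surface :: "'m::topological_space chart set \<Rightarrow> bool" where
  "oriented_surface A \<longleftrightarrow>
     (\<Union>(U, \<phi>)\<in>A. U) = UNIV \<and>
     (\<forall>(U, \<phi>)\<in>A. open U \<and> open (\<phi> ` U) \<and> homeomorphism U (\<phi> ` U) \<phi> (inv_into U \<phi>)) \<and>
     (\<forall>(U, \<phi>)\<in>A. \<forall>(V, \<psi>)\<in>A.
        smooth_on (\<phi> ` (U \<inter> V)) (in_chart U \<phi> \<psi>) \<and>
        (\<forall>w\<in>\<phi> ` (U \<inter> V). 0 < det (matrix (frechet_derivative (in_chart U \<phi> \<psi>) (at w)))))"

text \<open>Local coordinates of the smooth structure, not necessarily compatible with the
  orientation.\<close>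

definition local_coordinates ::
  "'m::topological_space chart set \<Rightarrow> 'm set \<Rightarrow> ('m \<Rightarrow> real^2) \<Rightarrow> bool" where
  "local_coordinates A U \<psi> \<longleftrightarrow>
     open U \<and> open (\<psi> ` U) \<and> homeomorphism U (\<psi> ` U) \<psi> (inv_into U \<psi>) \<and>
     (\<forall>(V, \<phi>)\<in>A. smooth_on (\<phi> ` (U \<inter> V)) (in_chart V \<phi> \<psi>) \<and>
                 smooth_on (\<psi> ` (U \<inter> V)) (in_chart U \<psi> \<phi>))"

definition smooth_map :: "'m chart set \<Rightarrow> ('m \<Rightarrow> 'b::real_normed_vector) \<Rightarrow> bool" where
  "smooth_map A F \<longleftrightarrow> (\<forall>(U, \<phi>)\<in>A. smooth_on (\<phi> ` U) (in_chart U \<phi> F))"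

text \<open>Tangent vectors at \<open>x\<close> are represented by their coordinate vectors with respect to a chart
  \<open>(U, \<phi>)\<close> around \<open>x\<close>; the following is the differential of \<open>F\<close> at \<open>x\<close>.\<close>

definition differential ::
  "'m set \<Rightarrow> ('m \<Rightarrow> real^2) \<Rightarrow> ('m \<Rightarrow> 'b::real_normed_vector) \<Rightarrow> 'm \<Rightarrow> real^2 \<Rightarrow> 'b" where
  "differential U \<phi> F x = frechet_derivative (in_chart U \<phi> F) (at (\<phi> x))"

definition immersive_at :: "'m chart set \<Rightarrow> ('m \<Rightarrow> 'b::real_normed_vector) \<Rightarrow> 'm \<Rightarrow> bool" where
  "immersive_at A F x \<longleftrightarrow> (\<forall>(U, \<phi>)\<in>A. x \<in> U \<longrightarrow> inj (differential U \<phi> F x))"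


section \<open>Fronts and their singularities\<close>

definition front_with_normal :: "'m chart set \<Rightarrow> ('m \<Rightarrow> real^3) \<Rightarrow> ('m \<Rightarrow> real^3) \<Rightarrow> bool" where
  "front_with_normal A f \<nu> \<longleftrightarrow>
     smooth_map A f \<and> smooth_map A \<nu> \<and>
     (\<forall>x. norm (\<nu> x) = 1) \<and>
     (\<forall>(U, \<phi>)\<in>A. \<forall>x\<in>U. \<forall>X. differential U \<phi> f x X \<bullet> \<nu> x = 0) \<and>
     (\<forall>x. immersive_at A (\<lambda>y. (f y, \<nu> y)) x)"

definition singular_set :: "'m chart set \<Rightarrow> ('m \<Rightarrow> real^3) \<Rightarrow> 'm set" where
  "singular_set A f = {x. \<not> immersive_at A f x}"

text \<open>Diffeomorphism germs \<open>\<psi>\<close> at \<open>q\<close> and \<open>\<Phi>\<close> at \<open>f q\<close> that carry the germ of \<open>f\<close> at \<open>q\<close> to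
  the germ of \<open>g\<close> at the origin.\<close>

definition normalizes ::
  "'m::topological_space chart set \<Rightarrow> ('m \<Rightarrow> real^3) \<Rightarrow> 'm \<Rightarrow> (real^2 \<Rightarrow> real^3) \<Rightarrow>
   'm set \<Rightarrow> ('m \<Rightarrow> real^2) \<Rightarrow> (real^3) set \<Rightarrow> (real^3 \<Rightarrow> real^3) \<Rightarrow> bool" where
  "normalizes A f q g U \<psi> V \<Phi> \<longleftrightarrow>
     local_coordinates A U \<psi> \<and> q \<in> U \<and> \<psi> q = 0 \<and>
     diffeomorphism_on V \<Phi> \<and> f ` U \<subseteq> V \<and> \<Phi> (f q) = 0 \<and>
     (\<forall>x\<in>U. \<Phi> (f x) = g (\<psi> x))"

definition cuspidal_edge_form :: "real^2 \<Rightarrow> real^3" where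
  "cuspidal_edge_form w = vector [(w$1)^2, (w$1)^3, w$2]"

definition swallowtail_form :: "real^2 \<Rightarrow> real^3" where
  "swallowtail_form w =
     vector [3 * (w$1)^4 + (w$1)^2 * w$2, 4 * (w$1)^3 + 2 * w$1 * w$2, w$2]"

definition cuspidal_edge :: "'m::topological_space chart set \<Rightarrow> ('m \<Rightarrow> real^3) \<Rightarrow> 'm \<Rightarrow> bool" where
  "cuspidal_edge A f q \<longleftrightarrow>
     q \<in> singular_set A f \<and> (\<exists>U \<psi> V \<Phi>. normalizes A f q cuspidal_edge_form U \<psi> V \<Phi>)"

definition swallowtail :: "'m::topological_space chart set \<Rightarrow> ('m \<Rightarrow> real^3) \<Rightarrow> 'm \<Rightarrow> bool" where
  "swallowtail A f p \<longleftrightarrow>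
     p \<in> singular_set A f \<and> (\<exists>U \<psi> V \<Phi>. normalizes A f p swallowtail_form U \<psi> V \<Phi>)"

definition second_fundamental_form ::
  "'m set \<Rightarrow> ('m \<Rightarrow> real^2) \<Rightarrow> ('m \<Rightarrow> real^3) \<Rightarrow> ('m \<Rightarrow> real^3) \<Rightarrow> 'm \<Rightarrow> real^2 \<Rightarrow> real^2 \<Rightarrow> real" where
  "second_fundamental_form U \<phi> f \<nu> x X Y = - (differential U \<phi> f x X \<bullet> differential U \<phi> \<nu> x Y)"

definition generic_swallowtail ::
  "'m::topological_space chart set \<Rightarrow> ('m \<Rightarrow> real^3) \<Rightarrow> ('m \<Rightarrow> real^3) \<Rightarrow> 'm \<Rightarrow> bool" where
  "generic_swallowtail A f \<nu> p \<longleftrightarrow>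
     swallowtail A f p \<and>
     (\<exists>(U, \<phi>)\<in>A. p \<in> U \<and> (\<exists>X Y. second_fundamental_form U \<phi> f \<nu> p X Y \<noteq> 0))"


section \<open>Gaussian curvature of the first fundamental form\<close>

definition partial :: "2 \<Rightarrow> (real^2 \<Rightarrow> 'b::real_normed_vector) \<Rightarrow> real^2 \<Rightarrow> 'b" where
  "partial i F w = frechet_derivative F (at w) (axis i 1)"

definition pullback_metric :: "(real^2 \<Rightarrow> real^3) \<Rightarrow> real^2 \<Rightarrow> real^2^2" where
  "pullback_metric F w = (\<chi> i j. partial i F w \<bullet> partial j F w)"

text \<open>\<open>christoffel g k i j\<close> is the symbol with upper index \<open>k\<close> and lower indices \<open>i\<close>, \<open>j\<close>.\<close>

definition christoffel :: "(real^2 \<Rightarrow> real^2^2) \<Rightarrow> 2 \<Rightarrow> 2 \<Rightarrow> 2 \<Rightarrow> real^2 \<Rightarrow> real" where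
  "christoffel g k i j w =
     (\<Sum>l\<in>UNIV. matrix_inv (g w) $ k $ l *
        (partial i (\<lambda>z. g z $ j $ l) w + partial j (\<lambda>z. g z $ i $ l) w
         - partial l (\<lambda>z. g z $ i $ j) w)) / 2"

text \<open>\<open>curvature_tensor g l k i j\<close> is the \<open>l\<close>-th component of \<open>R(\<partial>\<^sub>i, \<partial>\<^sub>j) \<partial>\<^sub>k\<close>, where
  \<open>R(X, Y) = [\<nabla>\<^sub>X, \<nabla>\<^sub>Y] - \<nabla>\<^bsub>[X, Y]\<^esub>\<close> for the Levi-Civita connection \<open>\<nabla>\<close> of \<open>g\<close>.\<close>

definition curvature_tensor :: "(real^2 \<Rightarrow> real^2^2) \<Rightarrow> 2 \<Rightarrow> 2 \<Rightarrow> 2 \<Rightarrow> 2 \<Rightarrow> real^2 \<Rightarrow> real" where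
  "curvature_tensor g l k i j w =
     partial i (christoffel g l j k) w - partial j (christoffel g l i k) w
     + (\<Sum>m\<in>UNIV. christoffel g l i m w * christoffel g m j k w
                - christoffel g l j m w * christoffel g m i k w)"

text \<open>The sectional curvature \<open>\<langle>R(\<partial>\<^sub>1, \<partial>\<^sub>2) \<partial>\<^sub>2, \<partial>\<^sub>1\<rangle> / det g\<close>.\<close>

definition metric_curvature :: "(real^2 \<Rightarrow> real^2^2) \<Rightarrow> real^2 \<Rightarrow> real" where
  "metric_curvature g w =
     (\<Sum>l\<in>UNIV. g w $ 1 $ l * curvature_tensor g l 2 1 2 w) / det (g w)"

text \<open>The value at a regular point does not depend on the chosen chart; at singular points, where
  the metric degenerates, the value is meaningless.\<close>

definition gauss_curvature :: "'m chart set \<Rightarrow> ('m \<Rightarrow> real^3) \<Rightarrow> 'm \<Rightarrow> real" where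
  "gauss_curvature A f x =
     (let (U, \<phi>) = (SOME (U, \<phi>). (U, \<phi>) \<in> A \<and> x \<in> U)
      in metric_curvature (pullback_metric (in_chart U \<phi> f)) (\<phi> x))"


section \<open>The half-space at a generic swallowtail\<close>

definition limiting_tangent_plane :: "('m \<Rightarrow> real^3) \<Rightarrow> ('m \<Rightarrow> real^3) \<Rightarrow> 'm \<Rightarrow> (real^3) set" where
  "limiting_tangent_plane f \<nu> p = {y. (y - f p) \<bullet> \<nu> p = 0}"

definition null_vector ::
  "'m set \<Rightarrow> ('m \<Rightarrow> real^2) \<Rightarrow> ('m \<Rightarrow> real^3) \<Rightarrow> 'm \<Rightarrow> real^2 \<Rightarrow> bool" where
  "null_vector U \<phi> f x X \<longleftrightarrow> X \<noteq> 0 \<and> differential U \<phi> f x X = 0"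

definition regular_curve ::
  "'m::topological_space chart set \<Rightarrow> real set \<Rightarrow> (real \<Rightarrow> 'm) \<Rightarrow> bool" where
  "regular_curve A I \<sigma> \<longleftrightarrow>
     continuous_on I \<sigma> \<and>
     (\<forall>(U, \<phi>)\<in>A. smooth_on {t\<in>I. \<sigma> t \<in> U} (\<phi> \<circ> \<sigma>) \<and>
        (\<forall>t\<in>I. \<sigma> t \<in> U \<longrightarrow> vector_derivative (\<phi> \<circ> \<sigma>) (at t) \<noteq> 0))"

definition null_curve ::
  "'m::topological_space chart set \<Rightarrow> ('m \<Rightarrow> real^3) \<Rightarrow> real set \<Rightarrow> (real \<Rightarrow> 'm) \<Rightarrow> bool" where
  "null_curve A f I \<sigma> \<longleftrightarrow>
     regular_curve A I \<sigma> \<and>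
     (\<forall>(U, \<phi>)\<in>A. \<forall>t\<in>I. \<sigma> t \<in> U \<and> \<sigma> t \<in> singular_set A f \<longrightarrow>
        null_vector U \<phi> f (\<sigma> t) (vector_derivative (\<phi> \<circ> \<sigma>) (at t)))"

text \<open>This is a relation and not a function: at most one half-space has the property,
  but there may be none. For instance, \<open>(x, y, z) = swallowtail_form (u, v)\<close> followed by
  \<open>(x, y, z) \<mapsto> (x - z\<^sup>2, y, z)\<close> has a generic swallowtail at the origin, with limiting tangent plane
  \<open>x = 0\<close>, and the images of the null curves \<open>t \<mapsto> (t, 0)\<close> and \<open>t \<mapsto> (t, 4 t\<^sup>2)\<close> have first
  coordinates \<open>3 t\<^sup>4\<close> and \<open>-9 t\<^sup>4\<close>.\<close>

definition half_space_at ::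
  "'m::topological_space chart set \<Rightarrow> ('m \<Rightarrow> real^3) \<Rightarrow> ('m \<Rightarrow> real^3) \<Rightarrow> 'm \<Rightarrow> (real^3) set \<Rightarrow> bool" where
  "half_space_at A f \<nu> p H \<longleftrightarrow>
     (\<exists>a b. a \<noteq> 0 \<and> H = {y. a \<bullet> y \<le> b}) \<and>
     frontier H = limiting_tangent_plane f \<nu> p \<and>
     (\<forall>a b \<sigma>. a < 0 \<and> 0 < b \<and> null_curve A f {a<..<b} \<sigma> \<and> \<sigma> 0 = p \<longrightarrow>
        (\<forall>\<^sub>F t in at 0. f (\<sigma> t) \<in> H))"

definition sgn_0 :: "('m \<Rightarrow> real^3) \<Rightarrow> ('m \<Rightarrow> real^3) \<Rightarrow> 'm \<Rightarrow> (real^3) set \<Rightarrow> real" where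
  "sgn_0 f \<nu> p H =
     (if \<forall>\<^sub>F s in at_right 0. f p + s *\<^sub>R \<nu> p \<in> interior H then 1 else -1)"


section \<open>Outward normals\<close>

definition thin_component :: "(real^3) set \<Rightarrow> (real^3 \<Rightarrow> real^3) \<Rightarrow> (real^3) set" where
  "thin_component V \<Phi> = {y\<in>V. (\<Phi> y $ 2)^2 < (\<Phi> y $ 1)^3}"

text \<open>At the points of \<open>D\<close> that are close to the cuspidal edge \<open>q\<close>, the vector \<open>\<nu>\<close> points away from
  the thin component; \<open>D\<close> should consist of regular points. Up to shrinking neighborhoods,
  the thin component does not depend on the choice of the diffeomorphism germs.\<close>

definition outward_near ::
  "'m::topological_space chart set \<Rightarrow> ('m \<Rightarrow> real^3) \<Rightarrow> ('m \<Rightarrow> real^3) \<Rightarrow> 'm \<Rightarrow> 'm set \<Rightarrow> bool" where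
  "outward_near A f \<nu> q D \<longleftrightarrow>
     (\<exists>U \<psi> V \<Phi>. normalizes A f q cuspidal_edge_form U \<psi> V \<Phi> \<and>
        (\<forall>x\<in>U \<inter> D. \<forall>\<^sub>F s in at_right 0. f x + s *\<^sub>R \<nu> x \<notin> thin_component V \<Phi>))"

text \<open>The side of the singular curve, within a neighborhood \<open>W\<close> of the swallowtail, on which a
  connected set \<open>\<Delta>\<close> of regular points lies. The cuspidal edges adjacent to \<open>\<Delta>\<close> are
  those in \<open>W\<close> which bound this side, so that \<open>\<Delta>\<close> itself need not touch the singular curve.\<close>

definition side :: "'m::topological_space chart set \<Rightarrow> ('m \<Rightarrow> real^3) \<Rightarrow> 'm set \<Rightarrow> 'm set \<Rightarrow> 'm set" where
  "side A f W \<Delta> = (\<Union>x\<in>\<Delta>. connected_component_set (W - singular_set A f) x)"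

definition sgn_domain ::
  "'m::topological_space chart set \<Rightarrow> ('m \<Rightarrow> real^3) \<Rightarrow> ('m \<Rightarrow> real^3) \<Rightarrow> 'm set \<Rightarrow> 'm set \<Rightarrow> real" where
  "sgn_domain A f \<nu> W \<Delta> =
     (if \<forall>q\<in>W \<inter> closure (side A f W \<Delta>). cuspidal_edge A f q \<longrightarrow> outward_near A f \<nu> q (side A f W \<Delta>)
      then 1 else -1)"

end

theory Submission
  imports Defs
begin

text \<open>In the source coordinates \<open>(u, v)\<close> of the normal form, \<open>f = G \<circ> swallowtail_form\<close> for a local
  diffeomorphism \<open>G\<close> of space. Put \<open>\<lambda> = 12 u\<^sup>2 + 2 v\<close>, whose zero set is the singular curve. Then
  \<open>f\<^sub>u = \<lambda> e\<close> with \<open>e = u G\<^sub>x + G\<^sub>y\<close>, and \<open>e\<close>, \<open>f\<^sub>v\<close> span the limiting tangent planes. The determinants of the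
  first and the second fundamental form are \<open>\<lambda>\<^sup>2\<close> times a positive function and \<open>\<lambda> B\<close>, and
  \<open>B(p) = \<alpha> \<beta>\<close> with \<open>\<alpha> = G\<^sub>x(0) \<bullet> \<nu>(p)\<close> and \<open>\<beta> = h(\<partial>\<^sub>v, \<partial>\<^sub>v)\<close> at \<open>p\<close>. Transversality gives \<open>\<alpha> \<noteq> 0\<close> and genericity gives
  \<open>\<beta> \<noteq> 0\<close>, so the Gaussian curvature is unbounded like \<open>1 / \<lambda>\<close> and has the sign of \<open>\<alpha> \<beta> \<lambda>\<close>.

  The null curve \<open>t \<mapsto> (t, c t\<^sup>2)\<close> has height \<open>(\<alpha> (3 + c) + \<beta> c\<^sup>2 / 2) t\<^sup>4 + o(t\<^sup>4)\<close> over the limiting tangent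
  plane. If all null curves lie in one half-space, then \<open>\<alpha> \<beta> > 0\<close> and \<open>\<nu>(p)\<close> points into it iff
  \<open>\<alpha> > 0\<close>. Factoring the quartics with a triple root yields explicit cuspidal edge coordinates at the
  other singular points, in which \<open>\<nu>\<close> is outward iff \<open>\<alpha> \<lambda> > 0\<close>. The product of the two signs is
  that of \<open>\<lambda>\<close>, hence that of the curvature.\<close>


section \<open>Calculus of smooth maps\<close>

text \<open>Two definitions shape the work. \<open>gauss_curvature\<close> is intrinsic and picks an
  arbitrary chart, so the Gauss equation and the common scaling of both determinants under changes
  of coordinates come first. \<open>outward_near\<close> asks for some normal form of the cuspidal
  edge; to refute it, every normal form must be controlled, hence the invariance of the thin
  component under diffeomorphisms preserving the cusp. The parabolas come from weights: with u of
  weight 1 and v of weight 2, the coordinate x of the swallowtail has weight 4, and so has the term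
  in v^2 governed by \<beta>. A null curve thus feels \<alpha> and \<beta> at the same order, and
  varying c separates them. The product in B(p) arises because f_uv = 2 e at p is tangent, which
  kills the off-diagonal term. The swallowtail is the discriminant of quartics and the cuspidal edge
  that of cubics; splitting off a simple root therefore gives the normal form at nearby singular
  points by a formula.\<close>

lemma frechet_derivative_eqI:
  "(f has_derivative f') (at x) \<Longrightarrow> frechet_derivative f (at x) = f'"
  by (metis frechet_derivative_at)

lemma has_derivative_frechet:
  "f differentiable (at x) \<Longrightarrow> (f has_derivative frechet_derivative f (at x)) (at x)"
  by (simp add: frechet_derivative_works)

lemma Ck_on_Suc_imp: "Ck_on (Suc k) S f \<Longrightarrow> Ck_on k S f"
proof (induction k arbitrary: f)
  case 0
  then show ?case
    by (auto intro!: continuous_at_imp_continuous_on differentiable_imp_continuous_within)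
next
  case (Suc k)
  then show ?case by (metis Ck_on.simps(2))
qed

text \<open>Smoothness is a fixed point of differentiation in fixed directions, so orders need not
  be tracked. In the converse only the orders \<open>Suc k\<close> arise directly; order 0 follows
  because the classes decrease.\<close>

lemma smooth_on_iff:
  "smooth_on S f \<longleftrightarrow>
     (\<forall>x\<in>S. f differentiable (at x)) \<and> (\<forall>v. smooth_on S (\<lambda>x. frechet_derivative f (at x) v))"
proof
  assume f: "smooth_on S f"
  then have "Ck_on (Suc k) S f" for k by (simp only: smooth_on_def)
  then show "(\<forall>x\<in>S. f differentiable (at x)) \<and> (\<forall>v. smooth_on S (\<lambda>x. frechet_derivative f (at x) v))"
    by (simp add: smooth_on_def)
next
  assume a: "(\<forall>x\<in>S. f differentiable (at x)) \<and> (\<forall>v. smooth_on S (\<lambda>x. frechet_derivative f (at x) v))"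
  then have "Ck_on (Suc k) S f" for k by (simp add: smooth_on_def)
  then show "smooth_on S f" unfolding smooth_on_def using Ck_on_Suc_imp by blast
qed

lemma smooth_on_imp_differentiable: "smooth_on S f \<Longrightarrow> x \<in> S \<Longrightarrow> f differentiable (at x)"
  using smooth_on_iff by blast

lemma smooth_on_imp_has_derivative:
  "smooth_on S f \<Longrightarrow> x \<in> S \<Longrightarrow> (f has_derivative frechet_derivative f (at x)) (at x)"
  by (simp add: has_derivative_frechet smooth_on_imp_differentiable)

lemma smooth_on_frechet_derivative: "smooth_on S f \<Longrightarrow> smooth_on S (\<lambda>x. frechet_derivative f (at x) v)"
  using smooth_on_iff by blast

lemma smooth_on_imp_continuous_on: "smooth_on S f \<Longrightarrow> continuous_on S f"
  by (metis Ck_on.simps(1) smooth_on_def)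

lemma smooth_on_imp_isCont: "smooth_on S f \<Longrightarrow> x \<in> S \<Longrightarrow> isCont f x"
  by (simp add: differentiable_imp_continuous_within smooth_on_imp_differentiable)

lemma Ck_on_subset: "Ck_on k T f \<Longrightarrow> S \<subseteq> T \<Longrightarrow> Ck_on k S f"
  by (induction k arbitrary: f) (auto intro: continuous_on_subset)

lemma smooth_on_subset: "smooth_on T f \<Longrightarrow> S \<subseteq> T \<Longrightarrow> smooth_on S f"
  using Ck_on_subset unfolding smooth_on_def by blast

text \<open>A derivative at a point sees a whole neighborhood, so agreement on \<open>S\<close>
  passes to derivatives because \<open>S\<close> is open; the values off \<open>S\<close> are
  arbitrary.\<close>

lemma Ck_on_cong:
  assumes "open S" "\<And>x. x \<in> S \<Longrightarrow> f x = g x" "Ck_on k S f"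
  shows "Ck_on k S g"
  using assms(2,3)
proof (induction k arbitrary: f g)
  case 0
  then show ?case using continuous_on_cong by (metis Ck_on.simps(1))
next
  case (Suc k)
  have *: "(g has_derivative frechet_derivative f (at x)) (at x)" if "x \<in> S" for x
    using has_derivative_transform_within_open[OF _ assms(1) that, of f "frechet_derivative f (at x)" UNIV g]
      Suc.prems that has_derivative_frechet[of f x] by auto
  show ?case
    unfolding Ck_on.simps
  proof (intro conjI ballI allI)
    show "g differentiable at x" if "x \<in> S" for x
      using *[OF that] differentiable_def by blast
    show "Ck_on k S (\<lambda>x. frechet_derivative g (at x) v)" for v
    proof (rule Suc.IH)
      show "Ck_on k S (\<lambda>x. frechet_derivative f (at x) v)" using Suc.prems(2) by simp
      show "frechet_derivative f (at x) v = frechet_derivative g (at x) v" if "x \<in> S" for x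
        by (simp only: frechet_derivative_eqI[OF *[OF that]])
    qed
  qed
qed

lemma smooth_on_cong:
  assumes "open S" "\<And>x. x \<in> S \<Longrightarrow> f x = g x" "smooth_on S f"
  shows "smooth_on S g"
  using assms Ck_on_cong unfolding smooth_on_def by blast

lemma Ck_on_SucI:
  assumes "open S" "\<And>x. x \<in> S \<Longrightarrow> (f has_derivative f' x) (at x)"
    and "\<And>v. Ck_on k S (\<lambda>x. f' x v)"
  shows "Ck_on (Suc k) S f"
proof -
  have "Ck_on k S (\<lambda>x. frechet_derivative f (at x) v)" for v
    by (rule Ck_on_cong[OF assms(1) _ assms(3)]) (simp add: frechet_derivative_eqI[OF assms(2)])
  then show ?thesis using assms(2) by (auto simp: differentiable_def)
qed

section \<open>Closure of smooth maps under algebra and composition\<close>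

lemma Ck_on_const: "Ck_on k S (\<lambda>x. c)"
  by (induction k arbitrary: c) auto

lemma smooth_on_const [intro, simp]: "smooth_on S (\<lambda>x. c)"
  by (simp add: smooth_on_def Ck_on_const)

lemma (in bounded_linear) smooth_on: "smooth_on S f"
proof -
  have "frechet_derivative f (at x) = f" for x
    using frechet_derivative_eqI has_derivative bounded_linear_axioms
    by (metis bounded_linear_imp_has_derivative)
  then show ?thesis
    unfolding smooth_on_iff[of S f]
    using bounded_linear_axioms bounded_linear_imp_differentiable by auto
qed

lemma smooth_on_ident [intro, simp]: "smooth_on S (\<lambda>x. x)"
  by (rule bounded_linear.smooth_on) (rule bounded_linear_ident)

lemma Ck_on_add:
  assumes "open S" "Ck_on k S f" "Ck_on k S g"
  shows "Ck_on k S (\<lambda>x. f x + g x)"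
  using assms(2,3)
proof (induction k arbitrary: f g)
  case 0
  then show ?case by (simp add: continuous_on_add)
next
  case (Suc k)
  show ?case
    by (rule Ck_on_SucI[OF assms(1), where f'="\<lambda>x v. frechet_derivative f (at x) v + frechet_derivative g (at x) v"])
      (use Suc in \<open>auto intro!: has_derivative_add has_derivative_frechet\<close>)
qed

lemma Ck_on_sum:
  assumes "open S" "\<And>i. i \<in> I \<Longrightarrow> Ck_on k S (f i)"
  shows "Ck_on k S (\<lambda>x. \<Sum>i\<in>I. f i x)"
  using assms(2)
  by (induction I rule: infinite_finite_induct) (auto intro!: Ck_on_const Ck_on_add assms(1))

lemma Ck_on_bilinear:
  assumes "bounded_bilinear bop" "open S" "Ck_on k S f" "Ck_on k S g"
  shows "Ck_on k S (\<lambda>x. bop (f x) (g x))"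
  using assms(3,4)
proof (induction k arbitrary: f g)
  case 0
  then show ?case using bounded_bilinear.continuous_on[OF assms(1)] by auto
next
  case (Suc k)
  have l: "Ck_on k S f" "Ck_on k S g" using Suc.prems Ck_on_Suc_imp by auto
  show ?case
    by (rule Ck_on_SucI[OF assms(2), where f'="\<lambda>x v. bop (f x) (frechet_derivative g (at x) v)
          + bop (frechet_derivative f (at x) v) (g x)"])
      (use Suc l in \<open>auto intro!: bounded_bilinear.FDERIV[OF assms(1)] has_derivative_frechet Ck_on_add assms\<close>)
qed

text \<open>The chain rule evaluates the derivative of \<open>f\<close> in the direction
  \<open>Dg x v\<close>, which moves with \<open>x\<close>, while \<open>Ck_on\<close> only speaks
  of fixed directions. Expanding that direction in the basis turns the derivative into a sum of
  scalar coefficients times derivatives of \<open>f\<close> in fixed directions, to which the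
  induction hypothesis applies.\<close>

lemma Ck_on_compose:
  fixes g :: "'a::real_normed_vector \<Rightarrow> 'b::euclidean_space" and f :: "'b \<Rightarrow> 'c::real_normed_vector"
  assumes "open S" "open T" "Ck_on k T f" "Ck_on k S g" "g ` S \<subseteq> T"
  shows "Ck_on k S (\<lambda>x. f (g x))"
  using assms(3,4)
proof (induction k arbitrary: f)
  case 0
  then show ?case using assms(5) by (auto intro: continuous_on_compose2)
next
  case (Suc k)
  let ?Df = "\<lambda>y. frechet_derivative f (at y)" and ?Dg = "\<lambda>x. frechet_derivative g (at x)"
  have gk: "Ck_on k S g" using Suc.prems Ck_on_Suc_imp by blast
  have lin: "?Df (g x) w = (\<Sum>b\<in>Basis. (w \<bullet> b) *\<^sub>R ?Df (g x) b)" if "x \<in> S" for x w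
  proof -
    have "linear (?Df (g x))"
      using Suc.prems(1) assms(5) that
      by (intro has_derivative_linear[OF has_derivative_frechet]) auto
    then show ?thesis
      by (subst (1) euclidean_representation[of w, symmetric]) (simp add: linear_sum linear_cmul)
  qed
  show ?case
  proof (rule Ck_on_SucI[OF assms(1), where f'="\<lambda>x v. \<Sum>b\<in>Basis. (?Dg x v \<bullet> b) *\<^sub>R ?Df (g x) b"])
    fix x assume x: "x \<in> S"
    have "((f \<circ> g) has_derivative (?Df (g x) \<circ> ?Dg x)) (at x)"
      using Suc.prems x assms(5) by (intro diff_chain_at has_derivative_frechet) auto
    then show "((\<lambda>x. f (g x)) has_derivative (\<lambda>v. \<Sum>b\<in>Basis. (?Dg x v \<bullet> b) *\<^sub>R ?Df (g x) b)) (at x)"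
      unfolding o_def lin[OF x, of "?Dg x _", symmetric] .
  next
    fix v
    show "Ck_on k S (\<lambda>x. \<Sum>b\<in>Basis. (?Dg x v \<bullet> b) *\<^sub>R ?Df (g x) b)"
      using Suc.prems gk
      by (intro Ck_on_sum assms Ck_on_bilinear[OF bounded_bilinear_scaleR]
          Ck_on_bilinear[OF bounded_bilinear_inner] Ck_on_const Suc.IH) auto
  qed
qed

lemma smooth_on_add:
  "open S \<Longrightarrow> smooth_on S f \<Longrightarrow> smooth_on S g \<Longrightarrow> smooth_on S (\<lambda>x. f x + g x)"
  by (simp add: smooth_on_def Ck_on_add)

lemma smooth_on_bilinear:
  "bounded_bilinear bop \<Longrightarrow> open S \<Longrightarrow> smooth_on S f \<Longrightarrow> smooth_on S g \<Longrightarrow> smooth_on S (\<lambda>x. bop (f x) (g x))"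
  by (simp add: smooth_on_def Ck_on_bilinear)

lemmas smooth_on_mult = smooth_on_bilinear[OF bounded_bilinear_mult]
lemmas smooth_on_inner = smooth_on_bilinear[OF bounded_bilinear_inner]
lemmas smooth_on_scaleR = smooth_on_bilinear[OF bounded_bilinear_scaleR]

lemma smooth_on_sum:
  "open S \<Longrightarrow> (\<And>i. i \<in> I \<Longrightarrow> smooth_on S (f i)) \<Longrightarrow> smooth_on S (\<lambda>x. \<Sum>i\<in>I. f i x)"
  by (simp add: smooth_on_def Ck_on_sum)

lemma smooth_on_compose:
  fixes g :: "'a::real_normed_vector \<Rightarrow> 'b::euclidean_space" and f :: "'b \<Rightarrow> 'c::real_normed_vector"
  assumes "open S" "open T" "smooth_on T f" "smooth_on S g" "g ` S \<subseteq> T"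
  shows "smooth_on S (\<lambda>x. f (g x))"
  using assms Ck_on_compose unfolding smooth_on_def by metis

lemma smooth_on_bounded_linear_compose:
  fixes g :: "'a::real_normed_vector \<Rightarrow> 'b::euclidean_space"
  assumes "bounded_linear f" "open S" "smooth_on S g"
  shows "smooth_on S (\<lambda>x. f (g x))"
  by (rule smooth_on_compose[OF assms(2) open_UNIV]) (use assms bounded_linear.smooth_on in auto)

lemma smooth_on_minus:
  assumes "open S" "smooth_on S f"
  shows "smooth_on S (\<lambda>x. - f x)"
  using smooth_on_scaleR[OF assms(1) smooth_on_const[of S "-1::real"] assms(2)] by simp

lemma smooth_on_diff:
  assumes "open S" "smooth_on S f" "smooth_on S g"
  shows "smooth_on S (\<lambda>x. f x - g x)"
  using smooth_on_add[OF assms(1,2) smooth_on_minus[OF assms(1,3)]] by simp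

lemma smooth_on_power:
  fixes f :: "'a::real_normed_vector \<Rightarrow> real"
  shows "open S \<Longrightarrow> smooth_on S f \<Longrightarrow> smooth_on S (\<lambda>x. f x ^ n)"
proof (induction n)
  case (Suc n)
  then show ?case using smooth_on_mult[of S f "\<lambda>x. f x ^ n"] by simp
qed simp

lemma smooth_on_prod:
  fixes f :: "'i \<Rightarrow> 'a::real_normed_vector \<Rightarrow> real"
  assumes "open S" "\<And>i. i \<in> I \<Longrightarrow> smooth_on S (f i)"
  shows "smooth_on S (\<lambda>x. \<Prod>i\<in>I. f i x)"
  using assms(2)
  by (induction I rule: infinite_finite_induct) (auto intro!: smooth_on_mult assms(1))

text \<open>The derivative of the inverse is a polynomial in the inverse itself, so each order of
  regularity yields the next.\<close>

lemma smooth_on_inverse_real: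
  fixes f :: "'a::real_normed_vector \<Rightarrow> real"
  assumes "open S" "smooth_on S f" "\<And>x. x \<in> S \<Longrightarrow> f x \<noteq> 0"
  shows "smooth_on S (\<lambda>x. inverse (f x))"
proof -
  have "Ck_on k (- {0}) (inverse :: real \<Rightarrow> real)" for k
  proof (induction k)
    case 0
    then show ?case using continuous_on_inverse[OF continuous_on_id, of "- {0 :: real}"] by simp
  next
    case (Suc k)
    note mult = Ck_on_bilinear[OF bounded_bilinear_mult open_Compl[OF closed_singleton[of "0::real"]]]
    have "Ck_on k (- {0}) (\<lambda>x::real. (-1) * (inverse x * v * inverse x))" for v
      by (intro mult Ck_on_const Suc)
    then have *: "Ck_on k (- {0}) (\<lambda>x::real. - (inverse x * v * inverse x))" for v by simp
    have "(inverse has_derivative (\<lambda>v. - (inverse x * v * inverse x))) (at x)" if "x \<in> - {0}" for x :: real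
      using that by (intro has_derivative_inverse') simp
    then show ?case by (rule Ck_on_SucI[OF open_Compl[OF closed_singleton] _ *])
  qed
  then have "smooth_on (- {0}) (inverse :: real \<Rightarrow> real)" by (simp add: smooth_on_def)
  then show ?thesis
    by (rule smooth_on_compose[OF assms(1) open_Compl[OF closed_singleton] _ assms(2)]) (use assms(3) in auto)
qed

lemma smooth_on_divide_real:
  fixes f :: "'a::real_normed_vector \<Rightarrow> real"
  assumes "open S" "smooth_on S f" "smooth_on S g" "\<And>x. x \<in> S \<Longrightarrow> g x \<noteq> 0"
  shows "smooth_on S (\<lambda>x. f x / g x)"
  unfolding divide_inverse by (intro smooth_on_mult smooth_on_inverse_real assms)

lemma smooth_on_component:
  fixes f :: "'a::real_normed_vector \<Rightarrow> real^'n"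
  shows "open S \<Longrightarrow> smooth_on S f \<Longrightarrow> smooth_on S (\<lambda>x. f x $ i)"
  by (rule smooth_on_bounded_linear_compose[OF bounded_linear_vec_nth])

lemma smooth_on_componentwise:
  fixes f :: "'a::real_normed_vector \<Rightarrow> real^'n"
  assumes "open S" "\<And>i. smooth_on S (\<lambda>x. f x $ i)"
  shows "smooth_on S f"
proof -
  have "(\<Sum>i\<in>UNIV. (f x $ i) *\<^sub>R axis i 1) = f x" for x
    by (simp add: vec_eq_iff axis_def if_distrib cong: if_cong)
  moreover have "smooth_on S (\<lambda>x. \<Sum>i\<in>UNIV. (f x $ i) *\<^sub>R axis i 1 :: real^'n)"
    by (rule smooth_on_sum[OF assms(1)], rule smooth_on_scaleR[OF assms smooth_on_const])
  ultimately show ?thesis by simp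
qed

lemma smooth_on_vector2:
  fixes f :: "'a::real_normed_vector \<Rightarrow> real"
  assumes "open S" "smooth_on S f" "smooth_on S g"
  shows "smooth_on S (\<lambda>x. vector [f x, g x] :: real^2)"
proof (rule smooth_on_componentwise[OF assms(1)])
  fix i :: 2
  show "smooth_on S (\<lambda>x. (vector [f x, g x] :: real^2) $ i)"
    using assms exhaust_2[of i] by auto
qed

lemma smooth_on_vector3:
  fixes f :: "'a::real_normed_vector \<Rightarrow> real"
  assumes "open S" "smooth_on S f" "smooth_on S g" "smooth_on S h"
  shows "smooth_on S (\<lambda>x. vector [f x, g x, h x] :: real^3)"
proof (rule smooth_on_componentwise[OF assms(1)])
  fix i :: 3
  show "smooth_on S (\<lambda>x. (vector [f x, g x, h x] :: real^3) $ i)"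
    using assms exhaust_3[of i] by auto
qed

lemmas smooth_on_intros = smooth_on_const smooth_on_ident smooth_on_add smooth_on_diff smooth_on_minus
  smooth_on_mult smooth_on_inner smooth_on_scaleR smooth_on_power smooth_on_component
  smooth_on_vector2 smooth_on_vector3 smooth_on_frechet_derivative


lemma smooth_on_det:
  fixes M :: "'a::real_normed_vector \<Rightarrow> real^'n^'n"
  assumes "open S" "\<And>i j. smooth_on S (\<lambda>x. M x $ i $ j)"
  shows "smooth_on S (\<lambda>x. det (M x))"
  unfolding det_def by (intro smooth_on_sum smooth_on_mult smooth_on_prod smooth_on_const assms)

section \<open>Smooth inverse function theorem\<close>

text \<open>The continuously differentiable version provides the inverse \<open>g\<close> and its
  derivative, the inverse of the differential at \<open>g y\<close>. By Cramer's rule this is a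
  rational function of the entries of the Jacobian matrix at \<open>g y\<close>, so if
  \<open>g\<close> is of class C^k then so is its derivative, and \<open>g\<close> is of class
  C^(k+1).\<close>

theorem smooth_inverse_function_theorem:
  fixes f :: "real^'n \<Rightarrow> real^'n"
  assumes "open S" "smooth_on S f" "x0 \<in> S" "inj (frechet_derivative f (at x0))"
  obtains V where "V \<subseteq> S" "x0 \<in> V" "diffeomorphism_on V f"
proof -
  let ?D = "\<lambda>x. frechet_derivative f (at x)"
  have der: "(f has_derivative ?D x) (at x)" if "x \<in> S" for x
    using assms(2) that by (rule smooth_on_imp_has_derivative)
  have bl: "bounded_linear (?D x)" if "x \<in> S" for x
    using der[OF that] by (rule has_derivative_bounded_linear)
  \<comment> \<open>The differential has to be continuous as a map into bounded operators; in finite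
    dimension it is enough that its values on fixed vectors are continuous.\<close>
  define f' where "f' x = Blinfun (?D x)" for x
  have app: "blinfun_apply (f' x) = ?D x" if "x \<in> S" for x
    using bl[OF that] by (simp add: f'_def bounded_linear_Blinfun_apply)
  have "continuous_on S f'"
  proof (rule continuous_on_blinfun_componentwise)
    fix i :: "real^'n"
    have "continuous_on S (\<lambda>x. ?D x i)"
      by (intro smooth_on_imp_continuous_on smooth_on_frechet_derivative assms)
    then show "continuous_on S (\<lambda>x. blinfun_apply (f' x) i)"
      using app by (simp cong: continuous_on_cong)
  qed
  moreover obtain g' where g': "linear g'" "g' \<circ> ?D x0 = id"
    using linear_injective_left_inverse[OF has_derivative_linear[OF der[OF assms(3)]] assms(4)] by blast
  then have "Blinfun g' o\<^sub>L f' x0 = id_blinfun"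
    using app[OF assms(3)]
    by (intro blinfun_eqI)
      (simp add: bounded_linear_Blinfun_apply linear_conv_bounded_linear[symmetric] fun_eq_iff)
  ultimately obtain U' V g g'' where *: "open U'" "U' \<subseteq> S" "x0 \<in> U'" "open V" "f x0 \<in> V"
    "homeomorphism U' V f g" "\<And>y. y \<in> V \<Longrightarrow> (g has_derivative (g'' y)) (at y)"
    "\<And>y. y \<in> V \<Longrightarrow> g'' y = inv (blinfun_apply (f'(g y)))"
    "\<And>y. y \<in> V \<Longrightarrow> bij (blinfun_apply (f'(g y)))"
    using inverse_function_theorem[OF assms(1), of f f' x0 "Blinfun g'"] der app assms(3) by metis
  have gU: "g ` V = U'" "f ` U' = V" and fg: "\<And>x. x \<in> U' \<Longrightarrow> g (f x) = x"
    using *(6) by (auto simp: homeomorphism_def)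
  have gS: "g y \<in> S" if "y \<in> V" for y using gU *(2) that by blast
  have D: "g'' y = inv (?D (g y))" "bij (?D (g y))" if "y \<in> V" for y
    using *(8,9)[OF that] app[OF gS[OF that]] by auto
  define M where "M y = matrix (?D (g y))" for y
  have Mv: "M y *v w = ?D (g y) w" if "y \<in> V" for y w
    unfolding M_def using bl[OF gS[OF that]] by (simp add: bounded_linear.linear)
  have detM: "det (M y) \<noteq> 0" if "y \<in> V" for y
  proof -
    have lin: "linear (?D (g y))" using bl[OF gS[OF that]] by (simp add: bounded_linear.linear)
    then show ?thesis
      unfolding M_def using matrix_invertible[of "?D (g y)"] D(2)[OF that]
      by (metis bij_is_inj det_nz_iff_inj)
  qed
  have cramer': "g'' y v = (\<chi> k. det (\<chi> i j. if j = k then v$i else M y$i$j) / det (M y))" if "y \<in> V" for y v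
  proof -
    have "M y *v (g'' y v) = v"
      using Mv[OF that] D[OF that] by (simp add: bij_is_surj surj_f_inv_f)
    then show ?thesis by (rule iffD1[OF cramer[OF detM[OF that]]])
  qed
  have "Ck_on k V g" for k
  proof (induction k)
    case 0
    then show ?case using *(6) by (simp add: homeomorphism_def)
  next
    case (Suc k)
    have entry: "Ck_on k V (\<lambda>y. M y $ i $ j)" for i j
    proof -
      have "Ck_on k V (\<lambda>y. ?D (g y) (axis j 1) $ i)"
      proof (rule Ck_on_compose[OF *(4) assms(1) _ Suc])
        show "Ck_on k S (\<lambda>x. ?D x (axis j 1) $ i)"
          using smooth_on_component[OF assms(1) smooth_on_frechet_derivative[OF assms(2)]]
          by (simp add: smooth_on_def)
      qed (use gS in blast)
      then show ?thesis by (simp add: M_def matrix_def)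
    qed
    show ?case
    proof (rule Ck_on_SucI[OF *(4) *(7)])
      fix v :: "real^'n"
      let ?h = "\<lambda>N :: real^'n^'n. (\<chi> k. det (\<chi> i j. if j = k then v$i else N$i$j) / det N) :: real^'n"
      let ?T = "{N :: real^'n^'n. det N \<noteq> 0}"
      have "?T = (\<lambda>N. det N) -` (- {0})" by auto
      moreover have sm: "smooth_on UNIV (\<lambda>N :: real^'n^'n. det N)"
        by (intro smooth_on_det smooth_on_component open_UNIV
             smooth_on_bounded_linear_compose[OF bounded_linear_vec_nth] smooth_on_ident)
      ultimately have oT: "open ?T"
        using smooth_on_imp_continuous_on[OF sm] by (metis open_vimage open_Compl closed_singleton)
      \<comment> \<open>Composing with the rational map \<open>?h\<close> needs the matrix-valued
        map \<open>M\<close> as a whole; it is rebuilt from its entries with matrix units.\<close>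
      have cM: "Ck_on k V M"
      proof -
        have "(\<Sum>i\<in>UNIV. \<Sum>j\<in>UNIV. (M x $ i $ j) *\<^sub>R axis i (axis j 1)) $ k $ l = M x $ k $ l" for x k l
        proof -
          have "(\<Sum>i\<in>UNIV. \<Sum>j\<in>UNIV. (M x $ i $ j) *\<^sub>R axis i (axis j 1)) $ k $ l
             = (\<Sum>i\<in>UNIV. \<Sum>j\<in>UNIV. if k = i then if l = j then M x $ i $ j else 0 else 0)"
            unfolding sum_component by (intro sum.cong refl) (simp add: axis_def)
          also have "\<dots> = (\<Sum>i\<in>UNIV. if k = i then M x $ i $ l else 0)"
            by (intro sum.cong refl) simp
          also have "\<dots> = M x $ k $ l" by simp
          finally show ?thesis .
        qed
        then have "M = (\<lambda>x. \<Sum>i\<in>UNIV. \<Sum>j\<in>UNIV. (M x $ i $ j) *\<^sub>R axis i (axis j 1))"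
          by (simp add: fun_eq_iff vec_eq_iff)
        moreover have "Ck_on k V (\<lambda>x. \<Sum>i\<in>UNIV. \<Sum>j\<in>UNIV. (M x $ i $ j) *\<^sub>R axis i (axis j 1) :: real^'n^'n)"
          by (intro Ck_on_sum *(4) Ck_on_bilinear[OF bounded_bilinear_scaleR] entry Ck_on_const)
        ultimately show ?thesis by simp
      qed
      have "smooth_on ?T ?h"
      proof (rule smooth_on_componentwise[OF oT])
        fix l :: 'n
        have "smooth_on ?T (\<lambda>N :: real^'n^'n. (\<chi> i j. if j = l then v $ i else N $ i $ j) $ i $ j)" for i j
          by (cases "j = l") (auto intro!: smooth_on_component oT smooth_on_bounded_linear_compose[OF bounded_linear_vec_nth])
        then have "smooth_on ?T (\<lambda>N :: real^'n^'n. det (\<chi> i j. if j = l then v$i else N$i$j) / det N)"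
          by (intro smooth_on_divide_real smooth_on_det oT smooth_on_subset[OF sm])
            (auto simp: smooth_on_subset[OF sm])
        then show "smooth_on ?T (\<lambda>N. ?h N $ l)" by simp
      qed
      then have "Ck_on k ?T ?h" by (simp add: smooth_on_def)
      then have "Ck_on k V (\<lambda>y. ?h (M y))"
        by (rule Ck_on_compose[OF *(4) oT _ cM]) (use detM in auto)
      then show "Ck_on k V (\<lambda>y. g'' y v)"
        by (rule Ck_on_cong[OF *(4), rotated]) (simp add: cramer')
    qed
  qed
  then have "smooth_on V g" by (simp add: smooth_on_def)
  moreover have "inv_into U' f y = g y" if "y \<in> V" for y
    using that gU fg by (metis imageI image_iff inv_into_f_f inj_on_inverseI)
  ultimately have "smooth_on V (inv_into U' f)"
    using smooth_on_cong[OF *(4)] by metis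
  then have "diffeomorphism_on U' f"
    unfolding diffeomorphism_on_def gU(2)
    using *(1,4) inj_on_inverseI[of U' g f, OF fg] smooth_on_subset[OF assms(2) *(2)] by simp
  then show thesis using that *(2,3) by blast
qed

section \<open>Symmetry of second derivatives\<close>

text \<open>The mean value theorem is applied twice, first along \<open>v\<close> to the difference
  in direction \<open>w\<close>, then along \<open>w\<close>. The second difference does not change
  when \<open>v\<close> and \<open>w\<close> are swapped, which is what symmetry of the second
  derivative rests on.\<close>

lemma second_difference_mean_value:
  fixes f :: "'a::real_normed_vector \<Rightarrow> real"
  assumes "smooth_on (ball x r) f" "0 < h" "h * (norm v + norm w) < r"
  obtains s t where "0 < s" "s < h" "0 < t" "t < h"
    "f (x + h *\<^sub>R v + h *\<^sub>R w) - f (x + h *\<^sub>R v) - f (x + h *\<^sub>R w) + f x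
      = h * h * frechet_derivative (\<lambda>y. frechet_derivative f (at y) v) (at (x + s *\<^sub>R v + t *\<^sub>R w)) w"
proof -
  have inb: "x + s *\<^sub>R v + t *\<^sub>R w \<in> ball x r" if "0 \<le> s" "s \<le> h" "0 \<le> t" "t \<le> h" for s t
  proof -
    have "norm (s *\<^sub>R v + t *\<^sub>R w) \<le> s * norm v + t * norm w"
      using norm_triangle_ineq[of "s *\<^sub>R v" "t *\<^sub>R w"] that by simp
    also have "\<dots> \<le> h * norm v + h * norm w" using that by (intro add_mono mult_right_mono) auto
    finally show ?thesis
      using assms(3) by (simp add: dist_norm algebra_simps norm_minus_commute)
  qed
  have d1: "((\<lambda>s. f (x + s *\<^sub>R v + t *\<^sub>R w)) has_real_derivative frechet_derivative f (at (x + s *\<^sub>R v + t *\<^sub>R w)) v) (at s)"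
    if "0 \<le> s" "s \<le> h" "0 \<le> t" "t \<le> h" for s t
  proof -
    have F: "(f has_derivative frechet_derivative f (at (x + s *\<^sub>R v + t *\<^sub>R w))) (at (x + s *\<^sub>R v + t *\<^sub>R w))"
      by (rule smooth_on_imp_has_derivative[OF assms(1) inb[OF that]])
    have "((\<lambda>s. x + s *\<^sub>R v + t *\<^sub>R w) has_derivative (\<lambda>k. k *\<^sub>R v)) (at s)"
      by (auto intro!: derivative_eq_intros)
    from has_derivative_compose[OF this F] show ?thesis
      using linear_cmul[OF has_derivative_linear[OF F]]
      by (simp add: has_field_derivative_def mult.commute fun_eq_iff mult_commute_abs)
  qed
  have sm2: "smooth_on (ball x r) (\<lambda>y. frechet_derivative f (at y) v)"
    by (rule smooth_on_frechet_derivative[OF assms(1)])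
  have d2: "((\<lambda>t. frechet_derivative f (at (x + s *\<^sub>R v + t *\<^sub>R w)) v) has_real_derivative
       frechet_derivative (\<lambda>y. frechet_derivative f (at y) v) (at (x + s *\<^sub>R v + t *\<^sub>R w)) w) (at t)"
    if "0 \<le> s" "s \<le> h" "0 \<le> t" "t \<le> h" for s t
  proof -
    let ?g = "\<lambda>y. frechet_derivative f (at y) v"
    have F: "(?g has_derivative frechet_derivative ?g (at (x + s *\<^sub>R v + t *\<^sub>R w))) (at (x + s *\<^sub>R v + t *\<^sub>R w))"
      by (rule smooth_on_imp_has_derivative[OF sm2 inb[OF that]])
    have "((\<lambda>t. x + s *\<^sub>R v + t *\<^sub>R w) has_derivative (\<lambda>k. k *\<^sub>R w)) (at t)"
      by (auto intro!: derivative_eq_intros)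
    from has_derivative_compose[OF this F] show ?thesis
      using linear_cmul[OF has_derivative_linear[OF F]]
      by (simp add: has_field_derivative_def mult.commute fun_eq_iff mult_commute_abs)
  qed
  let ?\<phi> = "\<lambda>s. f (x + s *\<^sub>R v + h *\<^sub>R w) - f (x + s *\<^sub>R v)"
  have "(?\<phi> has_real_derivative frechet_derivative f (at (x + s *\<^sub>R v + h *\<^sub>R w)) v
      - frechet_derivative f (at (x + s *\<^sub>R v)) v) (at s)" if "0 \<le> s" "s \<le> h" for s
    using DERIV_diff[OF d1[OF that, of h] d1[OF that, of 0]] assms(2) by simp
  from MVT2[OF assms(2) this] obtain s where s: "0 < s" "s < h" "?\<phi> h - ?\<phi> 0 = h *
     (frechet_derivative f (at (x + s *\<^sub>R v + h *\<^sub>R w)) v - frechet_derivative f (at (x + s *\<^sub>R v)) v)"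
    by auto
  from MVT2[OF assms(2) d2[of s]] s(1,2) obtain t where t: "0 < t" "t < h"
    "frechet_derivative f (at (x + s *\<^sub>R v + h *\<^sub>R w)) v - frechet_derivative f (at (x + s *\<^sub>R v)) v
      = h * frechet_derivative (\<lambda>y. frechet_derivative f (at y) v) (at (x + s *\<^sub>R v + t *\<^sub>R w)) w"
    by auto
  show thesis using that[OF s(1,2) t(1,2)] s(3) t(3) by simp
qed

lemma frechet_derivative_inner_const:
  fixes f :: "'a::real_normed_vector \<Rightarrow> 'b::real_inner"
  assumes "f differentiable (at x)"
  shows "frechet_derivative (\<lambda>y. f y \<bullet> b) (at x) v = frechet_derivative f (at x) v \<bullet> b"
  using frechet_derivative_eqI[OF has_derivative_inner_left[OF has_derivative_frechet[OF assms]]] by metis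

text \<open>Both mixed derivatives, each at some point close to \<open>x\<close>, equal the same
  second difference divided by \<open>h * h\<close>; continuity at \<open>x\<close> then makes them
  agree there.\<close>

lemma second_derivative_symmetric_real:
  fixes f :: "'a::real_normed_vector \<Rightarrow> real"
  assumes "open S" "smooth_on S f" "x \<in> S"
  shows "frechet_derivative (\<lambda>y. frechet_derivative f (at y) v) (at x) w
       = frechet_derivative (\<lambda>y. frechet_derivative f (at y) w) (at x) v"
proof -
  obtain r where r: "0 < r" "ball x r \<subseteq> S" using assms openE by blast
  have sm: "smooth_on (ball x r) f" using assms(2) r(2) by (rule smooth_on_subset)
  let ?D = "\<lambda>v w y. frechet_derivative (\<lambda>y. frechet_derivative f (at y) v) (at y) w"
  have cont: "isCont (?D v w) x" for v w
    by (rule smooth_on_imp_isCont[of S]) (intro smooth_on_frechet_derivative assms, fact)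
  have "\<bar>?D v w x - ?D w v x\<bar> < e" if "e > 0" for e
  proof -
    obtain d1 d2 where d: "d1 > 0" "\<And>y. dist y x < d1 \<Longrightarrow> \<bar>?D v w y - ?D v w x\<bar> < e/2"
      "d2 > 0" "\<And>y. dist y x < d2 \<Longrightarrow> \<bar>?D w v y - ?D w v x\<bar> < e/2"
      using cont[of v w] cont[of w v] \<open>e > 0\<close> unfolding continuous_at_eps_delta dist_real_def
      by (metis half_gt_zero)
    \<comment> \<open>The summand 1 keeps the denominator positive when both vectors vanish, and the
      factor 2 makes the inequality strict.\<close>
    define h where "h = min r (min d1 d2) / (2 * (norm v + norm w + 1))"
    have np: "norm v + norm w + 1 > 0" by (smt (verit) norm_ge_zero)
    have h: "h > 0" using r d np by (simp add: h_def)
    have hb: "h * (norm v + norm w) < min r (min d1 d2)"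
    proof -
      have "h * (norm v + norm w) < h * (norm v + norm w + 1)" using h by simp
      also have "\<dots> = min r (min d1 d2) / 2"
        using np unfolding h_def by (metis nonzero_divide_eq_eq less_irrefl divide_divide_eq_left mult.commute)
      also have "\<dots> < min r (min d1 d2)"
        using r(1) d(1,3) by linarith
      finally show ?thesis .
    qed
    have close: "dist (x + s *\<^sub>R v + t *\<^sub>R w) x < min d1 d2" if "0 < s" "s < h" "0 < t" "t < h" for s t
    proof -
      have "dist (x + s *\<^sub>R v + t *\<^sub>R w) x = norm (s *\<^sub>R v + t *\<^sub>R w)" by (simp add: dist_norm)
      also have "\<dots> \<le> s * norm v + t * norm w"
        using norm_triangle_ineq[of "s *\<^sub>R v" "t *\<^sub>R w"] that by simp
      also have "\<dots> \<le> h * norm v + h * norm w" using that by (intro add_mono mult_right_mono) auto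
      finally show ?thesis using hb by (simp add: algebra_simps)
    qed
    obtain s t where st: "0 < s" "s < h" "0 < t" "t < h"
      "f (x + h *\<^sub>R v + h *\<^sub>R w) - f (x + h *\<^sub>R v) - f (x + h *\<^sub>R w) + f x = h * h * ?D v w (x + s *\<^sub>R v + t *\<^sub>R w)"
      using second_difference_mean_value[OF sm h, of v w] hb by auto
    obtain s' t' where st': "0 < s'" "s' < h" "0 < t'" "t' < h"
      "f (x + h *\<^sub>R w + h *\<^sub>R v) - f (x + h *\<^sub>R w) - f (x + h *\<^sub>R v) + f x = h * h * ?D w v (x + s' *\<^sub>R w + t' *\<^sub>R v)"
      using second_difference_mean_value[OF sm h, of w v] hb by (auto simp: add.commute)
    have "h * h * ?D v w (x + s *\<^sub>R v + t *\<^sub>R w) = h * h * ?D w v (x + s' *\<^sub>R w + t' *\<^sub>R v)"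
      unfolding st(5)[symmetric] st'(5)[symmetric] by (simp add: add.commute add.left_commute)
    then have "?D v w (x + s *\<^sub>R v + t *\<^sub>R w) = ?D w v (x + t' *\<^sub>R v + s' *\<^sub>R w)"
      using h by (simp add: add.commute add.left_commute)
    moreover have "\<bar>?D v w (x + s *\<^sub>R v + t *\<^sub>R w) - ?D v w x\<bar> < e/2"
      using close[OF st(1-4)] d(2) by simp
    moreover have "\<bar>?D w v (x + t' *\<^sub>R v + s' *\<^sub>R w) - ?D w v x\<bar> < e/2"
      using close[OF st'(3,4,1,2)] d(4) by simp
    ultimately show ?thesis by linarith
  qed
  then show ?thesis by (metis abs_ge_zero abs_le_zero_iff eq_iff_diff_eq_0 less_irrefl linorder_not_less zero_less_abs_iff)
qed

lemma second_derivative_symmetric: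
  fixes f :: "'a::real_normed_vector \<Rightarrow> 'b::euclidean_space"
  assumes "open S" "smooth_on S f" "x \<in> S"
  shows "frechet_derivative (\<lambda>y. frechet_derivative f (at y) v) (at x) w
       = frechet_derivative (\<lambda>y. frechet_derivative f (at y) w) (at x) v"
proof (rule euclidean_eqI)
  fix b :: 'b assume "b \<in> Basis"
  have *: "frechet_derivative (\<lambda>y. frechet_derivative (\<lambda>z. f z \<bullet> b) (at y) v) (at x) w
     = frechet_derivative (\<lambda>y. frechet_derivative f (at y) v) (at x) w \<bullet> b" for v w
  proof -
    have "((\<lambda>y. frechet_derivative f (at y) v \<bullet> b) has_derivative
       (\<lambda>w. frechet_derivative (\<lambda>y. frechet_derivative f (at y) v) (at x) w \<bullet> b)) (at x)"
      by (intro has_derivative_inner_left smooth_on_imp_has_derivative[OF smooth_on_frechet_derivative[OF assms(2)] assms(3)])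
    then have "((\<lambda>y. frechet_derivative (\<lambda>z. f z \<bullet> b) (at y) v) has_derivative
       (\<lambda>w. frechet_derivative (\<lambda>y. frechet_derivative f (at y) v) (at x) w \<bullet> b)) (at x)"
      by (rule has_derivative_transform_within_open[OF _ assms(1,3)])
        (simp add: frechet_derivative_inner_const smooth_on_imp_differentiable[OF assms(2)])
    then show ?thesis by (simp add: frechet_derivative_eqI)
  qed
  have "smooth_on S (\<lambda>z. f z \<bullet> b)" by (intro smooth_on_intros assms)
  from second_derivative_symmetric_real[OF assms(1) this assms(3), of v w]
  show "frechet_derivative (\<lambda>y. frechet_derivative f (at y) v) (at x) w \<bullet> b
     = frechet_derivative (\<lambda>y. frechet_derivative f (at y) w) (at x) v \<bullet> b"
    by (simp add: *)
qed


section \<open>The Gauss equation\<close>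

lemma partial_eqI: "(f has_derivative f') (at w) \<Longrightarrow> partial i f w = f' (axis i 1)"
  by (simp add: partial_def frechet_derivative_eqI)

lemma smooth_on_partial: "smooth_on S f \<Longrightarrow> smooth_on S (partial i f)"
  using smooth_on_frechet_derivative by (simp add: partial_def[abs_def])

lemma partial_bilinear:
  assumes "bounded_bilinear bop" "smooth_on S f" "smooth_on S g" "w \<in> S"
  shows "partial i (\<lambda>z. bop (f z) (g z)) w = bop (f w) (partial i g w) + bop (partial i f w) (g w)"
  using partial_eqI[OF bounded_bilinear.FDERIV[OF assms(1) smooth_on_imp_has_derivative[OF assms(2,4)]
      smooth_on_imp_has_derivative[OF assms(3,4)]]]
  by (simp add: partial_def)

lemmas partial_inner = partial_bilinear[OF bounded_bilinear_inner]
lemmas partial_mult = partial_bilinear[OF bounded_bilinear_mult]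

lemma partial_add:
  assumes "smooth_on S f" "smooth_on S g" "w \<in> S"
  shows "partial i (\<lambda>z. f z + g z) w = partial i f w + partial i g w"
  using partial_eqI[OF has_derivative_add[OF smooth_on_imp_has_derivative[OF assms(1,3)]
      smooth_on_imp_has_derivative[OF assms(2,3)]]]
  by (simp add: partial_def)

lemma partial_cong:
  assumes "open S" "w \<in> S" "\<And>z. z \<in> S \<Longrightarrow> f z = g z" "smooth_on S f"
  shows "partial i f w = partial i g w"
  using frechet_derivative_transform_within_open[OF _ assms(1,2), of f g] assms
  by (simp add: partial_def smooth_on_imp_differentiable)

lemma partial_symmetric:
  fixes f :: "real^2 \<Rightarrow> 'b::euclidean_space"
  assumes "open S" "smooth_on S f" "w \<in> S"
  shows "partial i (partial j f) w = partial j (partial i f) w"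
  using second_derivative_symmetric[OF assms] by (simp add: partial_def[abs_def])

section \<open>Linear algebra for the Gauss equation\<close>

lemma matrix_inv_eqI:
  fixes A B :: "real^'n^'n"
  assumes "A ** B = mat 1"
  shows "matrix_inv A = B"
proof -
  have BA: "B ** A = mat 1" using assms matrix_left_right_inverse by blast
  have inv: "A ** matrix_inv A = mat 1 \<and> matrix_inv A ** A = mat 1"
    unfolding matrix_inv_def
    by (rule someI[where P="\<lambda>A'. A ** A' = mat 1 \<and> A' ** A = mat 1" and x=B]) (simp add: assms BA)
  have "matrix_inv A = matrix_inv A ** (A ** B)" by (simp add: assms)
  also have "\<dots> = B" using inv by (simp add: matrix_mul_assoc)
  finally show ?thesis .
qed

lemma matrix_inv_2:
  fixes A :: "real^2^2"
  assumes "det A \<noteq> 0"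
  shows "matrix_inv A = (\<chi> i j. (if i = j then (if i = 1 then A$2$2 else A$1$1) else - A$i$j) / det A)"
proof (rule matrix_inv_eqI)
  show "A ** (\<chi> i j. (if i = j then (if i = 1 then A$2$2 else A$1$1) else - A$i$j) / det A) = mat 1"
    using assms
    by (simp add: matrix_matrix_mult_def vec_eq_iff forall_2 sum_2 mat_def divide_simps)
      (simp add: det_2 algebra_simps)
qed

text \<open>The Gram determinant is the squared length of the cross product of \<open>x\<close> and
  \<open>y\<close>. Both \<open>n\<close> and the remainder \<open>U\<close> are orthogonal to
  \<open>x\<close> and \<open>y\<close>, hence parallel to that cross product; as \<open>U\<close>
  is also orthogonal to \<open>n\<close>, it vanishes.\<close>

lemma normal_decomposition:
  fixes V n x y :: "real^3"
  assumes "norm n = 1" "x \<bullet> n = 0" "y \<bullet> n = 0" "V \<bullet> x = 0" "V \<bullet> y = 0"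
    and "(x \<bullet> x) * (y \<bullet> y) - (x \<bullet> y) * (x \<bullet> y) \<noteq> 0"
  shows "V = (V \<bullet> n) *\<^sub>R n"
proof -
  let ?c = "cross3 x y"
  define U where "U = V - (V \<bullet> n) *\<^sub>R n"
  have nn: "n \<bullet> n = 1" using assms(1) by (simp add: norm_eq_1)
  have "?c \<bullet> ?c \<noteq> 0" using assms(6) dot_cross[of x y x y] by (simp add: inner_commute)
  then have c: "?c \<noteq> 0" by auto
  have U: "U \<bullet> x = 0" "U \<bullet> y = 0" "U \<bullet> n = 0"
    using assms nn inner_commute[of x n] inner_commute[of y n] by (simp_all add: U_def inner_diff_left)
  have Uc: "cross3 U ?c = 0" and nc: "cross3 n ?c = 0"
    using U assms by (simp_all add: Lagrange inner_commute)
  have "cross3 n (cross3 n ?c) = (n \<bullet> ?c) *\<^sub>R n - (n \<bullet> n) *\<^sub>R ?c" by (rule Lagrange)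
  then have "?c = (n \<bullet> ?c) *\<^sub>R n" using nc nn by simp
  then have "U \<bullet> ?c = 0" using U(3) by (metis inner_scaleR_right mult_zero_right)
  then have "U = 0" using Uc c norm_and_cross_eq_0 by blast
  then show ?thesis by (simp add: U_def)
qed

text \<open>The Christoffel symbols are the tangential coefficients in
  \<open>F\<^sub>i\<^sub>j = \<Sum>\<^sub>k \<Gamma>\<^sup>k\<^sub>i\<^sub>j F\<^sub>k + (F\<^sub>i\<^sub>j \<bullet> n) n\<close>. Lowering the upper index of the curvature tensor, the third
  derivatives of \<open>F\<close> cancel.\<close>

theorem gauss_equation:
  fixes F n :: "real^2 \<Rightarrow> real^3"
  assumes S: "open S" and F: "smooth_on S F" and n: "smooth_on S n"
    and unit: "\<And>z. z \<in> S \<Longrightarrow> norm (n z) = 1"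
    and normal: "\<And>i z. z \<in> S \<Longrightarrow> partial i F z \<bullet> n z = 0"
    and w: "w \<in> S" and reg: "det (pullback_metric F w) \<noteq> 0"
  shows "metric_curvature (pullback_metric F) w =
    ((partial 1 F w \<bullet> partial 1 n w) * (partial 2 F w \<bullet> partial 2 n w)
      - (partial 1 F w \<bullet> partial 2 n w) * (partial 2 F w \<bullet> partial 1 n w)) / det (pullback_metric F w)"
proof -
  let ?g = "pullback_metric F"
  let ?G = "christoffel ?g"
  define F1 where "F1 i = partial i F" for i
  define F2 where "F2 i j = partial j (F1 i)" for i j
  define F3 where "F3 i j k = partial k (F2 i j)" for i j k
  have sm1: "smooth_on S (F1 i)" for i unfolding F1_def by (intro smooth_on_partial F)
  have sm2: "smooth_on S (F2 i j)" for i j unfolding F2_def by (intro smooth_on_partial sm1)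
  have sym2: "F2 i j z = F2 j i z" if "z \<in> S" for i j z
    unfolding F2_def F1_def by (rule partial_symmetric[OF S F that])
  have sym3: "F3 2 2 1 w = F3 1 2 2 w"
  proof -
    have "F3 2 2 1 w = F3 2 1 2 w"
      unfolding F3_def F2_def by (rule partial_symmetric[OF S sm1 w])
    also have "\<dots> = F3 1 2 2 w"
      unfolding F3_def by (rule partial_cong[OF S w _ sm2]) (rule sym2)
    finally show ?thesis .
  qed
  have g: "?g z $ i $ j = F1 i z \<bullet> F1 j z" for z i j by (simp add: pullback_metric_def F1_def)
  have smg: "smooth_on S (\<lambda>z. ?g z $ i $ j)" for i j unfolding g by (intro smooth_on_inner S sm1)
  have dg: "partial k (\<lambda>z. ?g z $ i $ j) z = F1 i z \<bullet> F2 j k z + F2 i k z \<bullet> F1 j z" if "z \<in> S" for z i j k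
    unfolding g F2_def by (rule partial_inner[OF sm1 sm1 that])
  have Gam: "?G k i j z = (\<Sum>l\<in>UNIV. matrix_inv (?g z) $ k $ l * (F2 i j z \<bullet> F1 l z))" if "z \<in> S" for k i j z
  proof -
    \<comment> \<open>By the product rule each derivative of the metric is a sum of two terms
      pairing a first with a second derivative of \<open>F\<close>. In the combination defining the
      Christoffel symbol four of the six terms cancel and the other two coincide.\<close>
    have eq: "F1 j z \<bullet> F2 l i z + F2 j i z \<bullet> F1 l z + (F1 i z \<bullet> F2 l j z + F2 i j z \<bullet> F1 l z)
        - (F1 i z \<bullet> F2 j l z + F2 i l z \<bullet> F1 j z) = 2 * (F2 i j z \<bullet> F1 l z)" for l
      using sym2[OF that, of i j] sym2[OF that, of i l] sym2[OF that, of j l] by (simp add: inner_commute)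
    show ?thesis unfolding christoffel_def dg[OF that] eq by (simp add: sum_divide_distrib)
  qed
  \<comment> \<open>The Christoffel symbols involve the inverse metric, so they are differentiated
    only on the open set where the metric is nondegenerate.\<close>
  define S0 where "S0 = S \<inter> {z. det (?g z) \<noteq> 0}"
  have smdet: "smooth_on S (\<lambda>z. det (?g z))" by (intro smooth_on_det S smg)
  have "S0 = S \<inter> (\<lambda>z. det (?g z)) -` (- {0})" by (auto simp: S0_def)
  then have S0: "open S0"
    using smooth_on_imp_continuous_on[OF smdet] S by (metis continuous_on_open_vimage Int_commute open_Compl closed_singleton)
  have wS0: "w \<in> S0" and S0S: "S0 \<subseteq> S" using w reg by (auto simp: S0_def)
  have smG: "smooth_on S0 (?G k i j)" for k i j
  proof (rule smooth_on_cong[OF S0])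
    let ?inv = "\<lambda>k l z. (if k = l then (if k = 1 then ?g z$2$2 else ?g z$1$1) else - ?g z$k$l) / det (?g z)"
    show "(\<Sum>l\<in>UNIV. ?inv k l z * (F2 i j z \<bullet> F1 l z)) = ?G k i j z" if "z \<in> S0" for z
      using that by (subst Gam) (auto simp: S0_def matrix_inv_2 intro!: sum.cong)
    have "smooth_on S0 (\<lambda>z. if k = l then (if k = 1 then ?g z$2$2 else ?g z$1$1) else - ?g z$k$l)" for l
      using smg[THEN smooth_on_subset, OF S0S] smooth_on_minus[OF S0 smg[THEN smooth_on_subset, OF S0S]]
      by (cases "k = l"; cases "k = 1") simp_all
    then show "smooth_on S0 (\<lambda>z. \<Sum>l\<in>UNIV. ?inv k l z * (F2 i j z \<bullet> F1 l z))"
      using S0S smdet[THEN smooth_on_subset, OF S0S] sm1[THEN smooth_on_subset, OF S0S] sm2[THEN smooth_on_subset, OF S0S]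
      by (intro smooth_on_sum smooth_on_mult smooth_on_divide_real smooth_on_inner S0) (auto simp: S0_def)
  qed
  have E: "(\<Sum>k\<in>UNIV. ?G k i j z * (F1 k z \<bullet> F1 m z)) = F2 i j z \<bullet> F1 m z" if "z \<in> S0" for z i j m
  proof -
    have d: "det (?g z) \<noteq> 0" and zS: "z \<in> S" using that by (auto simp: S0_def)
    have "F1 2 z \<bullet> F1 1 z = F1 1 z \<bullet> F1 2 z" by (rule inner_commute)
    then have "\<forall>m. (\<Sum>k\<in>UNIV. ?G k i j z * (F1 k z \<bullet> F1 m z)) = F2 i j z \<bullet> F1 m z"
      unfolding Gam[OF zS] matrix_inv_2[OF d]
      using d by (simp add: forall_2 sum_2 g det_2 divide_simps) (simp add: algebra_simps)
    then show ?thesis by blast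
  qed
  \<comment> \<open>Differentiating \<open>E\<close> expresses the derivatives of the Christoffel
    symbols, with the upper index lowered, by third derivatives of \<open>F\<close>; no derivative
    of the inverse metric is ever computed.\<close>
  have DE: "(\<Sum>k\<in>UNIV. partial p (?G k i j) w * (F1 k w \<bullet> F1 m w)
        + ?G k i j w * (F2 k p w \<bullet> F1 m w + F1 k w \<bullet> F2 m p w))
      = F3 i j p w \<bullet> F1 m w + F2 i j w \<bullet> F2 m p w" for i j m p
  proof -
    note s = sm1[THEN smooth_on_subset, OF S0S] sm2[THEN smooth_on_subset, OF S0S]
    have sk: "smooth_on S0 (\<lambda>z. F1 k z \<bullet> F1 m z)" for k by (intro smooth_on_inner S0 s)
    have skm: "smooth_on S0 (\<lambda>z. ?G k i j z * (F1 k z \<bullet> F1 m z))" for k by (intro smooth_on_mult S0 sk smG)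
    have smE: "smooth_on S0 (\<lambda>z. \<Sum>k\<in>UNIV. ?G k i j z * (F1 k z \<bullet> F1 m z))"
      by (intro smooth_on_sum S0 skm)
    have "partial p (\<lambda>z. \<Sum>k\<in>UNIV. ?G k i j z * (F1 k z \<bullet> F1 m z)) w = partial p (\<lambda>z. F2 i j z \<bullet> F1 m z) w"
      by (rule partial_cong[OF S0 wS0 E smE])
    moreover have "partial p (\<lambda>z. \<Sum>k\<in>UNIV. ?G k i j z * (F1 k z \<bullet> F1 m z)) w
       = (\<Sum>k\<in>UNIV. partial p (\<lambda>z. ?G k i j z * (F1 k z \<bullet> F1 m z)) w)"
      unfolding sum_2 by (rule partial_add[OF skm skm wS0])
    moreover have "partial p (\<lambda>z. ?G k i j z * (F1 k z \<bullet> F1 m z)) w = partial p (?G k i j) w * (F1 k w \<bullet> F1 m w)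
        + ?G k i j w * (F2 k p w \<bullet> F1 m w + F1 k w \<bullet> F2 m p w)" for k
      using partial_mult[OF smG sk wS0, of p k i j k] partial_inner[OF s(1) s(1) wS0, of p k m]
      by (simp add: F2_def)
    moreover have "partial p (\<lambda>z. F2 i j z \<bullet> F1 m z) w = F3 i j p w \<bullet> F1 m w + F2 i j w \<bullet> F2 m p w"
      using partial_inner[OF sm2 sm1 w, of p i j m] by (simp add: F3_def F2_def)
    ultimately show ?thesis by simp
  qed
  have h: "F2 i j w \<bullet> n w = - (F1 i w \<bullet> partial j n w)" for i j
  proof -
    have "partial j (\<lambda>z. F1 i z \<bullet> n z) w = partial j (\<lambda>z. 0) w"
      by (rule partial_cong[OF S w _ smooth_on_inner[OF S sm1 n]]) (simp add: F1_def normal)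
    moreover have "partial j (\<lambda>z. 0 :: real) w = 0" by (simp add: partial_def)
    moreover have "partial j (\<lambda>z. F1 i z \<bullet> n z) w = F1 i w \<bullet> partial j n w + F2 i j w \<bullet> n w"
      using partial_inner[OF sm1 n w] by (simp add: F2_def)
    ultimately show ?thesis by simp
  qed
  have dec: "F2 i j w - (\<Sum>k\<in>UNIV. ?G k i j w *\<^sub>R F1 k w) = (F2 i j w \<bullet> n w) *\<^sub>R n w" for i j
  proof -
    let ?V = "F2 i j w - (\<Sum>k\<in>UNIV. ?G k i j w *\<^sub>R F1 k w)"
    have nrm: "F1 k w \<bullet> n w = 0" for k using normal[OF w] by (simp add: F1_def)
    have V: "?V \<bullet> F1 m w = 0" for m
      using E[OF wS0, of i j m] by (simp add: inner_diff_left inner_sum_left)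
    have "?V = (?V \<bullet> n w) *\<^sub>R n w"
      using reg by (intro normal_decomposition[OF unit[OF w] nrm nrm V V, of 1 2])
        (simp add: det_2 g inner_commute)
    moreover have "?V \<bullet> n w = F2 i j w \<bullet> n w"
      by (simp add: inner_diff_left inner_sum_left nrm)
    ultimately show ?thesis by simp
  qed
  have lower: "(\<Sum>l\<in>UNIV. ?g w $ 1 $ l * curvature_tensor ?g l 2 1 2 w)
     = (F2 2 2 w - (\<Sum>k\<in>UNIV. ?G k 2 2 w *\<^sub>R F1 k w)) \<bullet> F2 1 1 w
     - (F2 1 2 w - (\<Sum>k\<in>UNIV. ?G k 1 2 w *\<^sub>R F1 k w)) \<bullet> F2 1 2 w"
  proof -
    have r: "F1 2 w \<bullet> F1 1 w = F1 1 w \<bullet> F1 2 w" by (rule inner_commute)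
    have e: "a * (p * A + q * B) = A * (p * a) + B * (q * a)" for a p q A B :: real by algebra
    note E' = E[OF wS0, of 1 1 1, symmetric] E[OF wS0, of 1 2 1, symmetric]
      E[OF wS0, of 2 1 1, symmetric] E[OF wS0, of 2 2 1, symmetric]
    note E'' = E'[unfolded sum_2 r]
    have DE1: "partial 1 (?G 1 2 2) w * (F1 1 w \<bullet> F1 1 w) + partial 1 (?G 2 2 2) w * (F1 1 w \<bullet> F1 2 w)
       = F3 1 2 2 w \<bullet> F1 1 w + F2 2 2 w \<bullet> F2 1 1 w
       - ?G 1 2 2 w * (F2 1 1 w \<bullet> F1 1 w + F1 1 w \<bullet> F2 1 1 w)
       - ?G 2 2 2 w * (F2 1 2 w \<bullet> F1 1 w + F1 2 w \<bullet> F2 1 1 w)"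
      using DE[of 1 2 2 1] sym2[OF w, of 2 1] sym3 r by (simp add: sum_2)
    have DE2: "partial 2 (?G 1 1 2) w * (F1 1 w \<bullet> F1 1 w) + partial 2 (?G 2 1 2) w * (F1 1 w \<bullet> F1 2 w)
       = F3 1 2 2 w \<bullet> F1 1 w + F2 1 2 w \<bullet> F2 1 2 w
       - ?G 1 1 2 w * (F2 1 2 w \<bullet> F1 1 w + F1 1 w \<bullet> F2 1 2 w)
       - ?G 2 1 2 w * (F2 2 2 w \<bullet> F1 1 w + F1 2 w \<bullet> F2 1 2 w)"
      using DE[of 2 1 2 1] r by (simp add: sum_2)
    have "(\<Sum>l\<in>UNIV. ?g w $ 1 $ l * curvature_tensor ?g l 2 1 2 w)
      = (partial 1 (?G 1 2 2) w * (F1 1 w \<bullet> F1 1 w) + partial 1 (?G 2 2 2) w * (F1 1 w \<bullet> F1 2 w))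
       - (partial 2 (?G 1 1 2) w * (F1 1 w \<bullet> F1 1 w) + partial 2 (?G 2 1 2) w * (F1 1 w \<bullet> F1 2 w))
       + ?G 1 2 2 w * (?G 1 1 1 w * (F1 1 w \<bullet> F1 1 w) + ?G 2 1 1 w * (F1 1 w \<bullet> F1 2 w))
       + ?G 2 2 2 w * (?G 1 1 2 w * (F1 1 w \<bullet> F1 1 w) + ?G 2 1 2 w * (F1 1 w \<bullet> F1 2 w))
       - ?G 1 1 2 w * (?G 1 2 1 w * (F1 1 w \<bullet> F1 1 w) + ?G 2 2 1 w * (F1 1 w \<bullet> F1 2 w))
       - ?G 2 1 2 w * (?G 1 2 2 w * (F1 1 w \<bullet> F1 1 w) + ?G 2 2 2 w * (F1 1 w \<bullet> F1 2 w))"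
      unfolding g curvature_tensor_def sum_2 by algebra
    also have "\<dots> = F2 2 2 w \<bullet> F2 1 1 w - F2 1 2 w \<bullet> F2 1 2 w
       - ?G 1 2 2 w * (F1 1 w \<bullet> F2 1 1 w) - ?G 2 2 2 w * (F1 2 w \<bullet> F2 1 1 w)
       + ?G 1 1 2 w * (F1 1 w \<bullet> F2 1 2 w) + ?G 2 1 2 w * (F1 2 w \<bullet> F2 1 2 w)"
      unfolding DE1 DE2 E''[symmetric] sym2[OF w, of 2 1] by (simp add: algebra_simps)
    finally show ?thesis by (simp add: sum_2 inner_diff_left inner_add_left)
  qed
  \<comment> \<open>The second fundamental form is symmetric, which matches the square of its mixed
    entry with the product of two different entries in the claim.\<close>
  have "F1 2 w \<bullet> partial 1 n w = F1 1 w \<bullet> partial 2 n w"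
    using h[of 1 2] h[of 2 1] sym2[OF w, of 1 2] by simp
  then show ?thesis
    unfolding metric_curvature_def lower dec
    using h[of 1 1] h[of 2 2] h[of 1 2] by (simp add: inner_commute F1_def)
qed


section \<open>Fronts in swallowtail coordinates\<close>

lemma vector_3_eq_axis:
  "(vector [a, b, c] :: real^3) = a *\<^sub>R axis 1 1 + b *\<^sub>R axis 2 1 + c *\<^sub>R axis 3 1"
  by (simp add: vec_eq_iff forall_3 axis_def)

lemma vector_2_eq_axis:
  "(vector [a, b] :: real^2) = a *\<^sub>R axis 1 1 + b *\<^sub>R axis 2 1"
  by (simp add: vec_eq_iff forall_2 axis_def)

lemma axis_2_component [simp]:
  "(axis 1 (1::real) :: real^2) $ 1 = 1" "(axis 1 (1::real) :: real^2) $ 2 = 0"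
  "(axis 2 (1::real) :: real^2) $ 1 = 0" "(axis 2 (1::real) :: real^2) $ 2 = 1"
  by (simp_all add: axis_def)

lemma has_derivative_vector_3:
  assumes "(f has_derivative f') F" "(g has_derivative g') F" "(h has_derivative h') F"
  shows "((\<lambda>x. vector [f x, g x, h x] :: real^3) has_derivative (\<lambda>v. vector [f' v, g' v, h' v])) F"
  unfolding vector_3_eq_axis
  by (intro has_derivative_add has_derivative_scaleR_left assms)

lemma has_derivative_vector_2:
  assumes "(f has_derivative f') F" "(g has_derivative g') F"
  shows "((\<lambda>x. vector [f x, g x] :: real^2) has_derivative (\<lambda>v. vector [f' v, g' v])) F"
  unfolding vector_2_eq_axis
  by (intro has_derivative_add has_derivative_scaleR_left assms)

lemmas has_derivative_component [derivative_intros] =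
  bounded_linear.has_derivative[OF bounded_linear_vec_nth]

lemma frechet_derivative_linear_2:
  fixes F :: "real^2 \<Rightarrow> 'b::real_normed_vector"
  assumes "F differentiable (at w)"
  shows "frechet_derivative F (at w) X = X$1 *\<^sub>R partial 1 F w + X$2 *\<^sub>R partial 2 F w"
proof -
  have lin: "linear (frechet_derivative F (at w))"
    using assms by (rule linear_frechet_derivative)
  have "X = vector [X$1, X$2]" by (simp add: vec_eq_iff forall_2)
  then have "frechet_derivative F (at w) X = frechet_derivative F (at w) (X$1 *\<^sub>R axis 1 1 + X$2 *\<^sub>R axis 2 1)"
    unfolding vector_2_eq_axis by simp
  then show ?thesis
    by (simp add: partial_def linear_add[OF lin] linear_cmul[OF lin])
qed

lemma frechet_derivative_linear_3:
  fixes F :: "real^3 \<Rightarrow> 'b::real_normed_vector"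
  assumes "F differentiable (at y)"
  shows "frechet_derivative F (at y) X = X$1 *\<^sub>R frechet_derivative F (at y) (axis 1 1)
    + X$2 *\<^sub>R frechet_derivative F (at y) (axis 2 1) + X$3 *\<^sub>R frechet_derivative F (at y) (axis 3 1)"
proof -
  have lin: "linear (frechet_derivative F (at y))"
    using assms by (rule linear_frechet_derivative)
  have "X = vector [X$1, X$2, X$3]" by (simp add: vec_eq_iff forall_3)
  then have "frechet_derivative F (at y) X
     = frechet_derivative F (at y) (X$1 *\<^sub>R axis 1 1 + X$2 *\<^sub>R axis 2 1 + X$3 *\<^sub>R axis 3 1)"
    unfolding vector_3_eq_axis by simp
  then show ?thesis
    by (simp add: linear_add[OF lin] linear_cmul[OF lin])
qed

text \<open>The vector \<open>(u, 1, 0)\<close> spans the image of \<open>\<partial>\<^sub>u\<close> off the singular set, where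
  \<open>\<partial>\<^sub>u swallowtail_form = (12 u\<^sup>2 + 2 v) (u, 1, 0)\<close>.\<close>

definition singular_factor :: "real^2 \<Rightarrow> real" where
  "singular_factor w = 12 * (w$1)^2 + 2 * w$2"

lemma smooth_on_singular_factor: "open S \<Longrightarrow> smooth_on S singular_factor"
  unfolding singular_factor_def[abs_def] by (intro smooth_on_intros)

lemma isCont_singular_factor: "isCont singular_factor w"
  using smooth_on_imp_isCont[OF smooth_on_singular_factor[OF open_UNIV]] by simp

lemma has_derivative_swallowtail_form:
  "(swallowtail_form has_derivative (\<lambda>X.
      vector [singular_factor w * w$1 * X$1 + (w$1)^2 * X$2, singular_factor w * X$1 + 2 * w$1 * X$2, X$2])) (at w)"
  unfolding swallowtail_form_def[abs_def] singular_factor_def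
  by (rule has_derivative_eq_rhs, rule has_derivative_vector_3)
    (auto intro!: derivative_eq_intros has_derivative_component simp: algebra_simps power2_eq_square power3_eq_cube fun_eq_iff)

lemma smooth_on_swallowtail_form: "open S \<Longrightarrow> smooth_on S swallowtail_form"
  unfolding swallowtail_form_def[abs_def] by (intro smooth_on_intros)

section \<open>A front in the source coordinates of the normal form\<close>

text \<open>The part of the situation that needs no surface. \<open>G\<close> will be the inverse of
  the target diffeomorphism, while \<open>F\<close> and \<open>n\<close> are the front and its
  normal in source coordinates; \<open>nondegenerate\<close> is genericity.\<close>

locale swallowtail_chart =
  fixes \<Omega> :: "(real^2) set" and T :: "(real^3) set" and G :: "real^3 \<Rightarrow> real^3"
    and n :: "real^2 \<Rightarrow> real^3" and F :: "real^2 \<Rightarrow> real^3"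
  assumes open_\<Omega>: "open \<Omega>" and zero_\<Omega>: "0 \<in> \<Omega>" and open_T: "open T"
    and smooth_G: "smooth_on T G" and into_T: "swallowtail_form ` \<Omega> \<subseteq> T"
    and inj_G: "\<And>y. y \<in> T \<Longrightarrow> inj (frechet_derivative G (at y))"
    and F_eq: "\<And>w. w \<in> \<Omega> \<Longrightarrow> F w = G (swallowtail_form w)"
    and smooth_n: "smooth_on \<Omega> n" and norm_n: "\<And>w. w \<in> \<Omega> \<Longrightarrow> norm (n w) = 1"
    and orthogonal: "\<And>w X. w \<in> \<Omega> \<Longrightarrow> frechet_derivative F (at w) X \<bullet> n w = 0"
    and nondegenerate: "\<exists>X Y. frechet_derivative F (at 0) X \<bullet> frechet_derivative n (at 0) Y \<noteq> 0"
begin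

definition "Gd j w = frechet_derivative G (at (swallowtail_form w)) (axis j 1)"

definition "e w = w$1 *\<^sub>R Gd 1 w + Gd 2 w"

definition "f2 w = (w$1)^2 *\<^sub>R Gd 1 w + (2 * w$1) *\<^sub>R Gd 2 w + Gd 3 w"

text \<open>\<open>gram\<close> and \<open>B\<close> are the determinants of the two fundamental
  forms with \<open>e\<close> in place of the first partial derivative of \<open>F\<close>. Removing
  the powers of \<open>singular_factor\<close> leaves functions that stay nonzero near the origin,
  even on the singular curve.\<close>

definition "gram w = (e w \<bullet> e w) * (f2 w \<bullet> f2 w) - (e w \<bullet> f2 w) * (e w \<bullet> f2 w)"

definition "B w = (e w \<bullet> partial 1 n w) * (f2 w \<bullet> partial 2 n w) - (e w \<bullet> partial 2 n w) * (f2 w \<bullet> partial 1 n w)"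

definition "\<alpha> = Gd 1 0 \<bullet> n 0"

definition "\<beta> = - (f2 0 \<bullet> partial 2 n 0)"

lemma sw_T: "w \<in> \<Omega> \<Longrightarrow> swallowtail_form w \<in> T"
  using into_T by blast

lemma G_diff: "w \<in> \<Omega> \<Longrightarrow> G differentiable (at (swallowtail_form w))"
  using smooth_G sw_T smooth_on_imp_differentiable by blast

lemma smooth_Gd: "smooth_on \<Omega> (Gd j)"
  unfolding Gd_def[abs_def]
  by (rule smooth_on_compose[OF open_\<Omega> open_T smooth_on_frechet_derivative[OF smooth_G]
        smooth_on_swallowtail_form[OF open_\<Omega>] into_T])

lemma smooth_e: "smooth_on \<Omega> e"
  unfolding e_def[abs_def] by (intro smooth_on_intros smooth_Gd open_\<Omega>)

lemma smooth_f2: "smooth_on \<Omega> f2"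
  unfolding f2_def[abs_def] by (intro smooth_on_intros smooth_Gd open_\<Omega>)

lemma smooth_F: "smooth_on \<Omega> F"
  by (rule smooth_on_cong[OF open_\<Omega> F_eq[symmetric]])
    (auto intro: smooth_on_compose[OF open_\<Omega> open_T smooth_G smooth_on_swallowtail_form[OF open_\<Omega>] into_T])

lemma smooth_B: "smooth_on \<Omega> B"
  unfolding B_def[abs_def]
  by (intro smooth_on_diff smooth_on_mult smooth_on_inner smooth_e smooth_f2 smooth_on_partial smooth_n open_\<Omega>)

lemma smooth_gram: "smooth_on \<Omega> gram"
  unfolding gram_def[abs_def]
  by (intro smooth_on_diff smooth_on_mult smooth_on_inner smooth_e smooth_f2 open_\<Omega>)

lemma frechet_derivative_F:
  assumes "w \<in> \<Omega>"
  shows "frechet_derivative F (at w) X = (singular_factor w * X$1) *\<^sub>R e w + X$2 *\<^sub>R f2 w"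
proof -
  have "((\<lambda>w. G (swallowtail_form w)) has_derivative (\<lambda>X. frechet_derivative G (at (swallowtail_form w))
     (vector [singular_factor w * w$1 * X$1 + (w$1)^2 * X$2, singular_factor w * X$1 + 2 * w$1 * X$2, X$2]))) (at w)"
    by (rule has_derivative_compose[OF has_derivative_swallowtail_form has_derivative_frechet[OF G_diff[OF assms]]])
  then have "(F has_derivative (\<lambda>X. frechet_derivative G (at (swallowtail_form w))
     (vector [singular_factor w * w$1 * X$1 + (w$1)^2 * X$2, singular_factor w * X$1 + 2 * w$1 * X$2, X$2]))) (at w)"
    by (rule has_derivative_transform_within_open[OF _ open_\<Omega> assms]) (simp add: F_eq)
  then show ?thesis
    by (subst frechet_derivative_eqI, assumption, subst frechet_derivative_linear_3[OF G_diff[OF assms]])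
      (simp add: e_def f2_def Gd_def[symmetric] algebra_simps)
qed

lemma partial_1_F: "w \<in> \<Omega> \<Longrightarrow> partial 1 F w = singular_factor w *\<^sub>R e w"
  and partial_2_F: "w \<in> \<Omega> \<Longrightarrow> partial 2 F w = f2 w"
  by (simp_all add: partial_def frechet_derivative_F axis_def)

lemma f2_orthogonal: "w \<in> \<Omega> \<Longrightarrow> f2 w \<bullet> n w = 0"
  using orthogonal[of w "axis 2 1"] by (simp add: partial_2_F partial_def[symmetric])

text \<open>By continuity, because the regular points are dense.\<close>

lemma e_orthogonal:
  assumes w: "w \<in> \<Omega>"
  shows "e w \<bullet> n w = 0"
proof (rule ccontr)
  assume nz: "e w \<bullet> n w \<noteq> 0"
  \<comment> \<open>Along the v-axis direction \<open>singular_factor\<close> is affine with slope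
    2, so at most one parameter value is singular.\<close>
  define p where "p s = w + s *\<^sub>R axis 2 1" for s :: real
  have cp: "isCont p 0" unfolding p_def by (intro continuous_intros)
  have p0: "p 0 = w" by (simp add: p_def)
  have c: "isCont (\<lambda>z. e z \<bullet> n z) w"
    by (rule smooth_on_imp_isCont[OF smooth_on_inner[OF open_\<Omega> smooth_e smooth_n] w])
  have "isCont (\<lambda>s. e (p s) \<bullet> n (p s)) 0"
    using isCont_o2[OF cp, of "\<lambda>z. e z \<bullet> n z"] c p0 by simp
  then have "\<forall>\<^sub>F s in at 0. e (p s) \<bullet> n (p s) \<noteq> 0"
    using nz p0 by (simp add: isCont_def tendsto_imp_eventually_ne)
  moreover have "\<forall>\<^sub>F s in at 0. p s \<in> \<Omega>"
    using cp w open_\<Omega> p0 by (metis isCont_def topological_tendstoD)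
  moreover have "\<forall>\<^sub>F s in at 0. s \<noteq> - singular_factor w / 2"
    by (rule eventually_neq_at_within)
  ultimately have "\<forall>\<^sub>F s in at (0::real). False"
  proof eventually_elim
    case (elim s)
    have "singular_factor (p s) = singular_factor w + 2 * s"
      by (simp add: singular_factor_def p_def axis_def)
    then have "singular_factor (p s) \<noteq> 0" using elim by auto
    moreover have "singular_factor (p s) * (e (p s) \<bullet> n (p s)) = 0"
      using orthogonal[OF elim(2), of "axis 1 1"] by (simp add: frechet_derivative_F[OF elim(2)] axis_def)
    ultimately show ?case using elim by simp
  qed
  then show False by simp
qed

text \<open>If the first column of the differential of \<open>G\<close> were tangent, then
  \<open>e\<close> and \<open>f2\<close> being tangent would force the other two columns to be
  tangent as well, and the differential could not be onto.\<close>

lemma Gd_1_transversal: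
  assumes w: "w \<in> \<Omega>"
  shows "Gd 1 w \<bullet> n w \<noteq> 0"
proof
  assume 1: "Gd 1 w \<bullet> n w = 0"
  then have 2: "Gd 2 w \<bullet> n w = 0"
    using e_orthogonal[OF w] by (simp add: e_def inner_add_left)
  then have 3: "Gd 3 w \<bullet> n w = 0"
    using f2_orthogonal[OF w] 1 by (simp add: f2_def inner_add_left)
  let ?D = "frechet_derivative G (at (swallowtail_form w))"
  have lin: "linear ?D" by (rule linear_frechet_derivative[OF G_diff[OF w]])
  then have "surj ?D" using inj_G[OF sw_T[OF w]] by (rule linear_injective_imp_surjective) simp
  then obtain X where X: "?D X = n w" by (metis surjD)
  have "?D X \<bullet> n w = 0"
    by (subst frechet_derivative_linear_3[OF G_diff[OF w]])
      (simp add: inner_add_left Gd_def[symmetric] 1 2 3)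
  then have "n w \<bullet> n w = 0" by (simp add: X)
  then show False using norm_n[OF w] by simp
qed

text \<open>\<open>e\<close> and \<open>f2\<close> are the images of (u, 1, 0) and (u^2, 2 u, 1)
  under the injective differential of \<open>G\<close>; these two vectors are independent for every
  u.\<close>

lemma gram_pos:
  assumes w: "w \<in> \<Omega>"
  shows "0 < gram w"
proof -
  let ?D = "frechet_derivative G (at (swallowtail_form w))"
  have lin: "linear ?D" by (rule linear_frechet_derivative[OF G_diff[OF w]])
  have ker: "X = 0" if "?D X = 0" for X
    using inj_G[OF sw_T[OF w]] that linear_0[OF lin] by (metis injD)
  have De: "?D (vector [w$1, 1, 0]) = e w"
    by (subst frechet_derivative_linear_3[OF G_diff[OF w]]) (simp add: e_def Gd_def)
  have e: "e w \<noteq> 0"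
  proof
    assume "e w = 0"
    then have "(vector [w$1, 1, 0] :: real^3) = 0" by (intro ker[of "vector [w$1, 1, 0]"] trans[OF De])
    then show False by (simp add: vec_eq_iff forall_3)
  qed
  \<comment> \<open>An unnormalized Gram-Schmidt vector, chosen so that its squared length is
    \<open>gram w\<close> times a positive number.\<close>
  define v where "v = (e w \<bullet> e w) *\<^sub>R f2 w - (e w \<bullet> f2 w) *\<^sub>R e w"
  have vv: "v \<bullet> v = (e w \<bullet> e w) * gram w"
    using inner_commute[of "f2 w" "e w"]
    by (simp add: v_def gram_def inner_diff_left inner_diff_right algebra_simps)
  have "v \<noteq> 0"
  proof
    assume "v = 0"
    moreover have "?D (vector [(e w \<bullet> e w) * (w$1)^2 - (e w \<bullet> f2 w) * w$1,
        (e w \<bullet> e w) * (2 * w$1) - (e w \<bullet> f2 w), e w \<bullet> e w]) = v"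
      by (subst frechet_derivative_linear_3[OF G_diff[OF w]])
        (simp add: v_def e_def f2_def Gd_def[symmetric] algebra_simps del: inner_add_left inner_add_right)
    ultimately have "(vector [(e w \<bullet> e w) * (w$1)^2 - (e w \<bullet> f2 w) * w$1,
        (e w \<bullet> e w) * (2 * w$1) - (e w \<bullet> f2 w), e w \<bullet> e w] :: real^3) = 0"
      using ker by metis
    then have "(e w \<bullet> e w) = 0" by (simp add: vec_eq_iff forall_3)
    then show False using e by simp
  qed
  then have "0 < (e w \<bullet> e w) * gram w" using vv by (metis inner_gt_zero_iff)
  then show ?thesis using inner_ge_zero[of "e w"] by (auto simp: zero_less_mult_iff)
qed

lemma partial_orthogonal:
  assumes "smooth_on \<Omega> g" "\<And>z. z \<in> \<Omega> \<Longrightarrow> g z \<bullet> n z = 0" "w \<in> \<Omega>"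
  shows "partial i g w \<bullet> n w = - (g w \<bullet> partial i n w)"
proof -
  have "partial i (\<lambda>z. g z \<bullet> n z) w = partial i (\<lambda>z. 0 :: real) w"
    by (rule partial_cong[OF open_\<Omega> assms(3) _ smooth_on_inner[OF open_\<Omega> assms(1) smooth_n]]) (rule assms(2))
  then show ?thesis
    using partial_inner[OF assms(1) smooth_n assms(3), of i] by (simp add: partial_def)
qed

text \<open>At the origin \<open>swallowtail_form\<close> has vanishing u-derivative, so the same
  holds for every function that factors through it.\<close>

lemma partial_Gd_0: "partial 1 (Gd j) 0 = 0"
proof -
  have sm: "smooth_on T (\<lambda>y. frechet_derivative G (at y) (axis j 1))"
    by (rule smooth_on_frechet_derivative[OF smooth_G])
  have "(Gd j has_derivative (\<lambda>X. frechet_derivative (\<lambda>y. frechet_derivative G (at y) (axis j 1)) (at (swallowtail_form 0))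
     (vector [singular_factor 0 * (0::real^2)$1 * X$1 + ((0::real^2)$1)^2 * X$2, singular_factor 0 * X$1 + 2 * (0::real^2)$1 * X$2, X$2]))) (at 0)"
    unfolding Gd_def[abs_def]
    by (rule has_derivative_compose[where g="\<lambda>y. frechet_derivative G (at y) (axis j 1)", OF has_derivative_swallowtail_form smooth_on_imp_has_derivative[OF sm sw_T[OF zero_\<Omega>]]])
  from partial_eqI[OF this, of 1] show ?thesis
    by (simp add: singular_factor_def vector_3_eq_axis
        linear_0[OF linear_frechet_derivative[OF smooth_on_imp_differentiable[OF sm sw_T[OF zero_\<Omega>]]]])
qed

lemma partial_component: "partial i (\<lambda>w :: real^2. w $ j) w = (if i = j then 1 else 0)"
  by (subst partial_eqI[OF has_derivative_component[OF has_derivative_ident]]) (simp add: axis_def)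

lemma partial_1_e_0: "partial 1 e 0 = Gd 1 0"
proof -
  have sm: "smooth_on \<Omega> (\<lambda>w. w $ 1 *\<^sub>R Gd 1 w)" by (intro smooth_on_intros smooth_Gd open_\<Omega>)
  have "partial 1 e 0 = partial 1 (\<lambda>w. w $ 1 *\<^sub>R Gd 1 w) 0 + partial 1 (Gd 2) 0"
    unfolding e_def[abs_def] by (rule partial_add[OF sm smooth_Gd zero_\<Omega>])
  also have "partial 1 (\<lambda>w. w $ 1 *\<^sub>R Gd 1 w) 0 = Gd 1 0"
    by (subst partial_bilinear[OF bounded_bilinear_scaleR _ smooth_Gd zero_\<Omega>])
      (auto intro!: smooth_on_intros open_\<Omega> simp: partial_component)
  finally show ?thesis by (simp add: partial_Gd_0)
qed

lemma partial_singular_factor: "partial 2 singular_factor w = 2"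
proof -
  have "(singular_factor has_derivative (\<lambda>X. 24 * w$1 * X$1 + 2 * X$2)) (at w)"
    unfolding singular_factor_def[abs_def]
    by (auto intro!: derivative_eq_intros has_derivative_component simp: power2_eq_square algebra_simps fun_eq_iff)
  from partial_eqI[OF this] show ?thesis by (simp add: axis_def)
qed

text \<open>Since \<open>f2\<close> is the v-derivative of \<open>F\<close>, interchanging the two
  derivatives turns this into the product rule for \<open>singular_factor\<close> times
  \<open>e\<close>.\<close>

lemma partial_1_f2:
  assumes "w \<in> \<Omega>"
  shows "partial 1 f2 w = 2 *\<^sub>R e w + singular_factor w *\<^sub>R partial 2 e w"
proof -
  have "partial 1 f2 w = partial 1 (partial 2 F) w"
    by (rule partial_cong[OF open_\<Omega> assms partial_2_F[symmetric] smooth_f2])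
  also have "\<dots> = partial 2 (partial 1 F) w" by (rule partial_symmetric[OF open_\<Omega> smooth_F assms])
  also have "\<dots> = partial 2 (\<lambda>w. singular_factor w *\<^sub>R e w) w"
    by (rule partial_cong[OF open_\<Omega> assms partial_1_F smooth_on_partial[OF smooth_F]])
  also have "\<dots> = 2 *\<^sub>R e w + singular_factor w *\<^sub>R partial 2 e w"
    by (subst partial_bilinear[OF bounded_bilinear_scaleR smooth_on_singular_factor[OF open_\<Omega>] smooth_e assms])
      (simp add: partial_singular_factor)
  finally show ?thesis .
qed

text \<open>At the origin the u-derivative of \<open>f2\<close> is \<open>2 e\<close>, which is
  tangent, so \<open>f2\<close> is orthogonal to the u-derivative of the normal. The determinant
  \<open>B\<close> reduces to its diagonal product. As the u-derivative of \<open>F\<close> vanishes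
  there too, the only entry of the second fundamental form left to be nonzero is \<beta>.\<close>

lemma B_0: "B 0 = \<alpha> * \<beta>"
  and \<beta>_nonzero: "\<beta> \<noteq> 0"
proof -
  have 1: "f2 0 \<bullet> partial 1 n 0 = 0"
    using partial_orthogonal[OF smooth_f2 f2_orthogonal zero_\<Omega>, of 1] partial_1_f2[OF zero_\<Omega>] e_orthogonal[OF zero_\<Omega>]
    by (simp add: singular_factor_def)
  have 2: "e 0 \<bullet> partial 1 n 0 = - \<alpha>"
    using partial_orthogonal[OF smooth_e e_orthogonal zero_\<Omega>, of 1] by (simp add: partial_1_e_0 \<alpha>_def)
  show "B 0 = \<alpha> * \<beta>" by (simp add: B_def 1 2 \<beta>_def)
  obtain X Y where "frechet_derivative F (at 0) X \<bullet> frechet_derivative n (at 0) Y \<noteq> 0"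
    using nondegenerate by blast
  then show "\<beta> \<noteq> 0"
    using 1 by (auto simp: frechet_derivative_F[OF zero_\<Omega>] singular_factor_def \<beta>_def inner_add_right
        frechet_derivative_linear_2[OF smooth_on_imp_differentiable[OF smooth_n zero_\<Omega>]])
qed

lemma \<alpha>_nonzero: "\<alpha> \<noteq> 0"
  unfolding \<alpha>_def by (rule Gd_1_transversal[OF zero_\<Omega>])

lemma det_second_form:
  assumes "w \<in> \<Omega>"
  shows "(partial 1 F w \<bullet> partial 1 n w) * (partial 2 F w \<bullet> partial 2 n w)
      - (partial 1 F w \<bullet> partial 2 n w) * (partial 2 F w \<bullet> partial 1 n w) = singular_factor w * B w"
  by (simp add: partial_1_F partial_2_F assms B_def algebra_simps)

lemma det_first_form:
  assumes "w \<in> \<Omega>"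
  shows "(partial 1 F w \<bullet> partial 1 F w) * (partial 2 F w \<bullet> partial 2 F w)
      - (partial 1 F w \<bullet> partial 2 F w) * (partial 2 F w \<bullet> partial 1 F w) = (singular_factor w)^2 * gram w"
  by (simp add: partial_1_F partial_2_F assms gram_def algebra_simps power2_eq_square inner_commute)

section \<open>Height of parabolic null curves\<close>

text \<open>The derivative of the height along the parabola is (12 + 2 c) t^2 times the height of
  \<open>e\<close> plus 2 c t times the height of \<open>f2\<close>. The former height is \<alpha> t
  and the latter (\<alpha> + c \<beta>) t^2 to leading order. Dividing the sum by 4 t^3 gives the
  limit, by the rule of l'Hopital.\<close>

lemma height_of_null_curve:
  "((\<lambda>t. ((F (vector [t, c * t^2]) - F 0) \<bullet> n 0) / t^4) \<longlongrightarrow> \<alpha> * (3 + c) + \<beta> * c^2 / 2) (at 0)"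
proof -
  define p where "p t = (vector [t, c * t^2] :: real^2)" for t
  have p0: "p 0 = 0" by (simp add: p_def vec_eq_iff forall_2)
  have dp: "(p has_derivative (\<lambda>k. k *\<^sub>R vector [1, 2 * c * t])) (at t)" for t
  proof (rule has_derivative_eq_rhs)
    show "(p has_derivative (\<lambda>k. vector [k, c * (2 * t * k)])) (at t)"
      unfolding p_def by (rule has_derivative_vector_2) (auto intro!: derivative_eq_intros)
  qed (auto simp: vec_eq_iff forall_2)
  have cp: "isCont p t" for t using dp has_derivative_continuous by blast
  have ev: "\<forall>\<^sub>F t in at 0. p t \<in> \<Omega>"
    using cp[of 0] zero_\<Omega> open_\<Omega> p0 by (metis isCont_def topological_tendstoD)
  have sf: "singular_factor (p t) = (12 + 2 * c) * t^2" for t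
    by (simp add: singular_factor_def p_def algebra_simps)
  have comp: "((\<lambda>t. g (p t) \<bullet> n 0) has_real_derivative
      (partial 1 g (p t) + (2 * c * t) *\<^sub>R partial 2 g (p t)) \<bullet> n 0) (at t)"
    if "smooth_on \<Omega> g" "p t \<in> \<Omega>" for g t
  proof -
    have "((\<lambda>t. g (p t) \<bullet> n 0) has_derivative (\<lambda>k. frechet_derivative g (at (p t)) (k *\<^sub>R vector [1, 2 * c * t]) \<bullet> n 0)) (at t)"
      by (intro has_derivative_inner_left has_derivative_compose[OF dp] smooth_on_imp_has_derivative[OF that])
    then show ?thesis
      unfolding has_field_derivative_def
      by (rule has_derivative_eq_rhs)
        (simp add: frechet_derivative_linear_2[OF smooth_on_imp_differentiable[OF that]] inner_add_left algebra_simps fun_eq_iff)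
  qed
  have lim: "((\<lambda>t. g (p t) \<bullet> n 0) \<longlongrightarrow> g 0 \<bullet> n 0) (at 0)" if "smooth_on \<Omega> g" for g
  proof -
    have "isCont (\<lambda>t. g (p t)) 0"
      using isCont_o2[OF cp, where g=g] smooth_on_imp_isCont[OF that zero_\<Omega>] p0 by simp
    then show ?thesis using p0 by (auto simp: isCont_def intro!: tendsto_inner)
  qed
  have nz: "\<forall>\<^sub>F t in at 0. t \<noteq> (0::real)" by (simp add: eventually_at_filter)
  have t0: "(id \<longlongrightarrow> 0) (at (0::real))" by (simp add: tendsto_ident_at id_def)
  have E: "((\<lambda>t. (e (p t) \<bullet> n 0) / t) \<longlongrightarrow> \<alpha>) (at 0)"
  proof -
    have "((\<lambda>t. e (p t) \<bullet> n 0) has_real_derivative \<alpha>) (at 0)"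
      using comp[OF smooth_e, of 0] p0 zero_\<Omega> by (simp add: partial_1_e_0 \<alpha>_def)
    then show ?thesis by (simp add: has_field_derivative_iff e_orthogonal[OF zero_\<Omega>] p0)
  qed
  have Q: "((\<lambda>t. (f2 (p t) \<bullet> n 0) / t^2) \<longlongrightarrow> \<alpha> + c * \<beta>) (at 0)"
  proof (rule lhopital)
    show "((\<lambda>t. f2 (p t) \<bullet> n 0) \<longlongrightarrow> 0) (at 0)"
      using lim[OF smooth_f2] by (simp add: f2_orthogonal[OF zero_\<Omega>])
    show "((\<lambda>t::real. t^2) \<longlongrightarrow> 0) (at 0)" by (auto intro!: tendsto_eq_intros)
    show "\<forall>\<^sub>F t in at 0. t^2 \<noteq> (0::real)" using nz by simp
    show "\<forall>\<^sub>F t in at 0. 2 * t \<noteq> (0::real)" using nz by simp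
    show "\<forall>\<^sub>F t in at 0. ((\<lambda>t. f2 (p t) \<bullet> n 0) has_real_derivative
        (partial 1 f2 (p t) + (2 * c * t) *\<^sub>R partial 2 f2 (p t)) \<bullet> n 0) (at t)"
      using ev by eventually_elim (rule comp[OF smooth_f2])
    show "\<forall>\<^sub>F t in at 0. ((\<lambda>t::real. t^2) has_real_derivative 2 * t) (at t)"
      by (intro always_eventually allI) (auto intro!: derivative_eq_intros)
    have "((\<lambda>t. (e (p t) \<bullet> n 0) / t + (6 + c) * t * (partial 2 e (p t) \<bullet> n 0) + c * (partial 2 f2 (p t) \<bullet> n 0))
        \<longlongrightarrow> \<alpha> + (6 + c) * 0 * (partial 2 e 0 \<bullet> n 0) + c * (partial 2 f2 0 \<bullet> n 0)) (at 0)"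
      by (intro tendsto_intros E lim smooth_on_partial smooth_e smooth_f2)
    moreover have "partial 2 f2 0 \<bullet> n 0 = \<beta>"
      using partial_orthogonal[OF smooth_f2 f2_orthogonal zero_\<Omega>, of 2] by (simp add: \<beta>_def)
    ultimately have lim': "((\<lambda>t. (e (p t) \<bullet> n 0) / t + (6 + c) * t * (partial 2 e (p t) \<bullet> n 0) + c * (partial 2 f2 (p t) \<bullet> n 0))
        \<longlongrightarrow> \<alpha> + c * \<beta>) (at 0)" by simp
    show "((\<lambda>t. (partial 1 f2 (p t) + (2 * c * t) *\<^sub>R partial 2 f2 (p t)) \<bullet> n 0 / (2 * t)) \<longlongrightarrow> \<alpha> + c * \<beta>) (at 0)"
    proof (rule Lim_transform_eventually[OF lim'])
      show "\<forall>\<^sub>F t in at 0. (e (p t) \<bullet> n 0) / t + (6 + c) * t * (partial 2 e (p t) \<bullet> n 0) + c * (partial 2 f2 (p t) \<bullet> n 0)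
         = (partial 1 f2 (p t) + (2 * c * t) *\<^sub>R partial 2 f2 (p t)) \<bullet> n 0 / (2 * t)"
        using ev nz
        by eventually_elim (simp add: partial_1_f2 sf inner_add_left field_simps power2_eq_square)
    qed
  qed
  have "((\<lambda>t. ((F (p t) - F 0) \<bullet> n 0) / t^4) \<longlongrightarrow> \<alpha> * (3 + c) + \<beta> * c^2 / 2) (at 0)"
  proof (rule lhopital)
    show "((\<lambda>t. (F (p t) - F 0) \<bullet> n 0) \<longlongrightarrow> 0) (at 0)"
      using tendsto_diff[OF lim[OF smooth_F] tendsto_const[of "F 0 \<bullet> n 0"]] by (simp add: inner_diff_left)
    show "((\<lambda>t::real. t^4) \<longlongrightarrow> 0) (at 0)" by (auto intro!: tendsto_eq_intros)
    show "\<forall>\<^sub>F t in at 0. t^4 \<noteq> (0::real)" using nz by simp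
    show "\<forall>\<^sub>F t in at 0. 4 * t^3 \<noteq> (0::real)" using nz by simp
    show "\<forall>\<^sub>F t in at 0. ((\<lambda>t. (F (p t) - F 0) \<bullet> n 0) has_real_derivative
        (partial 1 F (p t) + (2 * c * t) *\<^sub>R partial 2 F (p t)) \<bullet> n 0) (at t)"
      using ev
    proof eventually_elim
      case (elim t)
      from DERIV_diff[OF comp[OF smooth_F elim] DERIV_const[of "F 0 \<bullet> n 0"]]
      show ?case by (simp add: inner_diff_left)
    qed
    show "\<forall>\<^sub>F t in at 0. ((\<lambda>t::real. t^4) has_real_derivative 4 * t^3) (at t)"
      by (intro always_eventually allI) (auto intro!: derivative_eq_intros)
    have lim': "((\<lambda>t. (6 + c) / 2 * ((e (p t) \<bullet> n 0) / t) + c / 2 * ((f2 (p t) \<bullet> n 0) / t^2))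
        \<longlongrightarrow> (6 + c) / 2 * \<alpha> + c / 2 * (\<alpha> + c * \<beta>)) (at 0)"
      by (intro tendsto_intros E Q)
    have eq: "(6 + c) / 2 * \<alpha> + c / 2 * (\<alpha> + c * \<beta>) = \<alpha> * (3 + c) + \<beta> * c^2 / 2"
      by (simp add: field_simps power2_eq_square)
    show "((\<lambda>t. (partial 1 F (p t) + (2 * c * t) *\<^sub>R partial 2 F (p t)) \<bullet> n 0 / (4 * t^3)) \<longlongrightarrow> \<alpha> * (3 + c) + \<beta> * c^2 / 2) (at 0)"
    proof (rule Lim_transform_eventually[OF lim'[unfolded eq]])
      show "\<forall>\<^sub>F t in at 0. (6 + c) / 2 * ((e (p t) \<bullet> n 0) / t) + c / 2 * ((f2 (p t) \<bullet> n 0) / t^2)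
         = (partial 1 F (p t) + (2 * c * t) *\<^sub>R partial 2 F (p t)) \<bullet> n 0 / (4 * t^3)"
        using ev nz
        by eventually_elim (simp add: partial_1_F partial_2_F sf inner_add_left field_simps power2_eq_square power3_eq_cube)
    qed
  qed
  then show ?thesis by (simp add: p_def)
qed

end


section \<open>Cuspidal edges near a swallowtail\<close>

text \<open>A rectangle in the coordinates (u, \<lambda>), which straighten the singular curve; each
  side of the curve becomes a rectangle and is therefore connected.\<close>

definition box_nbhd :: "real \<Rightarrow> (real^2) set" where
  "box_nbhd d = {w. \<bar>w$1\<bar> < d \<and> \<bar>singular_factor w\<bar> < d}"

lemma open_box_nbhd: "open (box_nbhd d)"
proof -
  have "continuous_on UNIV singular_factor"
    by (simp add: continuous_at_imp_continuous_on isCont_singular_factor)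
  then show ?thesis
    unfolding box_nbhd_def by (intro open_Collect_conj open_Collect_less continuous_intros)
qed

lemma zero_in_box_nbhd: "0 < d \<Longrightarrow> 0 \<in> box_nbhd d"
  by (simp add: box_nbhd_def singular_factor_def)

text \<open>With half-width d at most 1 one has u^2 \<le> |u|, so 2 |v| < 13 d and |u| + |v| < 15 d
  / 2; this explains the 8.\<close>

lemma box_nbhd_subset_ball:
  assumes "0 < r"
  shows "box_nbhd (min 1 (r / 8)) \<subseteq> ball 0 r"
proof
  fix w assume w: "w \<in> box_nbhd (min 1 (r / 8))"
  let ?d = "min 1 (r / 8)"
  have 1: "\<bar>w$1\<bar> < ?d" "\<bar>singular_factor w\<bar> < ?d" using w by (auto simp: box_nbhd_def)
  have "(w$1)^2 = \<bar>w$1\<bar> * \<bar>w$1\<bar>" by (simp add: power2_eq_square)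
  also have "\<dots> \<le> \<bar>w$1\<bar> * 1" using 1 by (intro mult_left_mono) auto
  finally have "(w$1)^2 \<le> \<bar>w$1\<bar>" by simp
  then have "2 * \<bar>w$2\<bar> < ?d + 12 * ?d"
    using 1 zero_le_power2[of "w$1"] unfolding singular_factor_def by linarith
  then have "\<bar>w$1\<bar> + \<bar>w$2\<bar> < r" using 1 assms by linarith
  moreover have "norm w \<le> \<bar>w$1\<bar> + \<bar>w$2\<bar>"
    using norm_le_l1_cart[of w] by (simp add: sum_2)
  ultimately show "w \<in> ball 0 r" by simp
qed

text \<open>The map \<open>?f\<close> inverts (u, v) \<mapsto> (u, \<lambda>), so the side is the
  continuous image of a convex rectangle.\<close>

lemma connected_box_nbhd_side:
  assumes "0 < d" "s = 1 \<or> s = -1"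
  shows "connected (box_nbhd d \<inter> {w. 0 < s * singular_factor w})"
    and "box_nbhd d \<inter> {w. 0 < s * singular_factor w} \<noteq> {}"
proof -
  let ?f = "\<lambda>(u, l). vector [u, (l - 12 * u^2) / 2] :: real^2"
  let ?I = "if s = 1 then {0<..<d} else {-d<..<0}"
  have sf: "singular_factor (?f (u, l)) = l" for u l by (simp add: singular_factor_def field_simps)
  have eq: "box_nbhd d \<inter> {w. 0 < s * singular_factor w} = ?f ` ({-d<..<d} \<times> ?I)"
  proof (intro equalityI subsetI)
    fix w assume w: "w \<in> box_nbhd d \<inter> {w. 0 < s * singular_factor w}"
    have "w = ?f (w$1, singular_factor w)" by (simp add: vec_eq_iff forall_2 singular_factor_def)
    moreover have "(w$1, singular_factor w) \<in> {-d<..<d} \<times> ?I"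
      using w assms(2) by (auto simp: box_nbhd_def)
    ultimately show "w \<in> ?f ` ({-d<..<d} \<times> ?I)" by blast
  next
    fix w assume "w \<in> ?f ` ({-d<..<d} \<times> ?I)"
    then obtain u l where "w = ?f (u, l)" "u \<in> {-d<..<d}" "l \<in> ?I" by blast
    then show "w \<in> box_nbhd d \<inter> {w. 0 < s * singular_factor w}"
      using assms(2) sf[of u l] by (auto simp: box_nbhd_def split: if_splits)
  qed
  have cont: "continuous_on X ?f" for X
    unfolding case_prod_unfold vector_2_eq_axis by (intro continuous_intros) auto
  have conv: "convex ({-d<..<d} \<times> ?I)" by (intro convex_Times) (auto split: if_splits)
  show "connected (box_nbhd d \<inter> {w. 0 < s * singular_factor w})"
    unfolding eq by (intro connected_continuous_image cont convex_connected conv)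
  have "(0, s * d / 2) \<in> {-d<..<d} \<times> ?I" using assms by auto
  then show "box_nbhd d \<inter> {w. 0 < s * singular_factor w} \<noteq> {}" unfolding eq by blast
qed

context swallowtail_chart
begin

lemma small_box_nbhd:
  obtains d where "0 < d" "box_nbhd d \<subseteq> \<Omega>"
    "\<And>w. w \<in> box_nbhd d \<Longrightarrow> 0 < B w * (\<alpha> * \<beta>)"
    "\<And>w. w \<in> box_nbhd d \<Longrightarrow> 0 < (Gd 1 w \<bullet> n w) * \<alpha>"
proof -
  have ab: "\<alpha> * \<beta> \<noteq> 0" using \<alpha>_nonzero \<beta>_nonzero by simp
  have cB: "continuous_on \<Omega> (\<lambda>w. B w * (\<alpha> * \<beta>))"
    by (intro smooth_on_imp_continuous_on smooth_on_mult smooth_on_const smooth_B open_\<Omega>)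
  have cG: "continuous_on \<Omega> (\<lambda>w. (Gd 1 w \<bullet> n w) * \<alpha>)"
    by (intro smooth_on_imp_continuous_on smooth_on_mult smooth_on_inner smooth_on_const smooth_Gd smooth_n open_\<Omega>)
  have "open ((\<Omega> \<inter> (\<lambda>w. B w * (\<alpha> * \<beta>)) -` {0<..}) \<inter> (\<Omega> \<inter> (\<lambda>w. (Gd 1 w \<bullet> n w) * \<alpha>) -` {0<..}))"
    by (intro open_Int continuous_open_preimage cB cG open_\<Omega> open_greaterThan)
  moreover have "0 < B 0 * (\<alpha> * \<beta>)" "0 < (Gd 1 0 \<bullet> n 0) * \<alpha>"
    unfolding B_0 \<alpha>_def[symmetric] using ab \<alpha>_nonzero not_real_square_gt_zero by blast+
  ultimately obtain r where r: "0 < r"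
    "ball 0 r \<subseteq> (\<Omega> \<inter> (\<lambda>w. B w * (\<alpha> * \<beta>)) -` {0<..}) \<inter> (\<Omega> \<inter> (\<lambda>w. (Gd 1 w \<bullet> n w) * \<alpha>) -` {0<..})"
    using zero_\<Omega> by (metis (no_types, lifting) IntI greaterThan_iff openE vimageI)
  show thesis
  proof (rule that)
    show "0 < min 1 (r / 8)" using r by simp
    show "box_nbhd (min 1 (r / 8)) \<subseteq> \<Omega>" using box_nbhd_subset_ball[OF r(1)] r(2) by blast
    show "0 < B w * (\<alpha> * \<beta>)" "0 < (Gd 1 w \<bullet> n w) * \<alpha>" if "w \<in> box_nbhd (min 1 (r / 8))" for w
      using subsetD[OF r(2) subsetD[OF box_nbhd_subset_ball[OF r(1)] that]] by auto
  qed
qed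

text \<open>Approach \<open>q\<close> along the v-direction from the side \<open>s\<close>, where
  \<open>singular_factor\<close> equals 2 s t. A bound M for the quotient would give |B / gram|
  \<le> 2 t M, which tends to 0, although the left side has a nonzero limit at
  \<open>q\<close>.\<close>

lemma curvature_unbounded_at_singular:
  assumes N: "open N" "q \<in> N" "N \<subseteq> \<Omega>" and q: "singular_factor q = 0" and B: "B q \<noteq> 0"
    and s: "s = 1 \<or> s = -1"
  shows "\<not> bounded ((\<lambda>w. B w / (singular_factor w * gram w)) ` (N \<inter> {w. 0 < s * singular_factor w}))"
proof
  assume "bounded ((\<lambda>w. B w / (singular_factor w * gram w)) ` (N \<inter> {w. 0 < s * singular_factor w}))"
  then obtain M where M: "\<And>w. w \<in> N \<Longrightarrow> 0 < s * singular_factor w \<Longrightarrow> \<bar>B w / (singular_factor w * gram w)\<bar> \<le> M"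
    by (auto simp: bounded_iff)
  have q\<Omega>: "q \<in> \<Omega>" using N by blast
  define p where "p t = q + (s * t) *\<^sub>R axis 2 1" for t :: real
  have p0: "p 0 = q" by (simp add: p_def)
  have cp: "isCont p 0" unfolding p_def by (intro continuous_intros)
  have sf: "singular_factor (p t) = 2 * s * t" for t
    using q by (simp add: singular_factor_def p_def)
  have ss: "s * s = 1" using s by auto
  have "isCont (\<lambda>w. B w / gram w) q"
    using gram_pos[OF q\<Omega>] smooth_on_imp_isCont[OF smooth_B q\<Omega>] smooth_on_imp_isCont[OF smooth_gram q\<Omega>]
    by (intro continuous_intros) auto
  then have "isCont (\<lambda>t. B (p t) / gram (p t)) 0"
    using isCont_o2[OF cp, where g="\<lambda>w. B w / gram w"] p0 by simp
  then have "((\<lambda>t. B (p t) / gram (p t)) \<longlongrightarrow> B q / gram q) (at_right 0)"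
    using p0 by (simp add: isCont_def filterlim_at_split)
  then have 1: "((\<lambda>t. \<bar>B (p t) / gram (p t)\<bar>) \<longlongrightarrow> \<bar>B q / gram q\<bar>) (at_right 0)"
    by (rule tendsto_rabs)
  have 2: "((\<lambda>t. 2 * t * M) \<longlongrightarrow> 2 * 0 * M) (at_right (0::real))"
    by (intro tendsto_intros)
  have evp: "\<forall>\<^sub>F t in at_right 0. p t \<in> N"
    using cp N p0 by (metis isCont_def topological_tendstoD filterlim_at_split)
  have "\<forall>\<^sub>F t in at_right 0. \<bar>B (p t) / gram (p t)\<bar> \<le> 2 * t * M"
    using evp eventually_at_right_less[of 0]
  proof eventually_elim
    case (elim t)
    have "s * singular_factor (p t) = 2 * (s * s) * t" by (simp add: sf)
    then have "0 < s * singular_factor (p t)" using elim ss by simp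
    from M[OF elim(1) this] have "\<bar>B (p t) / gram (p t)\<bar> / (2 * t) \<le> M"
      using s elim(2) by (auto simp: sf abs_mult mult.commute)
    moreover have "0 < 2 * t" using elim(2) by simp
    ultimately have "\<bar>B (p t) / gram (p t)\<bar> \<le> M * (2 * t)" by (simp only: pos_divide_le_eq)
    then show ?case by (simp only: mult.commute)
  qed
  from tendsto_le[OF _ 2 1 this] have "\<bar>B q / gram q\<bar> \<le> 0" by simp
  then show False using B gram_pos[OF q\<Omega>] by (simp add: divide_le_0_iff)
qed

end

text \<open>Swallowtail points are the quartics \<open>t\<^sup>4 + z t\<^sup>2 - y t + x\<close> with a double root \<open>u\<close>. Near the cuspidal
  edge with triple root \<open>m\<close> such a quartic splits as \<open>(t + 3 m) ((t - m)\<^sup>3 - 3 X (t - m) + 2 Y)\<close>,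
  and the cubic factor has a double root \<open>m + a\<close> iff \<open>(X, Y) = (a\<^sup>2, a\<^sup>3)\<close>.\<close>

definition cusp_source :: "real \<Rightarrow> real^2 \<Rightarrow> real^2" where
  "cusp_source m w = vector [m + w$2 + w$1, - 3 * (w$1)^2 - 6 * (m + w$2)^2]"

definition cusp_target :: "real \<Rightarrow> real^3 \<Rightarrow> real^3" where
  "cusp_target m y = vector
    [9 * y$1 * (m + y$3)^2 + 6 * (m + y$3) * y$2 - 3 * (m + y$3)^4,
     6 * (m + y$3) * y$1 - 2 * y$2 - 8 * (m + y$3)^3,
     - 3 * y$1 - 6 * (m + y$3)^2]"

lemma swallowtail_form_cusp_source:
  "swallowtail_form (cusp_source m w) = cusp_target m (cuspidal_edge_form w)"
  by (simp add: vec_eq_iff forall_3 swallowtail_form_def cusp_source_def cusp_target_def cuspidal_edge_form_def)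
    (algebra)

text \<open>\<open>singular_factor\<close> is the second derivative of the quartic at its double
  root, that is, twice the product of the distances (with sign) to the other two roots. With M = m +
  b these are M - 2 a and -3 M, seen from M + a. Near a = 0 the sign is that of m a.\<close>

lemma singular_factor_cusp_source:
  "singular_factor (cusp_source m w) = 6 * w$1 * (4 * (m + w$2) + w$1)"
  unfolding singular_factor_def cusp_source_def vector_2 by algebra

lemma smooth_on_cusp_source: "open S \<Longrightarrow> smooth_on S (cusp_source m)"
  unfolding cusp_source_def[abs_def] by (intro smooth_on_intros)

lemma smooth_on_cusp_target: "open S \<Longrightarrow> smooth_on S (cusp_target m)"
  unfolding cusp_target_def[abs_def] by (intro smooth_on_intros)

lemma smooth_on_cuspidal_edge_form: "open S \<Longrightarrow> smooth_on S cuspidal_edge_form"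
  unfolding cuspidal_edge_form_def[abs_def] by (intro smooth_on_intros)

lemma frechet_derivative_cusp_source_0:
  "frechet_derivative (cusp_source m) (at 0) X = vector [X$1 + X$2, - 12 * m * X$2]"
proof -
  have "(cusp_source m has_derivative (\<lambda>X. vector [X$1 + X$2, - 12 * m * X$2])) (at 0)"
    unfolding cusp_source_def
    by (rule has_derivative_vector_2) (auto intro!: derivative_eq_intros)
  then show ?thesis by (simp add: frechet_derivative_eqI)
qed

lemma has_derivative_cusp_target:
  "(cusp_target m has_derivative (\<lambda>X. vector
    [9 * (m + y$3)^2 * X$1 + 6 * (m + y$3) * X$2 + (18 * y$1 * (m + y$3) + 6 * y$2 - 12 * (m + y$3)^3) * X$3,
     6 * (m + y$3) * X$1 - 2 * X$2 + (6 * y$1 - 24 * (m + y$3)^2) * X$3,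
     - 3 * X$1 - 12 * (m + y$3) * X$3])) (at y)"
  unfolding cusp_target_def[abs_def]
  by (rule has_derivative_vector_3)
    (auto intro!: derivative_eq_intros simp: algebra_simps power2_eq_square power3_eq_cube fun_eq_iff)

lemma inj_cusp_source_0:
  assumes "m \<noteq> 0"
  shows "inj (frechet_derivative (cusp_source m) (at 0))"
  unfolding frechet_derivative_cusp_source_0 inj_def
  using assms by (auto simp: vec_eq_iff forall_2 frechet_derivative_cusp_source_0)

text \<open>\<open>cusp_target\<close> multiplies a linear factor with root -3 m by a cubic with
  triple root m. For nonzero m the factors are coprime, and multiplication of coprime monic
  polynomials is a local diffeomorphism.\<close>

lemma inj_cusp_target_0:
  assumes "m \<noteq> 0"
  shows "inj (frechet_derivative (cusp_target m) (at 0))"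
proof -
  let ?D = "frechet_derivative (cusp_target m) (at 0)"
  have D: "?D X = vector [9 * m^2 * X$1 + 6 * m * X$2 - 12 * m^3 * X$3,
      6 * m * X$1 - 2 * X$2 - 24 * m^2 * X$3, - 3 * X$1 - 12 * m * X$3]" for X
    by (subst frechet_derivative_eqI[OF has_derivative_cusp_target]) simp
  have "linear ?D" by (subst frechet_derivative_eqI[OF has_derivative_cusp_target], rule has_derivative_linear[OF has_derivative_cusp_target])
  moreover have "X = 0" if "?D X = 0" for X
  proof -
    have 3: "X$1 = - 4 * m * X$3"
      using that by (simp add: D vec_eq_iff forall_3)
    have 2: "X$2 = 3 * m * X$1 - 12 * m^2 * X$3"
      using that by (simp add: D vec_eq_iff forall_3)
    have 1: "9 * m^2 * X$1 + 6 * m * X$2 - 12 * m^3 * X$3 = 0"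
      using that by (simp add: D vec_eq_iff forall_3)
    have "192 * m^3 * X$3 = 0" using 1 unfolding 2 3 by algebra
    then have "X$3 = 0" using assms by simp
    then show "X = 0" using 2 3 by (simp add: vec_eq_iff forall_3)
  qed
  ultimately show ?thesis by (simp add: linear_injective_0)
qed

section \<open>The equation of the cuspidal edge and its invariance\<close>

text \<open>The defining function of the cuspidal edge: it is negative exactly on the thin side, so
  its differential is a conormal of the surface pointing outward.\<close>

definition cusp_equation :: "real^3 \<Rightarrow> real" where
  "cusp_equation y = (y$2)^2 - (y$1)^3"

lemma has_derivative_cusp_equation:
  "(cusp_equation has_derivative (\<lambda>X. 2 * y$2 * X$2 - 3 * (y$1)^2 * X$1)) (at y)"
  unfolding cusp_equation_def[abs_def]
  by (auto intro!: derivative_eq_intros simp: algebra_simps power2_eq_square fun_eq_iff)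

lemma cusp_equation_cuspidal_edge_form: "cusp_equation (cuspidal_edge_form w) = 0"
  by (simp add: cusp_equation_def cuspidal_edge_form_def power_mult[symmetric])

text \<open>A diffeomorphism germ \<open>\<kappa>\<close> that maps the cuspidal edge to itself, with \<open>\<tau>\<close> the induced map of the
  parameters, preserves the thin component. With \<open>\<rho> = \<partial>\<^sub>1 \<tau>\<^sub>1 (0)\<close>, the increment of
  \<open>\<kappa>\<^sub>2\<close> from \<open>(a\<^sup>2, -a\<^sup>3, 0)\<close> to \<open>(a\<^sup>2, a\<^sup>3, 0)\<close> shows \<open>\<partial>\<^sub>2 \<kappa>\<^sub>2 (0) = \<rho>\<^sup>3\<close>.\<close>

lemma cusp_equation_compose_sign:
  fixes \<kappa> :: "real^3 \<Rightarrow> real^3" and \<tau> :: "real^2 \<Rightarrow> real^2"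
  assumes T: "open T" "0 \<in> T" "smooth_on T \<kappa>" "inj (frechet_derivative \<kappa> (at 0))"
    and N: "open N" "0 \<in> N" "\<tau> differentiable (at 0)" "\<tau> 0 = 0"
    and eq: "\<And>w. w \<in> N \<Longrightarrow> cuspidal_edge_form w \<in> T \<and> \<kappa> (cuspidal_edge_form w) = cuspidal_edge_form (\<tau> w)"
  shows "\<forall>\<^sub>F a in at 0. 0 < a * frechet_derivative (\<lambda>y. cusp_equation (\<kappa> y))
    (at (cuspidal_edge_form (vector [a, 0]))) (axis 2 1)"
proof -
  define A where "A a = \<tau> (vector [a, 0]) $ 1" for a
  define C where "C b = \<tau> (vector [0, b]) $ 1" for b
  define \<rho> where "\<rho> = frechet_derivative \<tau> (at 0) (axis 1 1) $ 1"
  define K where "K j y = \<kappa> y $ j" for j y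
  define DK where "DK j i y = frechet_derivative (K j) (at y) (axis i 1)" for i j :: 3 and y
  define p where "p a = (vector [a, 0] :: real^2)" for a
  define q where "q a = (vector [a^2, a^3, 0] :: real^3)" for a
  have smK: "smooth_on T (K j)" for j unfolding K_def[abs_def] by (intro smooth_on_component T)
  have smDK: "smooth_on T (DK j i)" for i j unfolding DK_def[abs_def] by (intro smooth_on_frechet_derivative smK)
  have v0: "(vector [0, 0] :: real^2) = 0" "(vector [0, 0, 0] :: real^3) = 0"
    by (simp_all add: vec_eq_iff forall_2 forall_3)
  have dtau: "(\<tau> has_derivative frechet_derivative \<tau> (at 0)) (at 0)" by (rule has_derivative_frechet[OF N(3)])
  have lint: "linear (frechet_derivative \<tau> (at 0))" by (rule linear_frechet_derivative[OF N(3)])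
  have dA: "(A has_real_derivative \<rho>) (at 0)"
  proof -
    have "((\<lambda>a. vector [a, 0] :: real^2) has_derivative (\<lambda>k. k *\<^sub>R axis 1 1)) (at 0)"
      unfolding vector_2_eq_axis by (auto intro!: derivative_eq_intros)
    from has_derivative_component[OF has_derivative_compose[OF this, of \<tau> "frechet_derivative \<tau> (at 0)"], of 1]
    have "(A has_derivative (\<lambda>k. frechet_derivative \<tau> (at 0) (k *\<^sub>R axis 1 1) $ 1)) (at 0)"
      using dtau v0 by (simp add: A_def[abs_def])
    then show ?thesis
      unfolding has_field_derivative_def
      by (rule has_derivative_eq_rhs) (simp add: linear_cmul[OF lint] \<rho>_def fun_eq_iff)
  qed
  have dC: "(C has_real_derivative (frechet_derivative \<tau> (at 0) (axis 2 1) $ 1)) (at 0)"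
  proof -
    have "((\<lambda>b. vector [0, b] :: real^2) has_derivative (\<lambda>k. k *\<^sub>R axis 2 1)) (at 0)"
      unfolding vector_2_eq_axis by (auto intro!: derivative_eq_intros)
    from has_derivative_component[OF has_derivative_compose[OF this, of \<tau> "frechet_derivative \<tau> (at 0)"], of 1]
    have "(C has_derivative (\<lambda>k. frechet_derivative \<tau> (at 0) (k *\<^sub>R axis 2 1) $ 1)) (at 0)"
      using dtau v0 by (simp add: C_def[abs_def])
    then show ?thesis
      unfolding has_field_derivative_def
      by (rule has_derivative_eq_rhs) (simp add: linear_cmul[OF lint] fun_eq_iff)
  qed
  have A0: "A 0 = 0" and C0: "C 0 = 0" using N(4) by (simp_all add: A_def C_def v0)
  have cp: "isCont p 0" unfolding p_def vector_2_eq_axis by (intro continuous_intros)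
  have evO: "\<forall>\<^sub>F a in at 0. p a \<in> N"
    using cp N v0 by (metis isCont_def p_def topological_tendstoD)
  have cuspp: "cuspidal_edge_form (p a) = q a" for a
    by (simp add: cuspidal_edge_form_def p_def q_def)
  \<comment> \<open>The map of space sends cusp points to cusp points, so its first two components
    there are the square and the cube of one number.\<close>
  have Kq: "K 1 (q a) = A a ^ 2 \<and> K 2 (q a) = A a ^ 3" if "p a \<in> N" for a
    using eq[OF that] unfolding cuspp by (simp add: K_def A_def cuspidal_edge_form_def p_def)
  have cq: "isCont q 0" unfolding q_def vector_3_eq_axis by (intro continuous_intros)
  have q0: "q 0 = 0" by (simp add: q_def v0)
  have Aa: "((\<lambda>a. A a / a) \<longlongrightarrow> \<rho>) (at 0)"
    using dA by (simp add: has_field_derivative_iff A0)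
  have Alim: "(A \<longlongrightarrow> 0) (at 0)"
    using DERIV_isCont[OF dA] by (simp add: isCont_def A0)
  have limDK: "((\<lambda>a. DK j i (q a)) \<longlongrightarrow> DK j i 0) (at 0)" for i j
    using isCont_o2[OF cq, where g="DK j i"] smooth_on_imp_isCont[OF smDK T(2)] q0 by (simp add: isCont_def)
  have nz: "\<forall>\<^sub>F a in at 0. a \<noteq> (0::real)" by (rule eventually_neq_at_within)

  have K22: "DK 2 2 0 = \<rho>^3"
  proof -
    obtain r where r: "0 < r" "ball 0 r \<subseteq> T" using T(1,2) openE by blast
    let ?L = "\<lambda>a. (A a ^ 3 - A (- a) ^ 3) / (2 * a^3)"
    have "filterlim (\<lambda>a::real. - a) (at 0) (at 0)"
      unfolding filterlim_at using nz by (auto intro!: tendsto_eq_intros simp: eventually_at_filter)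
    from filterlim_compose[OF Aa this] have lim1: "((\<lambda>a. A (- a) / (- a)) \<longlongrightarrow> \<rho>) (at 0)" .
    have "((\<lambda>a. ((A a / a)^3 + (A (- a) / (- a))^3) / 2) \<longlongrightarrow> (\<rho>^3 + \<rho>^3) / 2) (at 0)"
      by (intro tendsto_intros Aa lim1) simp
    then have "(?L \<longlongrightarrow> (\<rho>^3 + \<rho>^3) / 2) (at 0)"
      by (rule Lim_transform_eventually)
        (use nz in eventually_elim, simp add: power_divide diff_divide_distrib add_divide_distrib)
    then have L1: "(?L \<longlongrightarrow> \<rho>^3) (at_right 0)" by (simp add: filterlim_at_split)
    have L2: "(?L \<longlongrightarrow> DK 2 2 0) (at_right 0)"
    proof (rule tendstoI)
      fix \<epsilon> :: real assume "\<epsilon> > 0"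
      then obtain d where d: "d > 0" "\<And>y. dist y 0 < d \<Longrightarrow> dist (DK 2 2 y) (DK 2 2 0) < \<epsilon>"
        using smooth_on_imp_isCont[OF smDK T(2)] unfolding continuous_at_eps_delta by metis
      have "((\<lambda>a::real. a^2 + a^3) \<longlongrightarrow> 0) (at_right 0)" by (auto intro!: tendsto_eq_intros)
      then have small: "\<forall>\<^sub>F a in at_right 0. a^2 + a^3 < min d r"
        using d r by (intro order_tendstoD(2)[of _ 0]) auto
      have evN': "\<forall>\<^sub>F a in at_right 0. p a \<in> N" "\<forall>\<^sub>F a in at_right 0. p (- a) \<in> N"
        using evO eventually_compose_filterlim[OF evO \<open>filterlim (\<lambda>a::real. - a) (at 0) (at 0)\<close>]
        by (simp_all add: eventually_at_split)
      show "\<forall>\<^sub>F a in at_right 0. dist (?L a) (DK 2 2 0) < \<epsilon>"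
        using small evN' eventually_at_right_less[of 0]
      proof eventually_elim
        case (elim a)
        let ?v = "\<lambda>y. vector [a^2, y, 0] :: real^3"
        have nv: "norm (?v y) < min d r" if "\<bar>y\<bar> \<le> a^3" for y
          using norm_le_l1_cart[of "?v y"] that elim(1) by (simp add: sum_3)
        have der: "((\<lambda>y. K 2 (?v y)) has_real_derivative DK 2 2 (?v y)) (at y)" if "- (a^3) \<le> y" "y \<le> a^3" for y
        proof -
          have vT: "?v y \<in> T" using nv[of y] that r by auto
          have "(?v has_derivative (\<lambda>k. k *\<^sub>R axis 2 1)) (at y)"
            unfolding vector_3_eq_axis by (auto intro!: derivative_eq_intros)
          from has_derivative_compose[OF this smooth_on_imp_has_derivative[OF smK vT]]
          show ?thesis
            unfolding has_field_derivative_def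
            by (rule has_derivative_eq_rhs)
              (simp add: DK_def fun_eq_iff linear_cmul[OF linear_frechet_derivative[OF smooth_on_imp_differentiable[OF smK vT]]])
        qed
        have "- (a^3) < a^3" using elim by simp
        from MVT2[OF this der] obtain \<xi> where \<xi>: "- (a^3) < \<xi>" "\<xi> < a^3"
          "K 2 (?v (a^3)) - K 2 (?v (- (a^3))) = (a^3 - - (a^3)) * DK 2 2 (?v \<xi>)" by blast
        have "?v (a^3) = q a" "?v (- (a^3)) = q (- a)" by (simp_all add: q_def)
        then have "A a ^ 3 - A (- a) ^ 3 = 2 * a^3 * DK 2 2 (?v \<xi>)"
          using \<xi>(3) Kq[OF elim(2)] Kq[OF elim(3)] by simp
        then have "?L a = DK 2 2 (?v \<xi>)" using elim by simp
        then show ?case using d(2)[of "?v \<xi>"] nv[of \<xi>] \<xi> by simp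
      qed
    qed
    show ?thesis by (rule tendsto_unique[OF trivial_limit_at_right_real L2 L1])
  qed

  have p0N: "p 0 \<in> N" using N(2) by (simp add: p_def v0)
  have K20: "K 2 0 = 0" using Kq[OF p0N] q0 A0 by simp
  have K21: "DK 2 1 0 = 0"
  proof -
    \<comment> \<open>A curve with tangent \<open>axis 1 1\<close> at 0 whose part s = a^2 runs
      along the upper branch of the cusp, where the second component is of order a^3. For negative s
      the root is \<open>- sqrt (- s)\<close>, which keeps the curve differentiable at 0 from both
      sides.\<close>
    define P where "P s = (vector [s, s * sqrt s, 0] :: real^3)" for s
    have P0: "P 0 = 0" by (simp add: P_def v0)
    have "((\<lambda>s. sqrt s) \<longlongrightarrow> 0) (at (0::real))"
      using tendsto_real_sqrt[OF tendsto_ident_at[of "0::real"]] by simp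
    then have "((\<lambda>s. (s * sqrt s) / s) \<longlongrightarrow> 0) (at 0)"
      by (rule Lim_transform_eventually) (use nz in eventually_elim, simp)
    then have "((\<lambda>s. s * sqrt s) has_real_derivative 0) (at 0)" by (simp add: has_field_derivative_iff)
    then have "((\<lambda>s. s * sqrt s) has_derivative (\<lambda>k. 0)) (at 0)"
      by (rule has_field_derivative_imp_has_derivative[THEN has_derivative_eq_rhs]) (simp add: fun_eq_iff)
    from has_derivative_vector_3[OF has_derivative_ident this has_derivative_const[of 0]]
    have "(P has_derivative (\<lambda>k. k *\<^sub>R axis 1 1)) (at 0)"
      unfolding P_def by (rule has_derivative_eq_rhs) (simp add: vector_3_eq_axis)
    from has_derivative_compose[OF this, of "K 2" "frechet_derivative (K 2) (at 0)"]
    have "((\<lambda>s. K 2 (P s)) has_derivative (\<lambda>k. frechet_derivative (K 2) (at 0) (k *\<^sub>R axis 1 1))) (at 0)"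
      using smooth_on_imp_has_derivative[OF smK T(2)] P0 by simp
    then have "((\<lambda>s. K 2 (P s)) has_real_derivative DK 2 1 0) (at 0)"
      unfolding has_field_derivative_def
      by (rule has_derivative_eq_rhs)
        (simp add: DK_def fun_eq_iff linear_cmul[OF linear_frechet_derivative[OF smooth_on_imp_differentiable[OF smK T(2)]]])
    then have "((\<lambda>s. K 2 (P s) / s) \<longlongrightarrow> DK 2 1 0) (at 0)"
      by (simp add: has_field_derivative_iff P0 K20)
    moreover have "filterlim (\<lambda>a::real. a^2) (at 0) (at_right 0)"
      unfolding filterlim_at using eventually_at_right_less[of "0::real"]
      by (auto intro!: tendsto_eq_intros elim!: eventually_mono)
    ultimately have "((\<lambda>a. K 2 (P (a^2)) / a^2) \<longlongrightarrow> DK 2 1 0) (at_right 0)"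
      by (rule filterlim_compose)
    then have l1: "((\<lambda>a. (A a / a)^3 * a) \<longlongrightarrow> DK 2 1 0) (at_right 0)"
    proof (rule Lim_transform_eventually)
      have "\<forall>\<^sub>F a in at_right 0. p a \<in> N" using evO by (simp add: eventually_at_split)
      then show "\<forall>\<^sub>F a in at_right 0. K 2 (P (a^2)) / a^2 = (A a / a)^3 * a"
        using eventually_at_right_less[of 0]
      proof eventually_elim
        case (elim a)
        have "P (a^2) = q a" using elim by (simp add: P_def q_def power2_eq_square power3_eq_cube)
        then show ?case using Kq[OF elim(1)] elim(2) by (simp add: field_simps power2_eq_square power3_eq_cube)
      qed
    qed
    have "((\<lambda>a. (A a / a)^3 * a) \<longlongrightarrow> \<rho>^3 * 0) (at 0)" by (intro tendsto_intros Aa)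
    then have l2: "((\<lambda>a. (A a / a)^3 * a) \<longlongrightarrow> 0) (at_right 0)" by (simp add: filterlim_at_split)
    show ?thesis by (rule tendsto_unique[OF trivial_limit_at_right_real l1 l2])
  qed
  \<comment> \<open>Along the edge itself the second component is the cube of a function vanishing
    at 0.\<close>
  have K23: "DK 2 3 0 = 0"
  proof -
    have "((\<lambda>b. vector [0, 0, b] :: real^3) has_derivative (\<lambda>k. k *\<^sub>R axis 3 1)) (at 0)"
      unfolding vector_3_eq_axis by (auto intro!: derivative_eq_intros)
    from has_derivative_compose[OF this, of "K 2" "frechet_derivative (K 2) (at 0)"]
    have "((\<lambda>b. K 2 (vector [0, 0, b])) has_derivative (\<lambda>k. frechet_derivative (K 2) (at 0) (k *\<^sub>R axis 3 1))) (at 0)"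
      using smooth_on_imp_has_derivative[OF smK T(2)] v0 by simp
    then have 1: "((\<lambda>b. K 2 (vector [0, 0, b])) has_real_derivative DK 2 3 0) (at 0)"
      unfolding has_field_derivative_def
      by (rule has_derivative_eq_rhs)
        (simp add: DK_def fun_eq_iff linear_cmul[OF linear_frechet_derivative[OF smooth_on_imp_differentiable[OF smK T(2)]]])
    have "((\<lambda>b. C b ^ 3) has_real_derivative 0) (at 0)"
      using DERIV_power[OF dC, of 3] by (simp add: C0)
    moreover have "\<forall>\<^sub>F b in nhds 0. C b ^ 3 = K 2 (vector [0, 0, b])"
    proof -
      have "isCont (\<lambda>b. vector [0, b] :: real^2) 0" unfolding vector_2_eq_axis by (intro continuous_intros)
      then have "((\<lambda>b. vector [0, b] :: real^2) \<longlongrightarrow> 0) (nhds 0)"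
        using v0 by (simp add: tendsto_nhds_iff isCont_def)
      then have "\<forall>\<^sub>F b in nhds 0. (vector [0, b] :: real^2) \<in> N" using N by (simp add: topological_tendstoD)
      then show ?thesis
      proof eventually_elim
        case (elim b)
        have "cuspidal_edge_form (vector [0, b]) = vector [0, 0, b]" by (simp add: cuspidal_edge_form_def)
        then show ?case using eq[OF elim] by (simp add: K_def C_def cuspidal_edge_form_def)
      qed
    qed
    ultimately have "((\<lambda>b. K 2 (vector [0, 0, b])) has_real_derivative 0) (at 0)"
      by (subst (asm) DERIV_cong_ev[OF refl _ refl]) auto
    then show ?thesis using 1 DERIV_unique by blast
  qed
  \<comment> \<open>Otherwise the whole second row of the differential would vanish, contradicting
    invertibility.\<close>
  have \<rho>: "\<rho> \<noteq> 0"
  proof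
    assume "\<rho> = 0"
    have dk: "\<kappa> differentiable (at 0)" by (rule smooth_on_imp_differentiable[OF T(3,2)])
    have "surj (frechet_derivative \<kappa> (at 0))"
      by (rule linear_injective_imp_surjective[OF linear_frechet_derivative[OF dk] T(4)]) simp
    then obtain X where X: "frechet_derivative \<kappa> (at 0) X = axis 2 1" by (metis surjD)
    have "frechet_derivative (K 2) (at 0) = (\<lambda>X. frechet_derivative \<kappa> (at 0) X $ 2)"
      unfolding K_def by (rule frechet_derivative_eqI[OF has_derivative_component[OF has_derivative_frechet[OF dk]]])
    then have "frechet_derivative (K 2) (at 0) X = 1" using X by (simp add: axis_def)
    moreover have "frechet_derivative (K 2) (at 0) X = 0"
      by (subst frechet_derivative_linear_3[OF smooth_on_imp_differentiable[OF smK T(2)]])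
        (use K21 K22 K23 \<open>\<rho> = 0\<close> in \<open>simp add: DK_def\<close>)
    ultimately show False by simp
  qed
  have "((\<lambda>a. (A a / a)^3 * (2 * DK 2 2 (q a) - 3 * A a * DK 1 2 (q a))) \<longlongrightarrow> \<rho>^3 * (2 * DK 2 2 0 - 3 * 0 * DK 1 2 0)) (at 0)"
    by (intro tendsto_intros Aa limDK Alim)
  moreover have "0 < \<rho>^3 * (2 * DK 2 2 0 - 3 * 0 * DK 1 2 0)"
    using \<rho> by (simp add: K22 power_add[symmetric] flip: power_mult_distrib)
  ultimately have "\<forall>\<^sub>F a in at 0. 0 < (A a / a)^3 * (2 * DK 2 2 (q a) - 3 * A a * DK 1 2 (q a))"
    by (rule order_tendstoD(1))
  then show ?thesis
    using nz evO
  proof eventually_elim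
    case (elim a)
    have qT: "q a \<in> T" using eq[OF elim(3)] cuspp by simp
    have dk: "(\<kappa> has_derivative frechet_derivative \<kappa> (at (q a))) (at (q a))"
      by (rule smooth_on_imp_has_derivative[OF T(3) qT])
    have DKk: "DK j i (q a) = frechet_derivative \<kappa> (at (q a)) (axis i 1) $ j" for i j
      unfolding DK_def K_def by (subst frechet_derivative_eqI[OF has_derivative_component[OF dk]]) simp
    have "frechet_derivative (\<lambda>y. cusp_equation (\<kappa> y)) (at (q a)) (axis 2 1)
       = 2 * K 2 (q a) * DK 2 2 (q a) - 3 * (K 1 (q a))^2 * DK 1 2 (q a)"
      unfolding DKk by (subst frechet_derivative_eqI[OF has_derivative_compose[OF dk has_derivative_cusp_equation]]) (simp add: K_def)
    also have "\<dots> = A a ^ 3 * (2 * DK 2 2 (q a) - 3 * A a * DK 1 2 (q a))"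
      using Kq[OF elim(3)] by (simp add: algebra_simps power2_eq_square power3_eq_cube)
    finally have fd: "frechet_derivative (\<lambda>y. cusp_equation (\<kappa> y)) (at (q a)) (axis 2 1)
       = A a ^ 3 * (2 * DK 2 2 (q a) - 3 * A a * DK 1 2 (q a))" .
    \<comment> \<open>The derivative of the equation has leading term 2 \<rho>^6 a^3; multiplying by
      \<open>a\<close> makes every power of \<open>a\<close> even, which handles both signs of
      \<open>a\<close> at once.\<close>
    have "a * (x ^ 3 * y) = a^4 * ((x / a)^3 * y)" for x y :: real
      using elim(2) by (simp add: field_simps power3_eq_cube power4_eq_xxxx)
    then have "a * frechet_derivative (\<lambda>y. cusp_equation (\<kappa> y)) (at (q a)) (axis 2 1)
       = a^4 * ((A a / a)^3 * (2 * DK 2 2 (q a) - 3 * A a * DK 1 2 (q a)))"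
      unfolding fd .
    moreover have "0 < a^4" using elim(2) by simp
    ultimately show ?case using elim(1) cuspp[of a] by (simp add: p_def)
  qed
qed


section \<open>Local coordinates on surfaces\<close>

lemma smooth_on_local:
  assumes "open S" "\<And>x. x \<in> S \<Longrightarrow> \<exists>T. open T \<and> x \<in> T \<and> smooth_on T f"
  shows "smooth_on S f"
proof -
  have "Ck_on k S g" if "\<And>x. x \<in> S \<Longrightarrow> \<exists>T. open T \<and> x \<in> T \<and> Ck_on k T g" for k and g :: "'a \<Rightarrow> 'b"
    using that
  proof (induction k arbitrary: g)
    case 0
    have "isCont g x" if "x \<in> S" for x
      using 0[OF that] by (auto simp: continuous_on_eq_continuous_at)
    then show ?case by (simp add: continuous_at_imp_continuous_on)
  next
    case (Suc k)
    have "g differentiable (at x)" if "x \<in> S" for x using Suc.prems[OF that] by auto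
    moreover have "Ck_on k S (\<lambda>x. frechet_derivative g (at x) v)" for v
    proof (rule Suc.IH)
      fix x assume "x \<in> S"
      then show "\<exists>T. open T \<and> x \<in> T \<and> Ck_on k T (\<lambda>x. frechet_derivative g (at x) v)"
        using Suc.prems by fastforce
    qed
    ultimately show ?case by simp
  qed
  then show ?thesis using assms(2) unfolding smooth_on_def by meson
qed

section \<open>Diffeomorphisms of open sets\<close>

lemma diffeomorphism_onD:
  assumes "diffeomorphism_on V \<Phi>"
  shows "open V" "open (\<Phi> ` V)" "inj_on \<Phi> V" "smooth_on V \<Phi>" "smooth_on (\<Phi> ` V) (inv_into V \<Phi>)"
  using assms by (simp_all add: diffeomorphism_on_def)

lemma diffeomorphism_on_subset:
  fixes \<Phi> :: "'a::real_normed_vector \<Rightarrow> 'b::real_normed_vector"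
  assumes "diffeomorphism_on V \<Phi>" "open V'" "V' \<subseteq> V"
  shows "diffeomorphism_on V' \<Phi>"
proof -
  note D = diffeomorphism_onD[OF assms(1)]
  have inj: "inj_on \<Phi> V'" using D(3) assms(3) by (rule inj_on_subset)
  have im: "\<Phi> ` V' = \<Phi> ` V \<inter> inv_into V \<Phi> -` V'"
    using D(3) assms(3) by (force simp: inv_into_f_f subset_iff)
  have "open (\<Phi> ` V')"
    unfolding im by (rule continuous_open_preimage[OF smooth_on_imp_continuous_on[OF D(5)] D(2) assms(2)])
  moreover have "smooth_on (\<Phi> ` V') (inv_into V' \<Phi>)"
  proof (rule smooth_on_cong)
    show "smooth_on (\<Phi> ` V') (inv_into V \<Phi>)" using D(5) assms(3) by (auto intro: smooth_on_subset)
    show "inv_into V \<Phi> y = inv_into V' \<Phi> y" if "y \<in> \<Phi> ` V'" for y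
      using that D(3) inj assms(3) by (auto simp: inv_into_f_f subset_iff)
  qed fact
  ultimately show ?thesis
    using inj assms D(4) by (auto simp: diffeomorphism_on_def intro: smooth_on_subset)
qed

lemma diffeomorphism_on_inv_into:
  fixes \<Phi> :: "'a::real_normed_vector \<Rightarrow> 'b::real_normed_vector"
  assumes "diffeomorphism_on V \<Phi>"
  shows "diffeomorphism_on (\<Phi> ` V) (inv_into V \<Phi>)"
proof -
  note D = diffeomorphism_onD[OF assms]
  have im: "inv_into V \<Phi> ` \<Phi> ` V = V" using D(3) by (force simp: image_image inv_into_f_f)
  have inj: "inj_on (inv_into V \<Phi>) (\<Phi> ` V)" by (rule inj_on_inv_into) simp
  have "smooth_on V (inv_into (\<Phi> ` V) (inv_into V \<Phi>))"
  proof (rule smooth_on_cong[OF D(1) _ D(4)])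
    fix x assume x: "x \<in> V"
    have "inv_into (\<Phi> ` V) (inv_into V \<Phi>) (inv_into V \<Phi> (\<Phi> x)) = \<Phi> x"
      using inj x by (intro inv_into_f_f) auto
    then show "\<Phi> x = inv_into (\<Phi> ` V) (inv_into V \<Phi>) x" using x D(3) by (simp add: inv_into_f_f)
  qed
  then show ?thesis using D inj im by (simp add: diffeomorphism_on_def)
qed

lemma diffeomorphism_on_compose:
  fixes \<Phi> :: "'a::euclidean_space \<Rightarrow> 'b::euclidean_space" and \<Theta> :: "'b \<Rightarrow> 'c::euclidean_space"
  assumes "diffeomorphism_on V \<Phi>" "diffeomorphism_on Z \<Theta>"
  shows "diffeomorphism_on {y\<in>V. \<Phi> y \<in> Z} (\<Theta> \<circ> \<Phi>)"
proof -
  let ?V = "{y\<in>V. \<Phi> y \<in> Z}"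
  note D = diffeomorphism_onD[OF assms(1)] and E = diffeomorphism_onD[OF assms(2)]
  have "?V = V \<inter> \<Phi> -` Z" by auto
  then have oV: "open ?V"
    using continuous_open_preimage[OF smooth_on_imp_continuous_on[OF D(4)] D(1) E(1)] by simp
  note D' = diffeomorphism_onD[OF diffeomorphism_on_subset[OF assms(1) oV Collect_restrict]]
  have sub: "\<Phi> ` ?V \<subseteq> Z" by auto
  note E' = diffeomorphism_onD[OF diffeomorphism_on_subset[OF assms(2) D'(2) sub]]
  have inj: "inj_on (\<Theta> \<circ> \<Phi>) ?V" by (rule comp_inj_on[OF D'(3) E'(3)])
  have im: "(\<Theta> \<circ> \<Phi>) ` ?V = \<Theta> ` \<Phi> ` ?V" by (simp add: image_comp)
  have "smooth_on ?V (\<Theta> \<circ> \<Phi>)"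
    unfolding o_def by (rule smooth_on_compose[OF oV E(1,4) D'(4) sub])
  moreover have "smooth_on ((\<Theta> \<circ> \<Phi>) ` ?V) (inv_into ?V (\<Theta> \<circ> \<Phi>))"
  proof (rule smooth_on_cong)
    show "open ((\<Theta> \<circ> \<Phi>) ` ?V)" unfolding im by (rule E'(2))
    show "smooth_on ((\<Theta> \<circ> \<Phi>) ` ?V) (\<lambda>z. inv_into ?V \<Phi> (inv_into (\<Phi> ` ?V) \<Theta> z))"
      unfolding im
      by (rule smooth_on_compose[OF E'(2) D'(2) D'(5) E'(5)]) (use E'(3) in \<open>auto simp: inv_into_f_f\<close>)
    fix z assume "z \<in> (\<Theta> \<circ> \<Phi>) ` ?V"
    then obtain y where y: "y \<in> ?V" "z = \<Theta> (\<Phi> y)" by auto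
    have "inv_into ?V (\<Theta> \<circ> \<Phi>) z = y" using inv_into_f_f[OF inj y(1)] y(2) by simp
    moreover have "inv_into (\<Phi> ` ?V) \<Theta> z = \<Phi> y" unfolding y(2) by (rule inv_into_f_f[OF E'(3)]) (use y in blast)
    ultimately show "inv_into ?V \<Phi> (inv_into (\<Phi> ` ?V) \<Theta> z) = inv_into ?V (\<Theta> \<circ> \<Phi>) z"
      using inv_into_f_f[OF D'(3) y(1)] by simp
  qed
  ultimately show ?thesis
    using oV inj E'(2) unfolding diffeomorphism_on_def im by blast
qed

text \<open>The chain rule for the identity, composed of the two maps, shows that one differential
  is a left inverse of the other.\<close>

lemma inj_frechet_derivative_of_left_inverse:
  fixes \<Phi> :: "'a::real_normed_vector \<Rightarrow> 'b::real_normed_vector"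
  assumes "open V" "x \<in> V" "\<Phi> differentiable (at x)" "\<Psi> differentiable (at (\<Phi> x))" "\<And>y. y \<in> V \<Longrightarrow> \<Psi> (\<Phi> y) = y"
  shows "frechet_derivative \<Psi> (at (\<Phi> x)) (frechet_derivative \<Phi> (at x) v) = v"
    and "inj (frechet_derivative \<Phi> (at x))"
proof -
  have "((\<lambda>y. \<Psi> (\<Phi> y)) has_derivative (\<lambda>v. frechet_derivative \<Psi> (at (\<Phi> x)) (frechet_derivative \<Phi> (at x) v))) (at x)"
    by (intro has_derivative_compose[OF has_derivative_frechet has_derivative_frechet] assms)
  then have "((\<lambda>y. y) has_derivative (\<lambda>v. frechet_derivative \<Psi> (at (\<Phi> x)) (frechet_derivative \<Phi> (at x) v))) (at x)"
    by (rule has_derivative_transform_within_open[OF _ assms(1,2)]) (rule assms(5))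
  from has_derivative_unique[OF this has_derivative_ident]
  show *: "frechet_derivative \<Psi> (at (\<Phi> x)) (frechet_derivative \<Phi> (at x) v) = v" for v
    by (simp add: fun_eq_iff)
  show "inj (frechet_derivative \<Phi> (at x))" by (rule injI) (metis *)
qed

lemma diffeomorphism_on_inj_inverse:
  assumes "diffeomorphism_on V \<Phi>" "y \<in> \<Phi> ` V"
  shows "inj (frechet_derivative (inv_into V \<Phi>) (at y))"
proof -
  note D = diffeomorphism_onD[OF assms(1)]
  have "inv_into V \<Phi> y \<in> V" using assms(2) by (rule inv_into_into)
  then show ?thesis
    by (intro inj_frechet_derivative_of_left_inverse(2)[OF D(2) assms(2) smooth_on_imp_differentiable[OF D(5) assms(2)]
          smooth_on_imp_differentiable[OF D(4)]]) (simp_all add: f_inv_into_f)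
qed

lemma chart_local_coordinates:
  assumes "oriented_surface A" "(U, \<phi>) \<in> A"
  shows "local_coordinates A U \<phi>"
  using assms unfolding oriented_surface_def local_coordinates_def
  by (auto simp: Int_commute split: prod.splits)

lemma chart_cover:
  assumes "oriented_surface A"
  obtains U \<phi> where "(U, \<phi>) \<in> A" "x \<in> U"
proof -
  have "x \<in> (\<Union>(U, \<phi>)\<in>A. U)" using assms by (simp add: oriented_surface_def)
  then show thesis using that by auto
qed

section \<open>Coordinate systems and their changes\<close>

context
  fixes A :: "'m::topological_space chart set" and U :: "'m set" and \<psi> :: "'m \<Rightarrow> real^2"
  assumes os: "oriented_surface A" and lc: "local_coordinates A U \<psi>"
begin

lemma local_coordinates_open: "open U" "open (\<psi> ` U)"
  and local_coordinates_cont: "continuous_on U \<psi>" "continuous_on (\<psi> ` U) (inv_into U \<psi>)"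
  using lc by (simp_all add: local_coordinates_def homeomorphism_def)

lemma local_coordinates_left_inverse: "x \<in> U \<Longrightarrow> inv_into U \<psi> (\<psi> x) = x"
  using lc by (simp add: local_coordinates_def homeomorphism_def)

lemma local_coordinates_inj: "inj_on \<psi> U"
  by (rule inj_on_inverseI[of _ "inv_into U \<psi>"]) (rule local_coordinates_left_inverse)

lemma local_coordinates_open_image:
  assumes "open V"
  shows "open (\<psi> ` (U \<inter> V))"
proof -
  have "\<psi> ` (U \<inter> V) = \<psi> ` U \<inter> inv_into U \<psi> -` V"
    by (force simp: local_coordinates_left_inverse)
  then show ?thesis
    using continuous_open_preimage[OF local_coordinates_cont(2) local_coordinates_open(2) assms] by simp
qed

lemma local_coordinates_open_vimage:
  assumes "open R"
  shows "open {x\<in>U. \<psi> x \<in> R}"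
proof -
  have "{x\<in>U. \<psi> x \<in> R} = U \<inter> \<psi> -` R" by auto
  then show ?thesis
    using continuous_open_preimage[OF local_coordinates_cont(1) local_coordinates_open(1) assms] by simp
qed

lemma in_chart_apply: "x \<in> U \<Longrightarrow> in_chart U \<psi> F (\<psi> x) = F x"
  by (simp add: in_chart_def local_coordinates_left_inverse)

lemma local_coordinates_transition:
  assumes "(V, \<phi>) \<in> A"
  shows "smooth_on (\<phi> ` (U \<inter> V)) (in_chart V \<phi> \<psi>)" "smooth_on (\<psi> ` (U \<inter> V)) (in_chart U \<psi> \<phi>)"
  using lc assms by (auto simp: local_coordinates_def)

lemma in_chart_image: "V \<subseteq> U \<Longrightarrow> in_chart U \<psi> F ` \<psi> ` V = F ` V"
  by (force simp: in_chart_apply)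

end

lemma local_coordinates_compose:
  fixes \<psi> :: "'m::topological_space \<Rightarrow> real^2"
  assumes os: "oriented_surface A" and lc: "local_coordinates A U \<psi>"
    and \<Theta>: "diffeomorphism_on Z \<Theta>"
  shows "local_coordinates A {x\<in>U. \<psi> x \<in> Z} (\<Theta> \<circ> \<psi>)"
proof -
  note lc_open_vimage = local_coordinates_open_vimage[OF os lc]
    and lc_open_image = local_coordinates_open_image[OF os lc]
    and lc_inj = local_coordinates_inj[OF os lc]
    and lc_cont = local_coordinates_cont[OF os lc]
    and lc_left_inverse = local_coordinates_left_inverse[OF os lc]
    and lc_open = local_coordinates_open[OF os lc]
    and lc_transition = local_coordinates_transition[OF os lc]
  let ?U = "{x\<in>U. \<psi> x \<in> Z}"
  note E = diffeomorphism_onD[OF \<Theta>]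
  have oU: "open ?U" by (rule lc_open_vimage[OF E(1)])
  have UU: "U \<inter> ?U = ?U" by auto
  have o\<psi>: "open (\<psi> ` ?U)" using lc_open_image[OF oU] by (simp only: UU)
  have sub: "\<psi> ` ?U \<subseteq> Z" by auto
  note E' = diffeomorphism_onD[OF diffeomorphism_on_subset[OF \<Theta> o\<psi> sub]]
  have im: "(\<Theta> \<circ> \<psi>) ` ?U = \<Theta> ` \<psi> ` ?U" by (simp add: image_comp)
  have inj: "inj_on (\<Theta> \<circ> \<psi>) ?U"
    by (rule comp_inj_on[OF inj_on_subset[OF lc_inj] E'(3)]) auto
  have inv: "inv_into ?U (\<Theta> \<circ> \<psi>) z = inv_into U \<psi> (inv_into (\<psi> ` ?U) \<Theta> z)" if z: "z \<in> (\<Theta> \<circ> \<psi>) ` ?U" for z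
  proof -
    obtain x where x: "x \<in> ?U" "z = \<Theta> (\<psi> x)" using z by auto
    have "inv_into ?U (\<Theta> \<circ> \<psi>) z = x" using inv_into_f_f[OF inj x(1)] x(2) by simp
    moreover have "inv_into (\<psi> ` ?U) \<Theta> z = \<psi> x" unfolding x(2) by (rule inv_into_f_f[OF E'(3)]) (use x in blast)
    ultimately show ?thesis using x lc_left_inverse by auto
  qed
  have c1: "continuous_on ?U (\<Theta> \<circ> \<psi>)"
    by (intro continuous_on_compose continuous_on_subset[OF lc_cont(1)]
        smooth_on_imp_continuous_on E'(4)) auto
  have c2: "continuous_on ((\<Theta> \<circ> \<psi>) ` ?U) (inv_into ?U (\<Theta> \<circ> \<psi>))"
  proof (subst continuous_on_cong[OF refl inv])
    show "continuous_on ((\<Theta> \<circ> \<psi>) ` ?U) (\<lambda>z. inv_into U \<psi> (inv_into (\<psi> ` ?U) \<Theta> z))"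
      unfolding im
      by (rule continuous_on_compose2[OF lc_cont(2) smooth_on_imp_continuous_on[OF E'(5)]])
        (use E'(3) in \<open>auto simp: inv_into_f_f\<close>)
  qed
  have hom: "homeomorphism ?U ((\<Theta> \<circ> \<psi>) ` ?U) (\<Theta> \<circ> \<psi>) (inv_into ?U (\<Theta> \<circ> \<psi>))"
    using c1 c2 inj by (intro homeomorphismI) (auto simp: inv_into_f_f f_inv_into_f simp del: o_apply)
  have "smooth_on (\<phi> ` (?U \<inter> V)) (in_chart V \<phi> (\<Theta> \<circ> \<psi>)) \<and>
        smooth_on ((\<Theta> \<circ> \<psi>) ` (?U \<inter> V)) (in_chart ?U (\<Theta> \<circ> \<psi>) \<phi>)" if V: "(V, \<phi>) \<in> A" for V \<phi>
  proof
    have lcV: "local_coordinates A V \<phi>" by (rule chart_local_coordinates[OF os V])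
    have o1: "open (\<phi> ` (?U \<inter> V))"
      using local_coordinates_open_image[OF os lcV oU] by (simp add: Int_commute)
    have "\<phi> ` (?U \<inter> V) \<subseteq> \<phi> ` (U \<inter> V)" by auto
    note s1 = smooth_on_subset[OF lc_transition(1)[OF V] this]
    have "in_chart V \<phi> \<psi> ` \<phi> ` (?U \<inter> V) \<subseteq> Z"
      by (subst in_chart_image[OF os lcV]) auto
    from smooth_on_compose[OF o1 E(1,4) s1 this]
    show "smooth_on (\<phi> ` (?U \<inter> V)) (in_chart V \<phi> (\<Theta> \<circ> \<psi>))" by (simp add: in_chart_def o_def)
  next
    have oV: "open V" using local_coordinates_open(1)[OF os chart_local_coordinates[OF os V]] .
    have o1: "open (\<psi> ` (?U \<inter> V))"
      using lc_open_image[OF open_Int[OF oU oV]] by (simp only: Int_assoc[symmetric] UU)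
    have sub1: "\<psi> ` (?U \<inter> V) \<subseteq> Z" by auto
    note E1 = diffeomorphism_onD[OF diffeomorphism_on_subset[OF \<Theta> o1 sub1]]
    have o2: "open ((\<Theta> \<circ> \<psi>) ` (?U \<inter> V))" using E1(2) by (simp add: image_comp)
    have "\<psi> ` (?U \<inter> V) \<subseteq> \<psi> ` (U \<inter> V)" by auto
    note s2 = smooth_on_subset[OF lc_transition(2)[OF V] this]
    have s3: "smooth_on ((\<Theta> \<circ> \<psi>) ` (?U \<inter> V)) (inv_into (\<psi> ` ?U) \<Theta>)"
      by (rule smooth_on_subset[OF E'(5)]) auto
    have "inv_into (\<psi> ` ?U) \<Theta> ` (\<Theta> \<circ> \<psi>) ` (?U \<inter> V) \<subseteq> \<psi> ` (?U \<inter> V)"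
      using E'(3) by (auto simp: inv_into_f_f)
    from smooth_on_compose[OF o2 o1 s2 s3 this]
    show "smooth_on ((\<Theta> \<circ> \<psi>) ` (?U \<inter> V)) (in_chart ?U (\<Theta> \<circ> \<psi>) \<phi>)"
      by (rule smooth_on_cong[OF o2, rotated]) (use inv in \<open>auto simp: in_chart_def simp del: o_apply\<close>, simp)
  qed
  then show ?thesis
    unfolding local_coordinates_def using oU hom E'(2) im by auto
qed


lemma smooth_on_in_chart:
  fixes f :: "'m::topological_space \<Rightarrow> 'b::real_normed_vector"
  assumes os: "oriented_surface A" and lc: "local_coordinates A U \<psi>" and f: "smooth_map A f"
  shows "smooth_on (\<psi> ` U) (in_chart U \<psi> f)"
proof (rule smooth_on_local)
  show "open (\<psi> ` U)" by (rule local_coordinates_open(2)[OF os lc])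
  fix w assume "w \<in> \<psi> ` U"
  then obtain x where x: "x \<in> U" "w = \<psi> x" by blast
  obtain V \<phi> where V: "(V, \<phi>) \<in> A" "x \<in> V" using chart_cover[OF os] .
  note lcV = chart_local_coordinates[OF os V(1)]
  have o: "open (\<psi> ` (U \<inter> V))"
    by (rule local_coordinates_open_image[OF os lc local_coordinates_open(1)[OF os lcV]])
  have fV: "smooth_on (\<phi> ` V) (in_chart V \<phi> f)" using f V by (auto simp: smooth_map_def)
  have "in_chart U \<psi> \<phi> ` \<psi> ` (U \<inter> V) \<subseteq> \<phi> ` V"
    by (subst in_chart_image[OF os lc]) auto
  from smooth_on_compose[OF o local_coordinates_open(2)[OF os lcV] fV local_coordinates_transition(2)[OF os lc V(1)] this]
  have "smooth_on (\<psi> ` (U \<inter> V)) (\<lambda>w. in_chart V \<phi> f (in_chart U \<psi> \<phi> w))" .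
  then have "smooth_on (\<psi> ` (U \<inter> V)) (in_chart U \<psi> f)"
    by (rule smooth_on_cong[OF o, rotated])
      (auto simp: in_chart_apply[OF os lc] in_chart_apply[OF os lcV])
  then show "\<exists>T. open T \<and> w \<in> T \<and> smooth_on T (in_chart U \<psi> f)"
    using o x V(2) by blast
qed

text \<open>Two coordinate systems that may both lie outside the atlas are compared through an atlas
  chart around each point.\<close>

lemma smooth_on_transition:
  assumes os: "oriented_surface A" and lc: "local_coordinates A U \<psi>" and lc': "local_coordinates A V \<phi>"
  shows "smooth_on (\<psi> ` (U \<inter> V)) (in_chart U \<psi> \<phi>)"
proof (rule smooth_on_local)
  show "open (\<psi> ` (U \<inter> V))"
    by (rule local_coordinates_open_image[OF os lc local_coordinates_open(1)[OF os lc']])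
  fix w assume "w \<in> \<psi> ` (U \<inter> V)"
  then obtain x where x: "x \<in> U" "x \<in> V" "w = \<psi> x" by blast
  obtain Q \<zeta> where Q: "(Q, \<zeta>) \<in> A" "x \<in> Q" using chart_cover[OF os] .
  note lcQ = chart_local_coordinates[OF os Q(1)]
  have oVQ: "open (V \<inter> Q)" using local_coordinates_open(1)[OF os lc'] local_coordinates_open(1)[OF os lcQ] by blast
  have o: "open (\<psi> ` (U \<inter> (V \<inter> Q)))" by (rule local_coordinates_open_image[OF os lc oVQ])
  have oQ: "open (\<zeta> ` (V \<inter> Q))"
    using local_coordinates_open_image[OF os lcQ local_coordinates_open(1)[OF os lc']] by (simp only: Int_commute)
  have s1: "smooth_on (\<psi> ` (U \<inter> (V \<inter> Q))) (in_chart U \<psi> \<zeta>)"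
    by (rule smooth_on_subset[OF local_coordinates_transition(2)[OF os lc Q(1)]]) auto
  have "in_chart U \<psi> \<zeta> ` \<psi> ` (U \<inter> (V \<inter> Q)) \<subseteq> \<zeta> ` (V \<inter> Q)"
    by (subst in_chart_image[OF os lc]) auto
  from smooth_on_compose[OF o oQ local_coordinates_transition(1)[OF os lc' Q(1)] s1 this]
  have "smooth_on (\<psi> ` (U \<inter> (V \<inter> Q))) (\<lambda>w. in_chart Q \<zeta> \<phi> (in_chart U \<psi> \<zeta> w))" .
  then have "smooth_on (\<psi> ` (U \<inter> (V \<inter> Q))) (in_chart U \<psi> \<phi>)"
    by (rule smooth_on_cong[OF o, rotated])
      (auto simp: in_chart_apply[OF os lc] in_chart_apply[OF os lcQ])
  then show "\<exists>T. open T \<and> w \<in> T \<and> smooth_on T (in_chart U \<psi> \<phi>)"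
    using o x Q(2) by blast
qed

text \<open>The fundamental notions are defined through charts of the atlas, whereas the
  computations live in normal form coordinates, which may even reverse the orientation. The
  injective linear map \<open>J\<close> carries one description to the other.\<close>

lemma transition_derivative:
  assumes os: "oriented_surface A" and lc: "local_coordinates A U \<psi>" and lc': "local_coordinates A V \<phi>"
    and x: "x \<in> U" "x \<in> V"
  defines "J \<equiv> frechet_derivative (in_chart V \<phi> \<psi>) (at (\<phi> x))"
  shows "linear J" "inj J"
    and "smooth_map A (f :: 'm::topological_space \<Rightarrow> 'b::real_normed_vector) \<Longrightarrow> differential V \<phi> f x X = differential U \<psi> f x (J X)"
proof -
  have VU: "smooth_on (\<phi> ` (V \<inter> U)) (in_chart V \<phi> \<psi>)" by (rule smooth_on_transition[OF os lc' lc])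
  have UV: "smooth_on (\<psi> ` (U \<inter> V)) (in_chart U \<psi> \<phi>)" by (rule smooth_on_transition[OF os lc lc'])
  have o: "open (\<phi> ` (V \<inter> U))"
    by (rule local_coordinates_open_image[OF os lc' local_coordinates_open(1)[OF os lc]])
  have xi: "\<phi> x \<in> \<phi> ` (V \<inter> U)" "\<psi> x \<in> \<psi> ` (U \<inter> V)" using x by auto
  have t: "in_chart V \<phi> \<psi> (\<phi> x) = \<psi> x" by (rule in_chart_apply[OF os lc' x(2)])
  have d1: "in_chart V \<phi> \<psi> differentiable (at (\<phi> x))" by (rule smooth_on_imp_differentiable[OF VU xi(1)])
  have d2: "in_chart U \<psi> \<phi> differentiable (at (in_chart V \<phi> \<psi> (\<phi> x)))"
    unfolding t by (rule smooth_on_imp_differentiable[OF UV xi(2)])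
  show "linear J" unfolding J_def by (rule linear_frechet_derivative[OF d1])
  show "inj J" unfolding J_def
    by (rule inj_frechet_derivative_of_left_inverse(2)[OF o xi(1) d1 d2])
      (auto simp: in_chart_apply[OF os lc] in_chart_apply[OF os lc'])
  assume f: "smooth_map A f"
  have "\<psi> x \<in> \<psi> ` U" using x by blast
  from smooth_on_imp_has_derivative[OF smooth_on_in_chart[OF os lc f] this]
  have "(in_chart U \<psi> f has_derivative differential U \<psi> f x) (at (in_chart V \<phi> \<psi> (\<phi> x)))"
    unfolding t differential_def .
  from has_derivative_compose[OF has_derivative_frechet[OF d1] this]
  have "((\<lambda>w. in_chart U \<psi> f (in_chart V \<phi> \<psi> w)) has_derivative (\<lambda>X. differential U \<psi> f x (J X))) (at (\<phi> x))"
    by (simp only: J_def)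
  then have "(in_chart V \<phi> f has_derivative (\<lambda>X. differential U \<psi> f x (J X))) (at (\<phi> x))"
    by (rule has_derivative_transform_within_open[OF _ o xi(1)])
      (auto simp: in_chart_apply[OF os lc] in_chart_apply[OF os lc'])
  then show "differential V \<phi> f x X = differential U \<psi> f x (J X)"
    by (simp add: differential_def frechet_derivative_eqI)
qed

lemma immersive_at_iff:
  fixes f :: "'m::topological_space \<Rightarrow> 'b::real_normed_vector"
  assumes os: "oriented_surface A" and lc: "local_coordinates A U \<psi>" and f: "smooth_map A f" and x: "x \<in> U"
  shows "immersive_at A f x \<longleftrightarrow> inj (differential U \<psi> f x)"
proof -
  have *: "inj (differential V \<phi> f x) \<longleftrightarrow> inj (differential U \<psi> f x)" if V: "(V, \<phi>) \<in> A" "x \<in> V" for V \<phi>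
  proof -
    note lcV = chart_local_coordinates[OF os V(1)]
    note T = transition_derivative[OF os lc lcV x V(2)] and T' = transition_derivative[OF os lcV lc V(2) x]
    have "differential V \<phi> f x = differential U \<psi> f x \<circ> frechet_derivative (in_chart V \<phi> \<psi>) (at (\<phi> x))"
      by (simp add: fun_eq_iff T(3)[OF f])
    moreover have "differential U \<psi> f x = differential V \<phi> f x \<circ> frechet_derivative (in_chart U \<psi> \<phi>) (at (\<psi> x))"
      by (simp add: fun_eq_iff T'(3)[OF f])
    ultimately show ?thesis using T(2) T'(2) by (metis inj_compose)
  qed
  obtain V \<phi> where "(V, \<phi>) \<in> A" "x \<in> V" using chart_cover[OF os] .
  then show ?thesis unfolding immersive_at_def using * by blast
qed

lemma linear_vec2_expand:
  fixes J :: "real^2 \<Rightarrow> 'b::real_vector"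
  assumes "linear J"
  shows "J X = X$1 *\<^sub>R J (axis 1 1) + X$2 *\<^sub>R J (axis 2 1)"
proof -
  have "X = X$1 *\<^sub>R axis 1 1 + X$2 *\<^sub>R axis 2 1"
    by (simp add: vec_eq_iff forall_2)
  then have "J X = J (X$1 *\<^sub>R axis 1 1 + X$2 *\<^sub>R axis 2 1)" by simp
  then show ?thesis by (simp add: linear_add[OF assms] linear_cmul[OF assms])
qed

lemma inj_linear_2_det:
  fixes J :: "real^2 \<Rightarrow> real^2"
  assumes "linear J" "inj J"
  shows "J (axis 1 1) $ 1 * J (axis 2 1) $ 2 - J (axis 1 1) $ 2 * J (axis 2 1) $ 1 \<noteq> 0"
proof -
  have "det (matrix J) \<noteq> 0" using assms by (metis det_nz_iff_inj)
  then show ?thesis by (simp add: det_2 matrix_def algebra_simps)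
qed

section \<open>Curvature of a front in arbitrary coordinates\<close>

text \<open>The Gauss equation holds in the chart chosen by \<open>SOME\<close>. Passing to
  \<open>\<psi>\<close> multiplies both determinants by the square of the Jacobian determinant
  \<open>j\<close>, so the quotient is unaffected, whatever the sign of \<open>j\<close>.\<close>

theorem gauss_curvature_eq:
  fixes f \<nu> :: "'m::topological_space \<Rightarrow> real^3"
  assumes os: "oriented_surface A" and fr: "front_with_normal A f \<nu>" and lc: "local_coordinates A U \<psi>"
    and x: "x \<in> U"
  defines "F i \<equiv> differential U \<psi> f x (axis i 1)" and "N i \<equiv> differential U \<psi> \<nu> x (axis i 1)"
  assumes reg: "(F 1 \<bullet> F 1) * (F 2 \<bullet> F 2) - (F 1 \<bullet> F 2) * (F 2 \<bullet> F 1) \<noteq> 0"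
  shows "gauss_curvature A f x = ((F 1 \<bullet> N 1) * (F 2 \<bullet> N 2) - (F 1 \<bullet> N 2) * (F 2 \<bullet> N 1))
    / ((F 1 \<bullet> F 1) * (F 2 \<bullet> F 2) - (F 1 \<bullet> F 2) * (F 2 \<bullet> F 1))"
proof -
  have sf: "smooth_map A f" and sn: "smooth_map A \<nu>" using fr by (auto simp: front_with_normal_def)
  define c where "c = (SOME (V, \<phi>). (V, \<phi>) \<in> A \<and> x \<in> V)"
  obtain V \<phi> where c: "c = (V, \<phi>)" by fastforce
  obtain V' \<phi>' where V': "(V', \<phi>') \<in> A" "x \<in> V'" using chart_cover[OF os] .
  have "case c of (V, \<phi>) \<Rightarrow> (V, \<phi>) \<in> A \<and> x \<in> V"
    unfolding c_def
    by (rule someI[where P="\<lambda>(V, \<phi>). (V, \<phi>) \<in> A \<and> x \<in> V" and x="(V', \<phi>')"]) (simp add: V')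
  then have V: "(V, \<phi>) \<in> A" "x \<in> V" by (auto simp: c)
  note lcV = chart_local_coordinates[OF os V(1)]
  let ?F = "in_chart V \<phi> f" and ?n = "in_chart V \<phi> \<nu>"
  define J where "J = frechet_derivative (in_chart V \<phi> \<psi>) (at (\<phi> x))"
  note T = transition_derivative[OF os lc lcV x V(2), folded J_def]
  have lin: "linear (differential U \<psi> g x)" if "smooth_map A g" for g :: "'m \<Rightarrow> real^3"
    unfolding differential_def
    by (rule linear_frechet_derivative[OF smooth_on_imp_differentiable[OF smooth_on_in_chart[OF os lc that]]]) (use x in blast)
  have DF: "partial i ?F (\<phi> x) = J (axis i 1) $ 1 *\<^sub>R F 1 + J (axis i 1) $ 2 *\<^sub>R F 2" for i
    using trans[OF T(3)[OF sf] linear_vec2_expand[OF lin[OF sf], of "J (axis i 1)"]]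
    unfolding F_def partial_def differential_def[of V, symmetric] .
  have DN: "partial i ?n (\<phi> x) = J (axis i 1) $ 1 *\<^sub>R N 1 + J (axis i 1) $ 2 *\<^sub>R N 2" for i
    using trans[OF T(3)[OF sn] linear_vec2_expand[OF lin[OF sn], of "J (axis i 1)"]]
    unfolding N_def partial_def differential_def[of V, symmetric] .
  define j where "j = J (axis 1 1) $ 1 * J (axis 2 1) $ 2 - J (axis 1 1) $ 2 * J (axis 2 1) $ 1"
  have j: "j \<noteq> 0" unfolding j_def by (rule inj_linear_2_det[OF T(1,2)])
  have gram: "det (pullback_metric ?F (\<phi> x)) = j^2 * ((F 1 \<bullet> F 1) * (F 2 \<bullet> F 2) - (F 1 \<bullet> F 2) * (F 2 \<bullet> F 1))"
    by (simp add: det_2 pullback_metric_def DF j_def inner_add_left inner_add_right) algebra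
  have second: "(partial 1 ?F (\<phi> x) \<bullet> partial 1 ?n (\<phi> x)) * (partial 2 ?F (\<phi> x) \<bullet> partial 2 ?n (\<phi> x))
      - (partial 1 ?F (\<phi> x) \<bullet> partial 2 ?n (\<phi> x)) * (partial 2 ?F (\<phi> x) \<bullet> partial 1 ?n (\<phi> x))
     = j^2 * ((F 1 \<bullet> N 1) * (F 2 \<bullet> N 2) - (F 1 \<bullet> N 2) * (F 2 \<bullet> N 1))"
    by (simp add: DF DN j_def inner_add_left inner_add_right) algebra
  have "metric_curvature (pullback_metric ?F) (\<phi> x) =
    ((partial 1 ?F (\<phi> x) \<bullet> partial 1 ?n (\<phi> x)) * (partial 2 ?F (\<phi> x) \<bullet> partial 2 ?n (\<phi> x))
      - (partial 1 ?F (\<phi> x) \<bullet> partial 2 ?n (\<phi> x)) * (partial 2 ?F (\<phi> x) \<bullet> partial 1 ?n (\<phi> x))) / det (pullback_metric ?F (\<phi> x))"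
  proof (rule gauss_equation[OF local_coordinates_open(2)[OF os lcV] smooth_on_in_chart[OF os lcV sf] smooth_on_in_chart[OF os lcV sn]])
    fix z assume "z \<in> \<phi> ` V"
    then obtain y where y: "y \<in> V" "z = \<phi> y" by blast
    show "norm (?n z) = 1" using fr y by (simp add: in_chart_apply[OF os lcV] front_with_normal_def)
    show "partial i ?F z \<bullet> ?n z = 0" for i
      using fr y V(1) by (auto simp: in_chart_apply[OF os lcV] front_with_normal_def partial_def differential_def)
  next
    show "\<phi> x \<in> \<phi> ` V" using V by blast
    show "det (pullback_metric ?F (\<phi> x)) \<noteq> 0" unfolding gram using reg j by simp
  qed
  then show ?thesis
    unfolding second gram using j
    by (simp add: gauss_curvature_def c_def[symmetric] c)
qed

lemma front_orthogonal:
  fixes f \<nu> :: "'m::topological_space \<Rightarrow> real^3"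
  assumes os: "oriented_surface A" and fr: "front_with_normal A f \<nu>" and lc: "local_coordinates A U \<psi>"
    and x: "x \<in> U"
  shows "differential U \<psi> f x X \<bullet> \<nu> x = 0"
proof -
  have sf: "smooth_map A f" using fr by (auto simp: front_with_normal_def)
  obtain V \<phi> where V: "(V, \<phi>) \<in> A" "x \<in> V" using chart_cover[OF os] .
  have "differential U \<psi> f x X = differential V \<phi> f x (frechet_derivative (in_chart U \<psi> \<phi>) (at (\<psi> x)) X)"
    by (rule transition_derivative(3)[OF os chart_local_coordinates[OF os V(1)] lc V(2) x sf])
  then show ?thesis using fr V by (auto simp: front_with_normal_def)
qed

text \<open>Turns a normal form at \<open>p\<close> into one at a nearby point \<open>q\<close>: if
  the old model precomposed with \<open>\<zeta>\<close> equals the new model followed by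
  \<open>\<Xi>\<close>, then the new coordinates are the old ones followed by the inverses of
  \<open>\<zeta>\<close> and \<open>\<Xi>\<close>.\<close>

lemma normalizes_compose:
  assumes os: "oriented_surface A" and nz: "normalizes A f p g U \<psi> V \<Phi>" and q: "q \<in> U"
    and X: "diffeomorphism_on X \<zeta>" "0 \<in> X" "\<zeta> 0 = \<psi> q"
    and Y: "diffeomorphism_on Y \<Xi>" "\<Xi> (0 :: real^3) = g (\<psi> q)"
    and g': "\<And>w. w \<in> X \<Longrightarrow> g' w \<in> Y \<and> g (\<zeta> w) = \<Xi> (g' w)" "g' 0 = 0"
  shows "normalizes A f q g' {x\<in>U. \<psi> x \<in> \<zeta> ` X} (inv_into X \<zeta> \<circ> \<psi>) {y\<in>V. \<Phi> y \<in> \<Xi> ` Y} (inv_into Y \<Xi> \<circ> \<Phi>)"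
proof -
  have lc: "local_coordinates A U \<psi>" and d: "diffeomorphism_on V \<Phi>" and fU: "f ` U \<subseteq> V"
    and eq: "\<And>x. x \<in> U \<Longrightarrow> \<Phi> (f x) = g (\<psi> x)"
    using nz by (auto simp: normalizes_def)
  note DX = diffeomorphism_onD[OF X(1)] and DY = diffeomorphism_onD[OF Y(1)]
  have l: "local_coordinates A {x\<in>U. \<psi> x \<in> \<zeta> ` X} (inv_into X \<zeta> \<circ> \<psi>)"
    by (rule local_coordinates_compose[OF os lc diffeomorphism_on_inv_into[OF X(1)]])
  have dd: "diffeomorphism_on {y\<in>V. \<Phi> y \<in> \<Xi> ` Y} (inv_into Y \<Xi> \<circ> \<Phi>)"
    by (rule diffeomorphism_on_compose[OF d diffeomorphism_on_inv_into[OF Y(1)]])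
  have q0: "inv_into X \<zeta> (\<psi> q) = 0" using inv_into_f_f[OF DX(3) X(2)] X(3) by simp
  have fx: "\<Phi> (f x) = \<Xi> (g' (inv_into X \<zeta> (\<psi> x)))" "g' (inv_into X \<zeta> (\<psi> x)) \<in> Y"
    if "x \<in> U" "\<psi> x \<in> \<zeta> ` X" for x
  proof -
    have "inv_into X \<zeta> (\<psi> x) \<in> X" "\<zeta> (inv_into X \<zeta> (\<psi> x)) = \<psi> x"
      using that by (simp_all add: inv_into_into f_inv_into_f)
    then show "\<Phi> (f x) = \<Xi> (g' (inv_into X \<zeta> (\<psi> x)))" "g' (inv_into X \<zeta> (\<psi> x)) \<in> Y"
      using g'(1)[of "inv_into X \<zeta> (\<psi> x)"] eq that by auto
  qed
  have q': "\<psi> q \<in> \<zeta> ` X" using X by (metis imageI)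
  have f0: "inv_into Y \<Xi> (\<Phi> (f q)) = 0"
    using fx[OF q q'] q0 g'(2) inv_into_f_f[OF DY(3)] by simp
  show ?thesis
    unfolding normalizes_def
  proof (intro conjI ballI l dd)
    show "f ` {x\<in>U. \<psi> x \<in> \<zeta> ` X} \<subseteq> {y\<in>V. \<Phi> y \<in> \<Xi> ` Y}" using fx fU by force
    show "(inv_into Y \<Xi> \<circ> \<Phi>) (f x) = g' ((inv_into X \<zeta> \<circ> \<psi>) x)" if "x \<in> {x\<in>U. \<psi> x \<in> \<zeta> ` X}" for x
      using that fx[of x] inv_into_f_f[OF DY(3)] by simp
  qed (use q q' q0 f0 in auto)
qed

lemma covector_of_tangent_plane:
  fixes \<omega> :: "real^3 \<Rightarrow> real" and F1 F2 n :: "real^3"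
  assumes "linear \<omega>" "\<omega> F1 = 0" "\<omega> F2 = 0" "F1 \<bullet> n = 0" "F2 \<bullet> n = 0" "norm n = 1"
    and "(F1 \<bullet> F1) * (F2 \<bullet> F2) - (F1 \<bullet> F2) * (F1 \<bullet> F2) \<noteq> 0"
  shows "\<omega> y = \<omega> n * (y \<bullet> n)"
proof -
  define a where "a = adjoint \<omega> 1"
  have a: "\<omega> y = y \<bullet> a" for y
    using adjoint_works[OF assms(1), of y 1] by (simp add: a_def inner_commute)
  have "a = (a \<bullet> n) *\<^sub>R n"
    using assms(2-) by (intro normal_decomposition[of n F1 F2]) (simp_all add: a inner_commute)
  then show ?thesis unfolding a by (metis inner_commute inner_scaleR_right mult.commute)
qed

text \<open>At a point of the surface the equation vanishes, so its first-order change along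
  \<open>v\<close> decides on which side the segment starts.\<close>

lemma thin_component_test:
  assumes d: "diffeomorphism_on V \<Phi>" and y: "y \<in> V" "cusp_equation (\<Phi> y) = 0"
  defines "\<omega> \<equiv> frechet_derivative (\<lambda>z. cusp_equation (\<Phi> z)) (at y)"
  shows "0 < \<omega> v \<Longrightarrow> \<forall>\<^sub>F s in at_right 0. y + s *\<^sub>R v \<notin> thin_component V \<Phi>"
    and "\<omega> v < 0 \<Longrightarrow> \<forall>\<^sub>F s in at_right 0. y + s *\<^sub>R v \<in> thin_component V \<Phi>"
proof -
  note D = diffeomorphism_onD[OF d]
  have thin: "z \<in> thin_component V \<Phi> \<longleftrightarrow> z \<in> V \<and> cusp_equation (\<Phi> z) < 0" for z
    by (simp add: thin_component_def cusp_equation_def)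
  let ?h = "\<lambda>s. cusp_equation (\<Phi> (y + s *\<^sub>R v))"
  have dz: "((\<lambda>z. cusp_equation (\<Phi> z)) has_derivative \<omega>) (at y)"
    unfolding \<omega>_def
    by (rule has_derivative_frechet,
        rule differentiableI[OF has_derivative_compose[OF smooth_on_imp_has_derivative[OF D(4) y(1)] has_derivative_cusp_equation]])
  have "((\<lambda>s. y + s *\<^sub>R v) has_derivative (\<lambda>k. k *\<^sub>R v)) (at 0)" by (auto intro!: derivative_eq_intros)
  from has_derivative_compose[OF this, of "\<lambda>z. cusp_equation (\<Phi> z)" \<omega>]
  have "(?h has_derivative (\<lambda>k. \<omega> (k *\<^sub>R v))) (at 0)" using dz by simp
  then have "(?h has_real_derivative \<omega> v) (at 0)"
    unfolding has_field_derivative_def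
    by (rule has_derivative_eq_rhs) (simp add: linear_cmul[OF has_derivative_linear[OF dz]] fun_eq_iff)
  then have lim: "((\<lambda>s. ?h s / s) \<longlongrightarrow> \<omega> v) (at_right 0)"
    by (simp add: has_field_derivative_iff y(2) filterlim_at_split)
  show "\<forall>\<^sub>F s in at_right 0. y + s *\<^sub>R v \<notin> thin_component V \<Phi>" if "0 < \<omega> v"
    using order_tendstoD(1)[OF lim that] eventually_at_right_less[of 0]
    by eventually_elim (simp add: thin zero_less_divide_iff)
  have "isCont (\<lambda>s. y + s *\<^sub>R v) 0" by (intro continuous_intros)
  then have "((\<lambda>s. y + s *\<^sub>R v) \<longlongrightarrow> y) (at_right 0)" by (simp add: isCont_def filterlim_at_split)
  then have evV: "\<forall>\<^sub>F s in at_right 0. y + s *\<^sub>R v \<in> V" using D(1) y(1) by (rule topological_tendstoD)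
  show "\<forall>\<^sub>F s in at_right 0. y + s *\<^sub>R v \<in> thin_component V \<Phi>" if "\<omega> v < 0"
    using order_tendstoD(2)[OF lim that] eventually_at_right_less[of 0] evV
    by eventually_elim (simp add: thin divide_less_0_iff)
qed


section \<open>Conormals of cuspidal edges\<close>

lemma cuspidal_edge_form_inj:
  assumes "cuspidal_edge_form w = cuspidal_edge_form w'"
  shows "w = w'"
proof -
  have "(w$1)^3 = (w'$1)^3" "w$2 = w'$2"
    using assms by (simp_all add: cuspidal_edge_form_def vec_eq_iff forall_3)
  then have "w$1 = w'$1" by (metis odd_numeral odd_real_root_power_cancel)
  then show ?thesis using \<open>w$2 = w'$2\<close> by (simp add: vec_eq_iff forall_2)
qed

section \<open>A generic swallowtail with a fixed normal form\<close>

locale generic_front_swallowtail =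
  fixes A :: "'m::{t2_space, second_countable_topology} chart set"
    and f \<nu> :: "'m \<Rightarrow> real^3" and p :: 'm
    and U :: "'m set" and \<psi> :: "'m \<Rightarrow> real^2" and V :: "(real^3) set" and \<Phi> :: "real^3 \<Rightarrow> real^3"
  assumes os: "oriented_surface A" and fr: "front_with_normal A f \<nu>"
    and nz: "normalizes A f p swallowtail_form U \<psi> V \<Phi>"
    and gen: "\<exists>(Q, \<phi>)\<in>A. p \<in> Q \<and> (\<exists>X Y. second_fundamental_form Q \<phi> f \<nu> p X Y \<noteq> 0)"
begin

lemma lc: "local_coordinates A U \<psi>" and pU: "p \<in> U" and \<psi>p: "\<psi> p = 0"
  and d\<Phi>: "diffeomorphism_on V \<Phi>" and fU: "x \<in> U \<Longrightarrow> f x \<in> V"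
  and \<Phi>f: "x \<in> U \<Longrightarrow> \<Phi> (f x) = swallowtail_form (\<psi> x)"
  using nz by (auto simp: normalizes_def)

lemma sf: "smooth_map A f" and sn: "smooth_map A \<nu>" and norm_\<nu>: "norm (\<nu> x) = 1"
  using fr by (auto simp: front_with_normal_def)

lemma chart_apply: "x \<in> U \<Longrightarrow> in_chart U \<psi> F (\<psi> x) = F x"
  by (rule in_chart_apply[OF os lc])

lemma inv_\<psi>: "w \<in> \<psi> ` U \<Longrightarrow> inv_into U \<psi> w \<in> U" "w \<in> \<psi> ` U \<Longrightarrow> \<psi> (inv_into U \<psi> w) = w"
  by (simp_all add: inv_into_into f_inv_into_f)

lemma f_eq: "x \<in> U \<Longrightarrow> f x = inv_into V \<Phi> (swallowtail_form (\<psi> x))"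
  using inv_into_f_f[OF diffeomorphism_onD(3)[OF d\<Phi>] fU] \<Phi>f by metis

sublocale swallowtail_chart "\<psi> ` U" "\<Phi> ` V" "inv_into V \<Phi>" "in_chart U \<psi> \<nu>" "in_chart U \<psi> f"
proof
  show "open (\<psi> ` U)" by (rule local_coordinates_open(2)[OF os lc])
  show "0 \<in> \<psi> ` U" using pU \<psi>p by force
  show "open (\<Phi> ` V)" "smooth_on (\<Phi> ` V) (inv_into V \<Phi>)" using diffeomorphism_onD[OF d\<Phi>] by auto
  show "swallowtail_form ` \<psi> ` U \<subseteq> \<Phi> ` V" using \<Phi>f[symmetric] fU by auto
  show "inj (frechet_derivative (inv_into V \<Phi>) (at y))" if "y \<in> \<Phi> ` V" for y
    by (rule diffeomorphism_on_inj_inverse[OF d\<Phi> that])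
  show "smooth_on (\<psi> ` U) (in_chart U \<psi> \<nu>)" by (rule smooth_on_in_chart[OF os lc sn])
  show "in_chart U \<psi> f w = inv_into V \<Phi> (swallowtail_form w)" if "w \<in> \<psi> ` U" for w
    using that by (auto simp: chart_apply f_eq)
  show "norm (in_chart U \<psi> \<nu> w) = 1" if "w \<in> \<psi> ` U" for w
    using that by (auto simp: chart_apply norm_\<nu>)
  show "frechet_derivative (in_chart U \<psi> f) (at w) X \<bullet> in_chart U \<psi> \<nu> w = 0" if "w \<in> \<psi> ` U" for w X
    using that front_orthogonal[OF os fr lc] by (auto simp: chart_apply differential_def)
  obtain Q \<phi> X Y where Q: "(Q, \<phi>) \<in> A" "p \<in> Q" and h: "second_fundamental_form Q \<phi> f \<nu> p X Y \<noteq> 0"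
    using gen by blast
  note T = transition_derivative(3)[OF os lc chart_local_coordinates[OF os Q(1)] pU Q(2)]
  show "\<exists>X Y. frechet_derivative (in_chart U \<psi> f) (at 0) X \<bullet> frechet_derivative (in_chart U \<psi> \<nu>) (at 0) Y \<noteq> 0"
    using h unfolding second_fundamental_form_def T[OF sf] T[OF sn] differential_def[of U] \<psi>p by auto
qed

lemma \<psi>_in: "x \<in> U \<Longrightarrow> \<psi> x \<in> \<psi> ` U" by blast

lemma independent:
  assumes "w \<in> \<psi> ` U" "a *\<^sub>R e w + b *\<^sub>R f2 w = 0"
  shows "a = 0" "b = 0"
proof -
  have 1: "a * (e w \<bullet> e w) + b * (e w \<bullet> f2 w) = 0"
    using arg_cong[OF assms(2), of "\<lambda>v. e w \<bullet> v"] by (simp add: inner_add_right)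
  have 2: "a * (e w \<bullet> f2 w) + b * (f2 w \<bullet> f2 w) = 0"
    using arg_cong[OF assms(2), of "\<lambda>v. v \<bullet> f2 w"] by (simp add: inner_add_left)
  have "a * gram w = 0" "b * gram w = 0" unfolding gram_def using 1 2 by algebra+
  then show "a = 0" "b = 0" using gram_pos[OF assms(1)] by auto
qed

lemma singular_iff:
  assumes x: "x \<in> U"
  shows "x \<in> singular_set A f \<longleftrightarrow> singular_factor (\<psi> x) = 0"
proof -
  let ?D = "frechet_derivative (in_chart U \<psi> f) (at (\<psi> x))"
  note D = frechet_derivative_F[OF \<psi>_in[OF x]]
  have "inj ?D \<longleftrightarrow> singular_factor (\<psi> x) \<noteq> 0"
  proof
    assume inj: "inj ?D"
    show "singular_factor (\<psi> x) \<noteq> 0"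
    proof
      assume "singular_factor (\<psi> x) = 0"
      then have "?D (axis 1 1) = ?D 0" by (simp add: D)
      then have "axis 1 (1::real) = (0 :: real^2)" using inj by (simp add: inj_eq)
      then show False by (metis axis_2_component(1) zero_index zero_neq_one)
    qed
  next
    assume nz: "singular_factor (\<psi> x) \<noteq> 0"
    show "inj ?D"
    proof (rule injI)
      fix X Y assume "?D X = ?D Y"
      then have "(singular_factor (\<psi> x) * (X$1 - Y$1)) *\<^sub>R e (\<psi> x) + (X$2 - Y$2) *\<^sub>R f2 (\<psi> x) = 0"
        by (simp add: D algebra_simps)
      from independent[OF \<psi>_in[OF x] this] nz show "X = Y" by (simp add: vec_eq_iff forall_2)
    qed
  qed
  then show ?thesis
    using immersive_at_iff[OF os lc sf x] by (simp add: singular_set_def differential_def)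
qed

lemma curvature_eq:
  assumes x: "x \<in> U" and reg: "singular_factor (\<psi> x) \<noteq> 0"
  shows "gauss_curvature A f x = B (\<psi> x) / (singular_factor (\<psi> x) * gram (\<psi> x))"
proof -
  note w = \<psi>_in[OF x]
  have p: "differential U \<psi> g x (axis i 1) = partial i (in_chart U \<psi> g) (\<psi> x)" for g :: "'m \<Rightarrow> real^3" and i
    by (simp add: differential_def partial_def)
  have "gauss_curvature A f x = singular_factor (\<psi> x) * B (\<psi> x) / ((singular_factor (\<psi> x))^2 * gram (\<psi> x))"
    using gram_pos[OF w] reg gauss_curvature_eq[OF os fr lc x]
    unfolding p det_second_form[OF w] det_first_form[OF w] by simp
  then show ?thesis using reg by (simp add: power2_eq_square)
qed

lemma has_derivative_cusp_equation_normalizes: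
  assumes "normalizes A f q cuspidal_edge_form U' \<psi>' V' \<Phi>'" "x \<in> U'"
  shows "((\<lambda>y. cusp_equation (\<Phi>' y)) has_derivative frechet_derivative (\<lambda>y. cusp_equation (\<Phi>' y)) (at (f x))) (at (f x))"
proof -
  have "diffeomorphism_on V' \<Phi>'" "f x \<in> V'" using assms by (auto simp: normalizes_def)
  then show ?thesis
    by (intro has_derivative_frechet differentiableI[OF has_derivative_compose[OF
            smooth_on_imp_has_derivative[OF diffeomorphism_onD(4)] has_derivative_cusp_equation]])
qed

text \<open>The equation vanishes identically on the surface, so its differential kills the tangent
  plane at a regular point and is the inner product with the normal up to a factor. The sign of that
  factor tells whether \<open>\<nu>\<close> is outward for the given normal form.\<close>

lemma conormal:
  assumes x: "x \<in> U" and reg: "singular_factor (\<psi> x) \<noteq> 0"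
    and n': "normalizes A f q cuspidal_edge_form U' \<psi>' V' \<Phi>'" "x \<in> U'"
  defines "\<omega> \<equiv> frechet_derivative (\<lambda>y. cusp_equation (\<Phi>' y)) (at (f x))"
  shows "\<omega> v = \<omega> (\<nu> x) * (v \<bullet> \<nu> x)"
proof -
  note w = \<psi>_in[OF x]
  let ?F = "in_chart U \<psi> f"
  have lc': "local_coordinates A U' \<psi>'" and d': "diffeomorphism_on V' \<Phi>'" and fx: "f x \<in> V'"
    and eq: "\<And>y. y \<in> U' \<Longrightarrow> \<Phi>' (f y) = cuspidal_edge_form (\<psi>' y)"
    using n' by (auto simp: normalizes_def)
  have d\<omega>: "((\<lambda>y. cusp_equation (\<Phi>' y)) has_derivative \<omega>) (at (f x))"
    unfolding \<omega>_def by (rule has_derivative_cusp_equation_normalizes[OF n'])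
  have lin: "linear \<omega>" by (rule has_derivative_linear[OF d\<omega>])
  let ?N = "\<psi> ` (U \<inter> U')"
  have oN: "open ?N" by (rule local_coordinates_open_image[OF os lc local_coordinates_open(1)[OF os lc']])
  have xN: "\<psi> x \<in> ?N" using x n'(2) by blast
  have "(?F has_derivative frechet_derivative ?F (at (\<psi> x))) (at (\<psi> x))"
    by (rule smooth_on_imp_has_derivative[OF smooth_F w])
  then have "((\<lambda>w. cusp_equation (\<Phi>' (?F w))) has_derivative (\<lambda>X. \<omega> (frechet_derivative ?F (at (\<psi> x)) X))) (at (\<psi> x))"
    by (rule has_derivative_compose) (simp add: chart_apply x d\<omega>)
  then have "((\<lambda>w. 0 :: real) has_derivative (\<lambda>X. \<omega> (frechet_derivative ?F (at (\<psi> x)) X))) (at (\<psi> x))"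
    by (rule has_derivative_transform_within_open[OF _ oN xN])
      (auto simp: chart_apply eq cusp_equation_cuspidal_edge_form)
  from has_derivative_unique[OF this has_derivative_const]
  have kill: "\<omega> (frechet_derivative ?F (at (\<psi> x)) X) = 0" for X by (simp add: fun_eq_iff)
  have "\<omega> (singular_factor (\<psi> x) *\<^sub>R e (\<psi> x)) = 0" "\<omega> (f2 (\<psi> x)) = 0"
    using kill[of "axis 1 1"] kill[of "axis 2 1"] by (simp_all add: frechet_derivative_F[OF w])
  then have "\<omega> (e (\<psi> x)) = 0" "\<omega> (f2 (\<psi> x)) = 0" using reg by (simp_all add: linear_cmul[OF lin])
  moreover have "e (\<psi> x) \<bullet> \<nu> x = 0" "f2 (\<psi> x) \<bullet> \<nu> x = 0"
    using e_orthogonal[OF w] f2_orthogonal[OF w] by (simp_all add: chart_apply x)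
  ultimately show "\<omega> v = \<omega> (\<nu> x) * (v \<bullet> \<nu> x)"
    using gram_pos[OF w] norm_\<nu> unfolding gram_def
    by (intro covector_of_tangent_plane[OF lin, of "e (\<psi> x)" "f2 (\<psi> x)"]) auto
qed

text \<open>The derivative of Y^2 - X^3 with respect to Y at (a^2, a^3) is 2 a^3. Transporting the
  Y-direction back to space gives a test vector on which the conormal is known explicitly.\<close>

lemma conormal_cusp_direction:
  assumes n': "normalizes A f q cuspidal_edge_form U' \<psi>' V' \<Phi>'" "x \<in> U'"
  shows "frechet_derivative (\<lambda>y. cusp_equation (\<Phi>' y)) (at (f x))
     (frechet_derivative (inv_into V' \<Phi>') (at (cuspidal_edge_form (\<psi>' x))) (axis 2 1)) = 2 * (\<psi>' x $ 1)^3"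
proof -
  have d': "diffeomorphism_on V' \<Phi>'" and fx: "f x \<in> V'" and eq: "\<Phi>' (f x) = cuspidal_edge_form (\<psi>' x)"
    using n' by (auto simp: normalizes_def)
  note D = diffeomorphism_onD[OF d']
  let ?z = "cuspidal_edge_form (\<psi>' x)" and ?\<omega> = "frechet_derivative (\<lambda>y. cusp_equation (\<Phi>' y)) (at (f x))"
  have zV: "?z \<in> \<Phi>' ` V'" and iz: "inv_into V' \<Phi>' ?z = f x"
    using fx eq[symmetric] inv_into_f_f[OF D(3) fx] by auto
  have "((\<lambda>y. cusp_equation (\<Phi>' y)) has_derivative ?\<omega>) (at (inv_into V' \<Phi>' ?z))"
    unfolding iz by (rule has_derivative_cusp_equation_normalizes[OF n'])
  from has_derivative_compose[OF smooth_on_imp_has_derivative[OF D(5) zV] this]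
  have "(cusp_equation has_derivative (\<lambda>X. ?\<omega> (frechet_derivative (inv_into V' \<Phi>') (at ?z) X))) (at ?z)"
    by (rule has_derivative_transform_within_open[OF _ D(2) zV]) (simp add: f_inv_into_f)
  from has_derivative_unique[OF this has_derivative_cusp_equation]
  have "?\<omega> (frechet_derivative (inv_into V' \<Phi>') (at ?z) X) = 2 * ?z$2 * X$2 - 3 * (?z$1)^2 * X$1" for X
    by (simp add: fun_eq_iff)
  from this[of "axis 2 1"] show ?thesis by (simp add: cuspidal_edge_form_def axis_def)
qed

lemma cuspidal_normalization:
  assumes q: "q \<in> U" "\<psi> q = cusp_source m 0" and m: "m \<noteq> 0"
  obtains X Y where
    "normalizes A f q cuspidal_edge_form {x\<in>U. \<psi> x \<in> cusp_source m ` X} (inv_into X (cusp_source m) \<circ> \<psi>)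
       {y\<in>V. \<Phi> y \<in> cusp_target m ` Y} (inv_into Y (cusp_target m) \<circ> \<Phi>)"
    "diffeomorphism_on X (cusp_source m)" "diffeomorphism_on Y (cusp_target m)" "0 \<in> X"
    "\<And>w. w \<in> X \<Longrightarrow> 0 < m * (4 * (m + w$2) + w$1)" "\<And>w. w \<in> X \<Longrightarrow> cuspidal_edge_form w \<in> Y"
proof -
  obtain X0 where X0: "X0 \<subseteq> UNIV" "0 \<in> X0" "diffeomorphism_on X0 (cusp_source m)"
    by (rule smooth_inverse_function_theorem[OF open_UNIV smooth_on_cusp_source[OF open_UNIV] UNIV_I inj_cusp_source_0[OF m]])
  obtain Y where Y: "Y \<subseteq> UNIV" "0 \<in> Y" "diffeomorphism_on Y (cusp_target m)"
    by (rule smooth_inverse_function_theorem[OF open_UNIV smooth_on_cusp_target[OF open_UNIV] UNIV_I inj_cusp_target_0[OF m]])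
  have c0: "cuspidal_edge_form 0 = 0" by (simp add: cuspidal_edge_form_def vec_eq_iff forall_3)
  \<comment> \<open>Besides mapping the model into \<open>Y\<close>, the shrinking keeps the factor
    4 (m + b) + a at the sign of \<open>m\<close>, so that the sign of \<lambda> on \<open>X\<close>
    is decided by the sign of a m.\<close>
  define X where "X = (X0 \<inter> cuspidal_edge_form -` Y) \<inter> {w. 0 < m * (4 * (m + w$2) + w$1)}"
  have "open (X0 \<inter> cuspidal_edge_form -` Y)"
    by (intro continuous_open_preimage smooth_on_imp_continuous_on smooth_on_cuspidal_edge_form
        diffeomorphism_onD(1)[OF X0(3)] diffeomorphism_onD(1)[OF Y(3)])
  moreover have "open {w :: real^2. 0 < m * (4 * (m + w$2) + w$1)}"
    by (intro open_Collect_less continuous_intros)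
  ultimately have oX: "open X" unfolding X_def by (rule open_Int)
  have dX: "diffeomorphism_on X (cusp_source m)"
    by (rule diffeomorphism_on_subset[OF X0(3) oX]) (auto simp: X_def)
  have "0 < m * m" using m not_real_square_gt_zero by blast
  then have X: "0 \<in> X" using X0 Y c0 by (simp add: X_def)
  have XY: "cuspidal_edge_form w \<in> Y" if "w \<in> X" for w using that by (auto simp: X_def)
  show thesis
  proof (rule that[OF normalizes_compose[OF os nz q(1) dX X q(2)[symmetric] Y(3)] dX Y(3) X _ XY])
    show "cusp_target m 0 = swallowtail_form (\<psi> q)"
      using swallowtail_form_cusp_source[of m 0] by (simp add: q c0)
    show "cuspidal_edge_form w \<in> Y \<and> swallowtail_form (cusp_source m w) = cusp_target m (cuspidal_edge_form w)" if "w \<in> X" for w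
      using XY[OF that] swallowtail_form_cusp_source by blast
    show "0 < m * (4 * (m + w$2) + w$1)" if "w \<in> X" for w using that by (simp add: X_def)
  qed (rule c0)
qed


text \<open>In the new coordinates \<open>(a, b)\<close> the vector \<open>\<partial>\<^sub>Y\<close> equals \<open>6 (m + b) \<partial>\<^sub>x - 2 \<partial>\<^sub>y\<close>, and
  \<open>\<partial>\<^sub>y\<close> is congruent to \<open>- u \<partial>\<^sub>x\<close> modulo the tangent plane.\<close>

lemma conormal_sign:
  assumes x: "x \<in> U" and reg: "singular_factor (\<psi> x) \<noteq> 0"
    and n': "normalizes A f q cuspidal_edge_form {x\<in>U. \<psi> x \<in> cusp_source m ` X} (inv_into X (cusp_source m) \<circ> \<psi>)
       {y\<in>V. \<Phi> y \<in> cusp_target m ` Y} (inv_into Y (cusp_target m) \<circ> \<Phi>)"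
    and dX: "diffeomorphism_on X (cusp_source m)" and dY: "diffeomorphism_on Y (cusp_target m)"
    and w: "w \<in> X" "\<psi> x = cusp_source m w" and wm: "0 < m * (4 * (m + w$2) + w$1)"
  shows "0 < frechet_derivative (\<lambda>y. cusp_equation ((inv_into Y (cusp_target m) \<circ> \<Phi>) y)) (at (f x)) (\<nu> x)
    * (singular_factor (\<psi> x) * (Gd 1 (\<psi> x) \<bullet> \<nu> x))"
proof -
  let ?U = "{x\<in>U. \<psi> x \<in> cusp_source m ` X}" and ?V = "{y\<in>V. \<Phi> y \<in> cusp_target m ` Y}"
    and ?\<psi> = "inv_into X (cusp_source m) \<circ> \<psi>" and ?\<Phi> = "inv_into Y (cusp_target m) \<circ> \<Phi>"
  let ?\<omega> = "frechet_derivative (\<lambda>y. cusp_equation (?\<Phi> y)) (at (f x))"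
  have xU: "x \<in> ?U" using x w by auto
  have pw: "?\<psi> x = w" using w inv_into_f_f[OF diffeomorphism_onD(3)[OF dX]] by simp
  have dV: "diffeomorphism_on ?V ?\<Phi>" and fV: "f x \<in> ?V" and eq: "?\<Phi> (f x) = cuspidal_edge_form w"
    using n' xU pw by (auto simp: normalizes_def)
  note D = diffeomorphism_onD[OF dV]
  let ?z = "cuspidal_edge_form w"
  have zV: "?z \<in> ?\<Phi> ` ?V" using imageI[OF fV, of ?\<Phi>] unfolding eq .
  have sw: "cusp_target m ?z = swallowtail_form (\<psi> x)" by (simp add: w(2) swallowtail_form_cusp_source)
  \<comment> \<open>The inverse of the new target coordinates is \<open>cusp_target m\<close>
    followed by the inverse of \<open>\<Phi>\<close>, so the chain rule gives its
    derivative.\<close>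
  have inv: "inv_into V \<Phi> (cusp_target m y) = inv_into ?V ?\<Phi> y" if y: "y \<in> ?\<Phi> ` ?V" for y
  proof -
    obtain v where v: "v \<in> ?V" "y = ?\<Phi> v" using y by blast
    have "cusp_target m y = \<Phi> v" using v by (simp add: f_inv_into_f)
    then show ?thesis
      using v inv_into_f_f[OF diffeomorphism_onD(3)[OF d\<Phi>], of v] inv_into_f_f[OF D(3) v(1)] by simp
  qed
  have "(inv_into V \<Phi> has_derivative frechet_derivative (inv_into V \<Phi>) (at (swallowtail_form (\<psi> x)))) (at (cusp_target m ?z))"
    unfolding sw by (rule has_derivative_frechet[OF G_diff[OF \<psi>_in[OF x]]])
  from has_derivative_compose[OF has_derivative_cusp_target this]
  have "(inv_into ?V ?\<Phi> has_derivative (\<lambda>X. frechet_derivative (inv_into V \<Phi>) (at (swallowtail_form (\<psi> x))) (vector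
    [9 * (m + ?z$3)^2 * X$1 + 6 * (m + ?z$3) * X$2 + (18 * ?z$1 * (m + ?z$3) + 6 * ?z$2 - 12 * (m + ?z$3)^3) * X$3,
     6 * (m + ?z$3) * X$1 - 2 * X$2 + (6 * ?z$1 - 24 * (m + ?z$3)^2) * X$3,
     - 3 * X$1 - 12 * (m + ?z$3) * X$3]))) (at ?z)"
    by (rule has_derivative_transform_within_open[OF _ D(2) zV]) (rule inv)
  then have "frechet_derivative (inv_into ?V ?\<Phi>) (at ?z) (axis 2 1)
      = frechet_derivative (inv_into V \<Phi>) (at (swallowtail_form (\<psi> x))) (vector [6 * (m + ?z$3), - 2, 0])"
    by (subst frechet_derivative_eqI, assumption) (simp add: axis_def)
  also have "\<dots> = (6 * (m + w$2)) *\<^sub>R Gd 1 (\<psi> x) - 2 *\<^sub>R Gd 2 (\<psi> x)"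
    by (subst frechet_derivative_linear_3[OF G_diff[OF \<psi>_in[OF x]]]) (simp add: Gd_def cuspidal_edge_form_def)
  finally have dir: "frechet_derivative (inv_into ?V ?\<Phi>) (at ?z) (axis 2 1)
      = (6 * (m + w$2)) *\<^sub>R Gd 1 (\<psi> x) - 2 *\<^sub>R Gd 2 (\<psi> x)" .
  have u: "\<psi> x $ 1 = m + w$2 + w$1" unfolding w(2) by (simp add: cusp_source_def)
  have "(m + w$2 + w$1) * (Gd 1 (\<psi> x) \<bullet> \<nu> x) + Gd 2 (\<psi> x) \<bullet> \<nu> x = 0"
    using e_orthogonal[OF \<psi>_in[OF x]] unfolding e_def u by (simp add: chart_apply x inner_add_left)
  then have "Gd 2 (\<psi> x) \<bullet> \<nu> x = - ((m + w$2 + w$1) * (Gd 1 (\<psi> x) \<bullet> \<nu> x))" by linarith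
  then have "((6 * (m + w$2)) *\<^sub>R Gd 1 (\<psi> x) - 2 *\<^sub>R Gd 2 (\<psi> x)) \<bullet> \<nu> x
     = 2 * (4 * (m + w$2) + w$1) * (Gd 1 (\<psi> x) \<bullet> \<nu> x)"
    by (simp add: inner_diff_left algebra_simps)
  then have "2 * (w$1)^3 = ?\<omega> (\<nu> x) * (2 * (4 * (m + w$2) + w$1) * (Gd 1 (\<psi> x) \<bullet> \<nu> x))"
    using conormal_cusp_direction[OF n' xU] conormal[OF x reg n' xU, of "frechet_derivative (inv_into ?V ?\<Phi>) (at ?z) (axis 2 1)"]
    unfolding pw dir by simp
  \<comment> \<open>Multiply the previous equation by 3 a and use \<lambda> = 6 a (4 (m + b) + a);
    the odd powers combine to the positive 6 a^4.\<close>
  then have "?\<omega> (\<nu> x) * (singular_factor (\<psi> x) * (Gd 1 (\<psi> x) \<bullet> \<nu> x)) = 6 * (w$1)^4"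
    unfolding w(2) singular_factor_cusp_source by algebra
  moreover have "w$1 \<noteq> 0" using reg unfolding w(2) singular_factor_cusp_source by auto
  then have "0 < 6 * (w$1)^4" by simp
  ultimately show ?thesis by simp
qed

text \<open>The swallowtail has the double points \<open>(\<plusminus>u, - 2 u\<^sup>2)\<close> arbitrarily close to \<open>p\<close>, but the
  normal form of a cuspidal edge is injective.\<close>

lemma not_cuspidal_edge: "\<not> cuspidal_edge A f p"
proof
  assume "cuspidal_edge A f p"
  then obtain U' \<psi>' V' \<Phi>' where n': "normalizes A f p cuspidal_edge_form U' \<psi>' V' \<Phi>'"
    by (auto simp: cuspidal_edge_def)
  have lc': "local_coordinates A U' \<psi>'" and p': "p \<in> U'" and eq: "\<And>x. x \<in> U' \<Longrightarrow> \<Phi>' (f x) = cuspidal_edge_form (\<psi>' x)"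
    using n' by (auto simp: normalizes_def)
  define y where "y t = (vector [t, - 2 * t^2] :: real^2)" for t
  have "isCont y 0" unfolding y_def vector_2_eq_axis by (intro continuous_intros)
  moreover have "y 0 = 0" by (simp add: y_def vec_eq_iff forall_2)
  moreover have o: "open (\<psi> ` (U \<inter> U'))"
    by (rule local_coordinates_open_image[OF os lc local_coordinates_open(1)[OF os lc']])
  moreover have "0 \<in> \<psi> ` (U \<inter> U')" using imageI[of p "U \<inter> U'" \<psi>] pU p' \<psi>p by simp
  ultimately have "\<forall>\<^sub>F t in at 0. y t \<in> \<psi> ` (U \<inter> U')"
    by (metis isCont_def topological_tendstoD)
  then obtain d where d: "d > 0" "\<And>t. t \<noteq> 0 \<Longrightarrow> \<bar>t\<bar> < d \<Longrightarrow> y t \<in> \<psi> ` (U \<inter> U')"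
    by (auto simp: eventually_at dist_real_def)
  have "y (d/2) \<in> \<psi> ` (U \<inter> U')" "y (- (d/2)) \<in> \<psi> ` (U \<inter> U')"
    using d(1) by (auto intro!: d(2))
  then obtain x1 x2 where x: "x1 \<in> U" "x1 \<in> U'" "\<psi> x1 = y (d/2)" "x2 \<in> U" "x2 \<in> U'" "\<psi> x2 = y (- (d/2))"
    by (metis IntE imageE)
  have "swallowtail_form (y t) = swallowtail_form (y (- t))" for t
    by (simp add: swallowtail_form_def y_def vec_eq_iff forall_3 power2_eq_square power3_eq_cube)
  then have "f x1 = f x2" using f_eq[OF x(1)] f_eq[OF x(4)] by (simp add: x)
  then have "\<psi>' x1 = \<psi>' x2" using eq[OF x(2)] eq[OF x(5)] by (metis cuspidal_edge_form_inj)
  then have "x1 = x2" using local_coordinates_inj[OF os lc'] x by (metis inj_onD)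
  then have "y (d/2) $ 1 = y (- (d/2)) $ 1" using x by simp
  then show False using d(1) by (simp add: y_def)
qed

text \<open>The change \<open>\<kappa>\<close> between the two target coordinates preserves the
  cusp. On the curve (a, 0), pairing either conormal with the Y-direction of the second normal form
  gives a number of the sign of \<open>a\<close>: one by direct computation, the other by
  \<open>cusp_equation_compose_sign\<close>. Both pairings contain the same inner product with
  \<open>\<nu>\<close>, so the remaining factors agree in sign.\<close>

lemma conormal_sign_independent:
  assumes n': "normalizes A f q cuspidal_edge_form U' \<psi>' V' \<Phi>'"
    and n0: "normalizes A f q cuspidal_edge_form U0 \<psi>0 V0 \<Phi>0"
  shows "\<forall>\<^sub>F a in at 0. \<forall>x\<in>U \<inter> U0 \<inter> U'. \<psi>0 x = vector [a, 0] \<longrightarrow> singular_factor (\<psi> x) \<noteq> 0 \<longrightarrow>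
     0 < frechet_derivative (\<lambda>y. cusp_equation (\<Phi>0 y)) (at (f x)) (\<nu> x)
       * frechet_derivative (\<lambda>y. cusp_equation (\<Phi>' y)) (at (f x)) (\<nu> x)"
proof -
  have lc': "local_coordinates A U' \<psi>'" and q': "q \<in> U'" "\<psi>' q = 0" and d': "diffeomorphism_on V' \<Phi>'"
    and fU': "\<And>x. x \<in> U' \<Longrightarrow> f x \<in> V'"
    and eq': "\<And>x. x \<in> U' \<Longrightarrow> \<Phi>' (f x) = cuspidal_edge_form (\<psi>' x)"
    using n' by (auto simp: normalizes_def)
  have lc0: "local_coordinates A U0 \<psi>0" and q0: "q \<in> U0" "\<psi>0 q = 0" and d0: "diffeomorphism_on V0 \<Phi>0"
    and fU0: "\<And>x. x \<in> U0 \<Longrightarrow> f x \<in> V0"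
    and eq0: "\<And>x. x \<in> U0 \<Longrightarrow> \<Phi>0 (f x) = cuspidal_edge_form (\<psi>0 x)"
    using n0 by (auto simp: normalizes_def)
  note D' = diffeomorphism_onD[OF d'] and D0 = diffeomorphism_onD[OF d0]
  let ?G0 = "inv_into V0 \<Phi>0"
  define T where "T = \<Phi>0 ` V0 \<inter> ?G0 -` V'"
  define \<kappa> where "\<kappa> y = \<Phi>' (?G0 y)" for y
  define \<tau> where "\<tau> = in_chart U0 \<psi>0 \<psi>'"
  define N where "N = \<psi>0 ` (U0 \<inter> U')"
  have c0: "cuspidal_edge_form 0 = 0" by (simp add: cuspidal_edge_form_def vec_eq_iff forall_3)
  have G0f: "?G0 (cuspidal_edge_form (\<psi>0 x)) = f x" if "x \<in> U0" for x
    using inv_into_f_f[OF D0(3) fU0[OF that]] eq0[OF that] by simp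
  have inT: "cuspidal_edge_form (\<psi>0 x) \<in> T" if "x \<in> U0" "x \<in> U'" for x
    using G0f[OF that(1)] fU'[OF that(2)] fU0[OF that(1)] eq0[OF that(1), symmetric] by (auto simp: T_def)
  have oT: "open T"
    unfolding T_def by (intro continuous_open_preimage smooth_on_imp_continuous_on D0 D')
  have T0: "0 \<in> T" using inT[OF q0(1) q'(1)] q0(2) c0 by simp
  have G0s: "smooth_on T ?G0" by (rule smooth_on_subset[OF D0(5)]) (simp add: T_def)
  have \<kappa>s: "smooth_on T \<kappa>"
    unfolding \<kappa>_def by (rule smooth_on_compose[OF oT D'(1,4) G0s]) (auto simp: T_def)
  have \<kappa>D: "frechet_derivative \<kappa> (at y) X = frechet_derivative \<Phi>' (at (?G0 y)) (frechet_derivative ?G0 (at y) X)"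
    if "y \<in> T" for y X
  proof -
    have "?G0 y \<in> V'" using that by (simp add: T_def)
    then show ?thesis
      unfolding \<kappa>_def
      by (subst frechet_derivative_eqI[OF has_derivative_compose[OF smooth_on_imp_has_derivative[OF G0s that]
            smooth_on_imp_has_derivative[OF D'(4)]]]) simp_all
  qed
  have \<kappa>inj: "inj (frechet_derivative \<kappa> (at 0))"
  proof -
    have z: "0 \<in> \<Phi>0 ` V0" "?G0 0 \<in> V'" using T0 by (auto simp: T_def)
    have "inj (frechet_derivative \<Phi>' (at (?G0 0)))"
      by (rule inj_frechet_derivative_of_left_inverse(2)[OF D'(1) z(2) smooth_on_imp_differentiable[OF D'(4) z(2)]
            smooth_on_imp_differentiable[OF D'(5) imageI[OF z(2)]]]) (simp add: inv_into_f_f[OF D'(3)])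
    moreover have "inj (frechet_derivative ?G0 (at 0))"
      by (rule diffeomorphism_on_inj_inverse[OF d0 z(1)])
    ultimately show ?thesis
      using \<kappa>D[OF T0] by (intro injI) (metis injD)
  qed
  have oN: "open N"
    unfolding N_def by (rule local_coordinates_open_image[OF os lc0 local_coordinates_open(1)[OF os lc']])
  have N0: "0 \<in> N" using imageI[of q "U0 \<inter> U'" \<psi>0] q0 q' by (simp add: N_def)
  have \<tau>a: "\<tau> (\<psi>0 x) = \<psi>' x" if "x \<in> U0" for x
    unfolding \<tau>_def by (rule in_chart_apply[OF os lc0 that])
  have \<tau>d: "\<tau> differentiable (at 0)"
    using smooth_on_transition[OF os lc0 lc'] N0 unfolding \<tau>_def N_def by (rule smooth_on_imp_differentiable)
  have \<tau>0: "\<tau> 0 = 0" using \<tau>a[OF q0(1)] q0 q' by simp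
  have "cuspidal_edge_form w \<in> T \<and> \<kappa> (cuspidal_edge_form w) = cuspidal_edge_form (\<tau> w)" if "w \<in> N" for w
    using that inT \<tau>a G0f eq' by (auto simp: N_def \<kappa>_def)
  from cusp_equation_compose_sign[OF oT T0 \<kappa>s \<kappa>inj oN N0 \<tau>d \<tau>0 this]
  have "\<forall>\<^sub>F a in at 0. 0 < a * frechet_derivative (\<lambda>y. cusp_equation (\<kappa> y)) (at (cuspidal_edge_form (vector [a, 0]))) (axis 2 1)" .
  then show ?thesis
  proof eventually_elim
    case (elim a)
    show ?case
    proof (intro ballI impI)
      fix x assume x: "x \<in> U \<inter> U0 \<inter> U'" and ax: "\<psi>0 x = vector [a, 0]" and reg: "singular_factor (\<psi> x) \<noteq> 0"
      let ?z = "cuspidal_edge_form (\<psi>0 x)" and ?\<omega>' = "frechet_derivative (\<lambda>y. cusp_equation (\<Phi>' y)) (at (f x))"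
        and ?\<omega>0 = "frechet_derivative (\<lambda>y. cusp_equation (\<Phi>0 y)) (at (f x))"
      let ?v = "frechet_derivative ?G0 (at ?z) (axis 2 1)"
      have xx: "x \<in> U" "x \<in> U0" "x \<in> U'" using x by auto
      have zT: "?z \<in> T" by (rule inT[OF xx(2,3)])
      have "((\<lambda>y. cusp_equation (\<Phi>' y)) has_derivative ?\<omega>') (at (?G0 ?z))"
        unfolding G0f[OF xx(2)] by (rule has_derivative_cusp_equation_normalizes[OF n' xx(3)])
      from has_derivative_compose[OF smooth_on_imp_has_derivative[OF G0s zT] this]
      have "frechet_derivative (\<lambda>y. cusp_equation (\<kappa> y)) (at ?z) (axis 2 1) = ?\<omega>' ?v"
        unfolding \<kappa>_def by (simp add: frechet_derivative_eqI)
      then have 1: "0 < a * (?\<omega>' (\<nu> x) * (?v \<bullet> \<nu> x))"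
        using elim conormal[OF xx(1) reg n' xx(3), of ?v] unfolding ax by simp
      have "2 * a^3 = ?\<omega>0 (\<nu> x) * (?v \<bullet> \<nu> x)"
        using conormal_cusp_direction[OF n0 xx(2)] conormal[OF xx(1) reg n0 xx(2), of ?v] unfolding ax by simp
      then have "a * (?\<omega>0 (\<nu> x) * (?v \<bullet> \<nu> x)) = 2 * a^4" by algebra
      moreover have "a \<noteq> 0" using 1 by auto
      ultimately have 2: "0 < a * (?\<omega>0 (\<nu> x) * (?v \<bullet> \<nu> x))" by simp
      show "0 < ?\<omega>0 (\<nu> x) * ?\<omega>' (\<nu> x)"
        using mult_pos_pos[OF 1 2] by (simp add: zero_less_mult_iff mult_less_0_iff) (smt (verit))
    qed
  qed
qed

end


section \<open>The two sides of the singular curve\<close>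

context generic_front_swallowtail
begin

definition "nbhd d = {x\<in>U. \<psi> x \<in> box_nbhd d}"

text \<open>The parameter \<open>s\<close> is 1 or -1, so that a single argument serves both sides
  of the singular curve.\<close>

definition "half d s = {x\<in>nbhd d. 0 < s * singular_factor (\<psi> x)}"

lemma open_nbhd: "open (nbhd d)"
  unfolding nbhd_def by (rule local_coordinates_open_vimage[OF os lc open_box_nbhd])

lemma half_subset: "half d s \<subseteq> nbhd d - singular_set A f"
  by (auto simp: half_def nbhd_def singular_iff)

lemma open_half: "open (half d s)"
proof -
  have eq: "half d s = {x\<in>U. \<psi> x \<in> box_nbhd d \<inter> {w. 0 < s * singular_factor w}}"
    by (auto simp: half_def nbhd_def)
  have "open (box_nbhd d \<inter> {w. 0 < s * singular_factor w})"
    by (intro open_Int open_box_nbhd open_Collect_less continuous_intros continuous_at_imp_continuous_on)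
      (auto intro: isCont_singular_factor)
  then show ?thesis unfolding eq by (rule local_coordinates_open_vimage[OF os lc])
qed

lemma half_union: "half d 1 \<union> half d (-1) = nbhd d - singular_set A f"
  by (auto simp: half_def nbhd_def singular_iff linorder_neq_iff)

lemma half_disjoint: "half d 1 \<inter> half d (-1) = {}"
  by (auto simp: half_def)

lemma connected_half:
  assumes d: "0 < d" "box_nbhd d \<subseteq> \<psi> ` U" and s: "s = 1 \<or> s = -1"
  shows "connected (half d s)" "half d s \<noteq> {}"
proof -
  let ?R = "box_nbhd d \<inter> {w. 0 < s * singular_factor w}"
  have eq: "half d s = inv_into U \<psi> ` ?R"
  proof (intro equalityI subsetI)
    fix x assume "x \<in> half d s"
    then have "x \<in> U" "\<psi> x \<in> ?R" by (auto simp: half_def nbhd_def)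
    then show "x \<in> inv_into U \<psi> ` ?R"
      using local_coordinates_left_inverse[OF os lc] by (metis imageI)
  next
    fix x assume "x \<in> inv_into U \<psi> ` ?R"
    then obtain w where w: "w \<in> ?R" "x = inv_into U \<psi> w" by blast
    then have "w \<in> \<psi> ` U" using d by blast
    then show "x \<in> half d s" using w inv_\<psi>[of w] by (simp add: half_def nbhd_def)
  qed
  have "continuous_on ?R (inv_into U \<psi>)"
    by (rule continuous_on_subset[OF local_coordinates_cont(2)[OF os lc]]) (use d in blast)
  then show "connected (half d s)"
    unfolding eq by (rule connected_continuous_image) (rule connected_box_nbhd_side[OF d(1) s])
  show "half d s \<noteq> {}" unfolding eq using connected_box_nbhd_side(2)[OF d(1) s] by blast
qed

lemma connected_subset_half:
  assumes "connected C" "C \<subseteq> nbhd d - singular_set A f"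
  shows "C \<subseteq> half d 1 \<or> C \<subseteq> half d (-1)"
proof -
  have "half d 1 \<inter> C = {} \<or> half d (-1) \<inter> C = {}"
    using assms half_disjoint[of d] half_union[of d]
    by (intro connectedD[OF assms(1) open_half open_half]) auto
  then show ?thesis using assms(2) half_union[of d] by blast
qed

lemma component_half:
  assumes d: "0 < d" "box_nbhd d \<subseteq> \<psi> ` U" and s: "s = 1 \<or> s = -1" and x: "x \<in> half d s"
  shows "connected_component_set (nbhd d - singular_set A f) x = half d s"
proof
  let ?C = "connected_component_set (nbhd d - singular_set A f) x"
  have xC: "x \<in> ?C" using x half_subset[of d s] by auto
  have "?C \<subseteq> half d 1 \<or> ?C \<subseteq> half d (-1)"
    by (rule connected_subset_half) (auto simp: connected_component_subset)
  then show "?C \<subseteq> half d s"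
    using s by (elim disjE) (use xC x half_disjoint[of d] in blast)+
  show "half d s \<subseteq> ?C"
    by (rule connected_component_maximal[OF x connected_half(1)[OF d s] half_subset])
qed

lemma components_nbhd:
  assumes d: "0 < d" "box_nbhd d \<subseteq> \<psi> ` U" and s: "s = 1 \<or> s = -1"
  shows "components (nbhd d - singular_set A f) = {half d s, half d (- s)}" "half d s \<noteq> half d (- s)"
proof -
  have s': "- s = 1 \<or> - s = -1" using s by auto
  obtain x where x: "x \<in> half d s" using connected_half(2)[OF d s] by (meson ex_in_conv)
  obtain y where y: "y \<in> half d (- s)" using connected_half(2)[OF d s'] by (meson ex_in_conv)
  note xy = x y
  have un: "nbhd d - singular_set A f = half d s \<union> half d (- s)"
    using half_union[of d] s by (elim disjE) (simp_all add: Un_commute)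
  note cc = component_half[OF d s] component_half[OF d s']
  show "components (nbhd d - singular_set A f) = {half d s, half d (- s)}"
  proof (intro equalityI subsetI)
    fix C assume "C \<in> components (nbhd d - singular_set A f)"
    then obtain z where "z \<in> nbhd d - singular_set A f" "C = connected_component_set (nbhd d - singular_set A f) z"
      by (auto simp: components_def)
    then show "C \<in> {half d s, half d (- s)}" using cc[of z] un by blast
  next
    fix C assume "C \<in> {half d s, half d (- s)}"
    then show "C \<in> components (nbhd d - singular_set A f)"
      using cc(1)[OF xy(1)] cc(2)[OF xy(2)] xy un by (auto simp: components_def)
  qed
  show "half d s \<noteq> half d (- s)" using xy half_disjoint[of d] s by auto
qed

lemma side_half:
  assumes d: "0 < d" "box_nbhd d \<subseteq> \<psi> ` U" and s: "s = 1 \<or> s = -1"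
    and D: "\<Delta> \<noteq> {}" "\<Delta> \<subseteq> half d s"
  shows "side A f (nbhd d) \<Delta> = half d s"
proof -
  have "connected_component_set (nbhd d - singular_set A f) x = half d s" if "x \<in> \<Delta>" for x
    using component_half[OF d s] D that by blast
  then show ?thesis using D(1) unfolding side_def by auto
qed

section \<open>Curvature on the two sides\<close>

lemma curvature_unbounded:
  assumes d: "0 < d" "box_nbhd d \<subseteq> \<psi> ` U" "\<And>w. w \<in> box_nbhd d \<Longrightarrow> 0 < B w * (\<alpha> * \<beta>)"
    and s: "s = 1 \<or> s = -1" and q: "q \<in> nbhd d" "q \<in> singular_set A f" and O: "open N" "q \<in> N"
  shows "\<not> bounded (gauss_curvature A f ` (N \<inter> half d s))"
proof -
  have qU: "q \<in> U" and qb: "\<psi> q \<in> box_nbhd d" using q by (auto simp: nbhd_def)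
  let ?O = "\<psi> ` (U \<inter> (N \<inter> nbhd d))"
  have "open ?O" by (intro local_coordinates_open_image[OF os lc] open_Int O open_nbhd)
  moreover have "\<psi> q \<in> ?O" using qU q O by blast
  moreover have "?O \<subseteq> \<psi> ` U" by blast
  moreover have "singular_factor (\<psi> q) = 0" using singular_iff[OF qU] q by simp
  moreover have "B (\<psi> q) \<noteq> 0" using d(3)[OF qb] by auto
  ultimately have "\<not> bounded ((\<lambda>w. B w / (singular_factor w * gram w)) ` (?O \<inter> {w. 0 < s * singular_factor w}))"
    using s by (rule curvature_unbounded_at_singular)
  moreover have "(\<lambda>w. B w / (singular_factor w * gram w)) ` (?O \<inter> {w. 0 < s * singular_factor w})
      \<subseteq> gauss_curvature A f ` (N \<inter> half d s)"
  proof
    fix k assume "k \<in> (\<lambda>w. B w / (singular_factor w * gram w)) ` (?O \<inter> {w. 0 < s * singular_factor w})"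
    then obtain x where x: "x \<in> U" "x \<in> N" "x \<in> nbhd d" "0 < s * singular_factor (\<psi> x)"
      "k = B (\<psi> x) / (singular_factor (\<psi> x) * gram (\<psi> x))" by auto
    then have "k = gauss_curvature A f x" by (subst curvature_eq) auto
    then show "k \<in> gauss_curvature A f ` (N \<inter> half d s)" using x by (auto simp: half_def)
  qed
  ultimately show ?thesis using bounded_subset by blast
qed

text \<open>The empty set has bounded image, so unboundedness of the curvature in every neighborhood
  of \<open>q\<close> already shows that the half reaches \<open>q\<close>.\<close>

lemma singular_in_closure:
  assumes "0 < d" "box_nbhd d \<subseteq> \<psi> ` U" "\<And>w. w \<in> box_nbhd d \<Longrightarrow> 0 < B w * (\<alpha> * \<beta>)"
    and "s = 1 \<or> s = -1" and "q \<in> nbhd d" "q \<in> singular_set A f"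
  shows "q \<in> closure (half d s)"
  unfolding closure_iff_nhds_not_empty
proof (intro allI impI)
  fix N S assume "S \<subseteq> N" "open S" "q \<in> S"
  from curvature_unbounded[OF assms this(2,3)] have "\<not> bounded (gauss_curvature A f ` (S \<inter> half d s))" .
  then have "S \<inter> half d s \<noteq> {}" by auto
  then show "half d s \<inter> N \<noteq> {}" using \<open>S \<subseteq> N\<close> by blast
qed

lemma curvature_sign:
  assumes "\<And>w. w \<in> box_nbhd d \<Longrightarrow> 0 < B w * (\<alpha> * \<beta>)" and "s = 1 \<or> s = -1" and "x \<in> half d s"
  shows "sgn (gauss_curvature A f x) = s * sgn (\<alpha> * \<beta>)"
proof -
  have x: "x \<in> U" "\<psi> x \<in> box_nbhd d" "0 < s * singular_factor (\<psi> x)" using assms(3) by (auto simp: half_def nbhd_def)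
  have "sgn b = sgn c" if "0 < b * c" for b c :: real
    using that by (auto simp: sgn_if zero_less_mult_iff)
  then have "sgn (B (\<psi> x)) = sgn (\<alpha> * \<beta>)" using assms(1)[OF x(2)] .
  moreover have "sgn (singular_factor (\<psi> x)) = s" using x(3) assms(2) by auto
  moreover have "sgn (gram (\<psi> x)) = 1" using gram_pos[OF \<psi>_in[OF x(1)]] by simp
  moreover have "singular_factor (\<psi> x) \<noteq> 0" using x(3) by auto
  ultimately show ?thesis using assms(2) by (auto simp: curvature_eq[OF x(1)] sgn_divide sgn_mult)
qed

section \<open>Outward normals along the singular curve\<close>

text \<open>The parameter is the first coordinate of the point, the triple root of its quartic; it
  is 0 only at the swallowtail.\<close>

lemma singular_parameter:
  assumes q: "q \<in> U" "q \<in> singular_set A f" "q \<noteq> p"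
  obtains m where "m \<noteq> 0" "\<psi> q = cusp_source m 0"
proof -
  have z: "singular_factor (\<psi> q) = 0" using singular_iff[OF q(1)] q(2) by simp
  then have eq: "\<psi> q = cusp_source (\<psi> q $ 1) 0"
    by (simp add: vec_eq_iff forall_2 cusp_source_def singular_factor_def)
  moreover have "\<psi> q $ 1 \<noteq> 0"
  proof
    assume "\<psi> q $ 1 = 0"
    then have "\<psi> q = \<psi> p" using eq by (simp add: \<psi>p vec_eq_iff forall_2 cusp_source_def)
    then show False using local_coordinates_inj[OF os lc] q pU by (metis inj_onD)
  qed
  ultimately show thesis by (rule that[rotated])
qed

lemma singular_is_cuspidal_edge:
  assumes q: "q \<in> U" "q \<in> singular_set A f" "q \<noteq> p"
  shows "cuspidal_edge A f q"
proof -
  obtain m where m: "m \<noteq> 0" "\<psi> q = cusp_source m 0" using singular_parameter[OF q] .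
  show ?thesis
    by (rule cuspidal_normalization[OF q(1) m(2,1)]) (use q(2) in \<open>unfold cuspidal_edge_def, blast\<close>)
qed

text \<open>If s \<alpha> is positive, the explicit normal form from the quartics is a witness,
  since its conormal is positive on \<open>\<nu>\<close> throughout the half. For the converse the
  given normal form is arbitrary. Near \<open>q\<close> there are points of the half on the curve
  (a, 0) of the explicit form where both conormals have the same sign; if s \<alpha> were negative,
  \<open>\<nu>\<close> would point into the thin component there.\<close>

lemma outward_near_iff:
  assumes d: "0 < d" "box_nbhd d \<subseteq> \<psi> ` U" "\<And>w. w \<in> box_nbhd d \<Longrightarrow> 0 < (Gd 1 w \<bullet> in_chart U \<psi> \<nu> w) * \<alpha>"
    and s: "s = 1 \<or> s = -1" and q: "q \<in> nbhd d" "q \<in> singular_set A f" "q \<noteq> p"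
  shows "outward_near A f \<nu> q (half d s) \<longleftrightarrow> 0 < s * \<alpha>"
proof -
  have qU: "q \<in> U" using q by (simp add: nbhd_def)
  obtain m where m: "m \<noteq> 0" "\<psi> q = cusp_source m 0" using singular_parameter[OF qU q(2,3)] .
  obtain X Y where n0: "normalizes A f q cuspidal_edge_form {x\<in>U. \<psi> x \<in> cusp_source m ` X} (inv_into X (cusp_source m) \<circ> \<psi>)
       {y\<in>V. \<Phi> y \<in> cusp_target m ` Y} (inv_into Y (cusp_target m) \<circ> \<Phi>)"
    and dX: "diffeomorphism_on X (cusp_source m)" and dY: "diffeomorphism_on Y (cusp_target m)" and X0: "0 \<in> X"
    and Xm: "\<And>w. w \<in> X \<Longrightarrow> 0 < m * (4 * (m + w$2) + w$1)"
    and "\<And>w. w \<in> X \<Longrightarrow> cuspidal_edge_form w \<in> Y"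
    by (rule cuspidal_normalization[OF qU m(2,1)]) (rule that)
  let ?U = "{x\<in>U. \<psi> x \<in> cusp_source m ` X}" and ?V = "{y\<in>V. \<Phi> y \<in> cusp_target m ` Y}"
    and ?\<psi> = "inv_into X (cusp_source m) \<circ> \<psi>" and ?\<Phi> = "inv_into Y (cusp_target m) \<circ> \<Phi>"
  let ?\<omega> = "\<lambda>x. frechet_derivative (\<lambda>y. cusp_equation (?\<Phi> y)) (at (f x)) (\<nu> x)"
  have d0: "diffeomorphism_on ?V ?\<Phi>" and f0: "\<And>x. x \<in> ?U \<Longrightarrow> f x \<in> ?V"
    and eq0: "\<And>x. x \<in> ?U \<Longrightarrow> ?\<Phi> (f x) = cuspidal_edge_form (?\<psi> x)"
    using n0 unfolding normalizes_def by blast+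
  have sign: "0 < ?\<omega> x * (s * \<alpha>)" if x: "x \<in> ?U" "x \<in> half d s" for x
  proof -
    obtain w where w: "w \<in> X" "\<psi> x = cusp_source m w" using x by blast
    have xx: "x \<in> U" "\<psi> x \<in> box_nbhd d" "0 < s * singular_factor (\<psi> x)" using x by (auto simp: half_def nbhd_def)
    then have "singular_factor (\<psi> x) \<noteq> 0" by auto
    from conormal_sign[OF xx(1) this n0 dX dY w Xm[OF w(1)]]
    have 1: "0 < ?\<omega> x * (singular_factor (\<psi> x) * (Gd 1 (\<psi> x) \<bullet> \<nu> x))" .
    have 2: "0 < (Gd 1 (\<psi> x) \<bullet> \<nu> x) * \<alpha>" using d(3)[OF xx(2)] by (simp add: chart_apply xx(1))
    \<comment> \<open>The three positive factors multiply to the claimed product times a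
      square.\<close>
    have "0 < (?\<omega> x * (singular_factor (\<psi> x) * (Gd 1 (\<psi> x) \<bullet> \<nu> x))) * (((Gd 1 (\<psi> x) \<bullet> \<nu> x) * \<alpha>) * (s * singular_factor (\<psi> x)))"
      by (intro mult_pos_pos 1 2 xx)
    also have "\<dots> = (?\<omega> x * (s * \<alpha>)) * (singular_factor (\<psi> x) * (Gd 1 (\<psi> x) \<bullet> \<nu> x))^2"
      by (simp only: power2_eq_square mult_ac)
    finally show ?thesis by (simp add: zero_less_mult_iff)
  qed
  show ?thesis
  proof
    assume sa: "0 < s * \<alpha>"
    have "\<forall>\<^sub>F t in at_right 0. f x + t *\<^sub>R \<nu> x \<notin> thin_component ?V ?\<Phi>" if "x \<in> ?U \<inter> half d s" for x
    proof (rule thin_component_test(1)[OF d0])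
      show "f x \<in> ?V" using that f0 by blast
      show "cusp_equation (?\<Phi> (f x)) = 0" using that eq0[of x] by (simp only: IntD1 cusp_equation_cuspidal_edge_form)
      show "0 < frechet_derivative (\<lambda>z. cusp_equation (?\<Phi> z)) (at (f x)) (\<nu> x)"
        using sign[of x] that sa zero_less_mult_pos2 by blast
    qed
    then show "outward_near A f \<nu> q (half d s)" unfolding outward_near_def using n0 by blast
  next
    assume "outward_near A f \<nu> q (half d s)"
    then obtain U' \<psi>' V' \<Phi>' where n': "normalizes A f q cuspidal_edge_form U' \<psi>' V' \<Phi>'"
      and out: "\<And>x. x \<in> U' \<inter> half d s \<Longrightarrow> \<forall>\<^sub>F t in at_right 0. f x + t *\<^sub>R \<nu> x \<notin> thin_component V' \<Phi>'"
      unfolding outward_near_def by blast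
    have d': "diffeomorphism_on V' \<Phi>'" and f': "\<And>x. x \<in> U' \<Longrightarrow> f x \<in> V'"
      and eq': "\<And>x. x \<in> U' \<Longrightarrow> \<Phi>' (f x) = cuspidal_edge_form (\<psi>' x)"
      and lc': "local_coordinates A U' \<psi>'" and q': "q \<in> U'"
      using n' unfolding normalizes_def by blast+
    let ?\<omega>' = "\<lambda>x. frechet_derivative (\<lambda>y. cusp_equation (\<Phi>' y)) (at (f x)) (\<nu> x)"
    show "0 < s * \<alpha>"
    proof (rule ccontr)
      assume "\<not> 0 < s * \<alpha>"
      then have sa: "s * \<alpha> < 0" using \<alpha>_nonzero s by auto
      \<comment> \<open>This choice puts the points (a t, 0) on the side \<open>s\<close>: s
        \<lambda> equals 6 s^2 t m (4 m + a t), and the factor m (4 m + a t) is positive on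
        \<open>X\<close>.\<close>
      define a where "a t = (s * m * t)" for t
      define z where "z t = cusp_source m (vector [a t, 0])" for t
      have am: "s * m \<noteq> 0" using s m by auto
      have "((\<lambda>t. s * m * t) \<longlongrightarrow> s * m * 0) (at_right (0::real))" by (intro tendsto_intros)
      then have fa: "filterlim a (at 0) (at_right 0)"
        unfolding filterlim_at a_def using am eventually_at_right_less[of "0::real"]
        by (auto elim!: eventually_mono)
      have evc: "\<forall>\<^sub>F t in at_right 0. \<forall>x\<in>U \<inter> ?U \<inter> U'. ?\<psi> x = vector [a t, 0] \<longrightarrow> singular_factor (\<psi> x) \<noteq> 0 \<longrightarrow> 0 < ?\<omega> x * ?\<omega>' x"
        using eventually_compose_filterlim[OF conormal_sign_independent[OF n' n0] fa] .
      have "continuous_on UNIV (\<lambda>a. vector [a, 0] :: real^2)"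
        unfolding vector_2_eq_axis by (intro continuous_intros)
      then have ca: "isCont (\<lambda>a. vector [a, 0] :: real^2) 0" by (simp add: continuous_on_eq_continuous_at)
      have v0: "(vector [0, 0] :: real^2) = 0" by (simp add: vec_eq_iff forall_2)
      have fa0: "filterlim a (nhds 0) (at_right 0)" using fa by (simp add: filterlim_at)
      have lv: "((\<lambda>t. vector [a t, 0] :: real^2) \<longlongrightarrow> 0) (at_right 0)"
        using isCont_tendsto_compose[OF ca fa0] v0 by simp
      have evX: "\<forall>\<^sub>F t in at_right 0. vector [a t, 0] \<in> X"
        using topological_tendstoD[OF lv diffeomorphism_onD(1)[OF dX] X0] .
      have "isCont (cusp_source m) 0"
        using smooth_on_imp_isCont[OF smooth_on_cusp_source[OF open_UNIV] UNIV_I] .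
      then have lz: "(z \<longlongrightarrow> \<psi> q) (at_right 0)"
        unfolding m(2) z_def using lv by (rule isCont_tendsto_compose)
      have oZ: "open (\<psi> ` (U \<inter> (U' \<inter> nbhd d)))"
        by (intro local_coordinates_open_image[OF os lc] open_Int open_nbhd local_coordinates_open(1)[OF os lc'])
      have "\<psi> q \<in> \<psi> ` (U \<inter> (U' \<inter> nbhd d))" using qU q' q(1) by blast
      then have evZ: "\<forall>\<^sub>F t in at_right 0. z t \<in> \<psi> ` (U \<inter> (U' \<inter> nbhd d))"
        using topological_tendstoD[OF lz oZ] by blast
      have "\<forall>\<^sub>F t in at_right (0::real). False"
        using evc evX evZ eventually_at_right_less[of 0]
      proof eventually_elim
        case (elim t)
        obtain x where x: "x \<in> U" "x \<in> U'" "x \<in> nbhd d" "\<psi> x = z t" using elim(3) by auto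
        have xU: "x \<in> ?U" using x elim(2) by (auto simp: z_def)
        have px: "?\<psi> x = vector [a t, 0]"
          using inv_into_f_f[OF diffeomorphism_onD(3)[OF dX] elim(2)] by (simp add: x(4) z_def)
        have "s * singular_factor (\<psi> x) = 6 * (s * s) * (t * (m * (4 * (m + 0) + a t)))"
          unfolding x(4) z_def singular_factor_cusp_source by (simp add: a_def)
        moreover have "0 < m * (4 * (m + 0) + a t)" using Xm[OF elim(2)] by simp
        moreover have "s * s = 1" using s by auto
        ultimately have sp: "0 < s * singular_factor (\<psi> x)" using elim(4) by simp
        then have xh: "x \<in> half d s" using x by (simp add: half_def)
        have neg: "b < 0" if "0 < b * c" "c < 0" for b c :: real
          using that by (auto simp: zero_less_mult_iff)
        have "?\<omega> x < 0" by (rule neg[OF sign[OF xU xh] sa])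
        moreover have "0 < ?\<omega> x * ?\<omega>' x"
        proof -
          have "x \<in> U \<inter> ?U \<inter> U'" using x(1,2) xU by blast
          moreover have "singular_factor (\<psi> x) \<noteq> 0" using sp by auto
          ultimately show ?thesis using elim(1) px by blast
        qed
        ultimately have "?\<omega>' x < 0" by (metis neg mult.commute)
        from thin_component_test(2)[OF d' f'[OF x(2)] _ this]
        have "\<forall>\<^sub>F t in at_right 0. f x + t *\<^sub>R \<nu> x \<in> thin_component V' \<Phi>'"
          by (simp add: eq'[OF x(2)] cusp_equation_cuspidal_edge_form)
        moreover have "\<forall>\<^sub>F t in at_right 0. f x + t *\<^sub>R \<nu> x \<notin> thin_component V' \<Phi>'" using out x(2) xh by blast
        ultimately have "\<forall>\<^sub>F t in at_right (0::real). False" by eventually_elim blast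
        then show False by simp
      qed
      then show False by simp
    qed
  qed
qed

text \<open>All adjacent cuspidal edges give the same answer by \<open>outward_near_iff\<close>; the
  swallowtail itself does not enter the quantifier because it is not a cuspidal edge.\<close>

lemma sgn_domain_eq:
  assumes d: "0 < d" "box_nbhd d \<subseteq> \<psi> ` U" "\<And>w. w \<in> box_nbhd d \<Longrightarrow> 0 < B w * (\<alpha> * \<beta>)"
      "\<And>w. w \<in> box_nbhd d \<Longrightarrow> 0 < (Gd 1 w \<bullet> in_chart U \<psi> \<nu> w) * \<alpha>"
    and s: "s = 1 \<or> s = -1" and D: "\<Delta> \<noteq> {}" "\<Delta> \<subseteq> half d s"
  shows "sgn_domain A f \<nu> (nbhd d) \<Delta> = sgn (s * \<alpha>)"
proof (cases "0 < s * \<alpha>")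
  case True
  have "outward_near A f \<nu> q (half d s)" if "q \<in> nbhd d" "cuspidal_edge A f q" for q
  proof -
    have "q \<in> singular_set A f" "q \<noteq> p" using that(2) not_cuspidal_edge by (auto simp: cuspidal_edge_def)
    then show ?thesis using outward_near_iff[OF d(1,2,4) s that(1)] True by blast
  qed
  then show ?thesis unfolding sgn_domain_def side_half[OF d(1,2) s D] using True by auto
next
  case False
  then have neg: "s * \<alpha> < 0" using \<alpha>_nonzero s by auto
  \<comment> \<open>For the value -1 some adjacent cuspidal edge must fail, so one is exhibited: the
    point of the singular curve v = -6 u^2 with u = d/2.\<close>
  let ?w = "vector [d/2, - 6 * (d/2)^2] :: real^2"
  have sw: "singular_factor ?w = 0" by (simp add: singular_factor_def power2_eq_square)
  then have wb: "?w \<in> box_nbhd d" using d(1) by (simp add: box_nbhd_def)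
  then obtain q where q: "q \<in> U" "\<psi> q = ?w" using d(2) by (metis imageE subsetD)
  have qn: "q \<in> nbhd d" using q wb by (simp add: nbhd_def)
  have qs: "q \<in> singular_set A f" using singular_iff[OF q(1)] q sw by simp
  have qp: "q \<noteq> p"
  proof
    assume "q = p"
    then have "?w $ 1 = 0" using q \<psi>p by simp
    then show False using d(1) by simp
  qed
  have "\<not> outward_near A f \<nu> q (half d s)" using outward_near_iff[OF d(1,2,4) s qn qs qp] False by blast
  moreover have "cuspidal_edge A f q" by (rule singular_is_cuspidal_edge[OF q(1) qs qp])
  moreover have "q \<in> closure (half d s)" by (rule singular_in_closure[OF d(1,2,3) s qn qs])
  ultimately show ?thesis unfolding sgn_domain_def side_half[OF d(1,2) s D] using qn neg by auto
qed

section \<open>Null curves and the half-space\<close>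

text \<open>The singular curve is the parabola v = -6 u^2. For any other \<open>c\<close> the curve
  meets it only at the swallowtail, where its tangent is the u-direction, which is null.\<close>

lemma parabola_null_curve:
  assumes c: "c \<noteq> -6"
  obtains r where "0 < r" "null_curve A f {-r<..<r} (\<lambda>t. inv_into U \<psi> (vector [t, c * t^2]))"
    "inv_into U \<psi> (vector [0, c * 0^2]) = p"
    "\<And>t. \<bar>t\<bar> < r \<Longrightarrow> vector [t, c * t^2] \<in> \<psi> ` U"
proof -
  define P where "P t = (vector [t, c * t^2] :: real^2)" for t
  define \<sigma> where "\<sigma> t = inv_into U \<psi> (P t)" for t
  have smP: "smooth_on S P" if "open S" for S
    unfolding P_def[abs_def] using that by (intro smooth_on_intros)
  have dP: "(P has_derivative (\<lambda>k. k *\<^sub>R vector [1, 2 * c * t])) (at t)" for t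
  proof (rule has_derivative_eq_rhs)
    show "(P has_derivative (\<lambda>k. vector [k, c * (2 * t * k)])) (at t)"
      unfolding P_def by (rule has_derivative_vector_2) (auto intro!: derivative_eq_intros)
  qed (auto simp: vec_eq_iff forall_2)
  have cP: "isCont P t" for t using dP has_derivative_continuous by blast
  have P0: "P 0 = 0" by (simp add: P_def vec_eq_iff forall_2)
  have "open (P -` (\<psi> ` U))"
    using continuous_on_open_vimage[of UNIV P] cP local_coordinates_open(2)[OF os lc]
    by (simp add: continuous_at_imp_continuous_on)
  then obtain r where r: "0 < r" "ball 0 r \<subseteq> P -` (\<psi> ` U)"
    using zero_\<Omega> P0 by (metis openE vimageI)
  have PU: "P t \<in> \<psi> ` U" if "\<bar>t\<bar> < r" for t using r(2) that by (auto simp: subset_iff)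
  have \<sigma>U: "\<sigma> t \<in> U" and \<psi>\<sigma>: "\<psi> (\<sigma> t) = P t" if "\<bar>t\<bar> < r" for t
    using inv_\<psi>[OF PU[OF that]] by (simp_all add: \<sigma>_def)
  have \<sigma>0: "\<sigma> 0 = p" using local_coordinates_left_inverse[OF os lc pU] by (simp add: \<sigma>_def P0 \<psi>p)
  let ?I = "{-r<..<r}"
  have cont: "continuous_on ?I \<sigma>"
    unfolding \<sigma>_def
    by (rule continuous_on_compose2[OF local_coordinates_cont(2)[OF os lc]])
      (use PU cP in \<open>auto intro!: continuous_at_imp_continuous_on\<close>)
  have chart: "smooth_on {t\<in>?I. \<sigma> t \<in> Q} (\<phi> \<circ> \<sigma>) \<and> (\<forall>t\<in>?I. \<sigma> t \<in> Q \<longrightarrow>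
      vector_derivative (\<phi> \<circ> \<sigma>) (at t) = frechet_derivative (in_chart U \<psi> \<phi>) (at (\<psi> (\<sigma> t))) (vector [1, 2 * c * t]))"
    if Q: "(Q, \<phi>) \<in> A" for Q \<phi>
  proof -
    note lcQ = chart_local_coordinates[OF os Q]
    let ?J = "{t\<in>?I. \<sigma> t \<in> Q}" and ?t = "in_chart U \<psi> \<phi>"
    have oQ: "open (\<psi> ` (U \<inter> Q))"
      by (rule local_coordinates_open_image[OF os lc local_coordinates_open(1)[OF os lcQ]])
    have "?J = ?I \<inter> \<sigma> -` Q" by auto
    then have oJ: "open ?J"
      using continuous_open_preimage[OF cont _ local_coordinates_open(1)[OF os lcQ]] by simp
    have tr: "smooth_on (\<psi> ` (U \<inter> Q)) ?t" by (rule local_coordinates_transition(2)[OF os lc Q])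
    have im: "P t \<in> \<psi> ` (U \<inter> Q)" if "t \<in> ?J" for t
      using that \<sigma>U[of t] \<psi>\<sigma>[of t] by (auto simp: image_iff intro!: bexI[of _ "\<sigma> t"])
    have eq: "?t (P t) = (\<phi> \<circ> \<sigma>) t" for t by (simp add: in_chart_def \<sigma>_def)
    have "smooth_on ?J (\<lambda>t. ?t (P t))"
      by (rule smooth_on_compose[OF oJ oQ tr smP[OF oJ]]) (use im in blast)
    then have 1: "smooth_on ?J (\<phi> \<circ> \<sigma>)" by (simp add: eq o_def)
    have "vector_derivative (\<phi> \<circ> \<sigma>) (at t) = frechet_derivative ?t (at (\<psi> (\<sigma> t))) (vector [1, 2 * c * t])"
      if t: "t \<in> ?I" "\<sigma> t \<in> Q" for t
    proof -
      have tJ: "t \<in> ?J" using t by simp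
      note D = smooth_on_imp_differentiable[OF tr im[OF tJ]]
      from has_derivative_compose[OF dP has_derivative_frechet[OF D]]
      have "((\<phi> \<circ> \<sigma>) has_derivative (\<lambda>k. frechet_derivative ?t (at (P t)) (k *\<^sub>R vector [1, 2 * c * t]))) (at t)"
        unfolding eq by (simp add: o_def)
      then have "((\<phi> \<circ> \<sigma>) has_vector_derivative frechet_derivative ?t (at (P t)) (vector [1, 2 * c * t])) (at t)"
        by (simp add: has_vector_derivative_def linear_cmul[OF linear_frechet_derivative[OF D]])
      moreover have "\<psi> (\<sigma> t) = P t" using t by (intro \<psi>\<sigma>) auto
      ultimately show ?thesis by (simp add: vector_derivative_at)
    qed
    then show ?thesis using 1 by blast
  qed
  have one: "(vector [1, x] :: real^2) \<noteq> 0" for x by (simp add: vec_eq_iff forall_2)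
  have nonzero: "vector_derivative (\<phi> \<circ> \<sigma>) (at t) \<noteq> 0" if Q: "(Q, \<phi>) \<in> A" and t: "t \<in> ?I" "\<sigma> t \<in> Q" for Q \<phi> t
  proof -
    have tU: "\<sigma> t \<in> U" using \<sigma>U t by auto
    note T = transition_derivative[OF os chart_local_coordinates[OF os Q] lc t(2) tU]
    have "frechet_derivative (in_chart U \<psi> \<phi>) (at (\<psi> (\<sigma> t))) (vector [1, 2 * c * t]) \<noteq> 0"
    proof
      assume "frechet_derivative (in_chart U \<psi> \<phi>) (at (\<psi> (\<sigma> t))) (vector [1, 2 * c * t]) = 0"
      then show False using one T(1,2) linear_injective_0 by blast
    qed
    then show ?thesis using chart[OF Q] t by simp
  qed
  have null: "null_vector Q \<phi> f (\<sigma> t) (vector_derivative (\<phi> \<circ> \<sigma>) (at t))"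
    if Q: "(Q, \<phi>) \<in> A" and t: "t \<in> ?I" "\<sigma> t \<in> Q" "\<sigma> t \<in> singular_set A f" for Q \<phi> t
  proof -
    have tU: "\<sigma> t \<in> U" and pt: "\<psi> (\<sigma> t) = P t" using \<sigma>U \<psi>\<sigma> t by auto
    have "singular_factor (P t) = 0" using singular_iff[OF tU] t(3) pt by simp
    then have "(12 + 2 * c) * t^2 = 0" by (simp add: singular_factor_def P_def algebra_simps)
    then have t0: "t = 0" using c by auto
    note T = transition_derivative(3)[OF os chart_local_coordinates[OF os Q] lc t(2) tU sf]
    have "differential U \<psi> f (\<sigma> t) (vector [1, 2 * c * t]) = 0"
    proof -
      have "\<psi> (\<sigma> t) = 0" using pt t0 P0 by simp
      then show ?thesis
        by (simp add: differential_def frechet_derivative_F[OF zero_\<Omega>] singular_factor_def t0)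
    qed
    then have "differential Q \<phi> f (\<sigma> t) (vector_derivative (\<phi> \<circ> \<sigma>) (at t)) = 0"
      using chart[OF Q] t T[of "vector [1, 2 * c * t]"] by simp
    then show ?thesis using nonzero[OF Q t(1,2)] by (simp add: null_vector_def)
  qed
  have "null_curve A f ?I \<sigma>"
    unfolding null_curve_def regular_curve_def using cont chart nonzero null by blast
  then show thesis using that[OF r(1)] \<sigma>0 PU by (simp add: \<sigma>_def[abs_def] P_def)
qed

text \<open>The null curves with \<open>c = 0\<close> and \<open>c = -4\<close> have the heights \<open>3 \<alpha> t\<^sup>4\<close> and \<open>(8 \<beta> - \<alpha>) t\<^sup>4\<close>
  up to higher order. If both lie in \<open>H\<close>, then \<open>\<alpha>\<close> and \<open>\<beta>\<close> have the same sign.\<close>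

lemma half_space_signs:
  assumes H: "half_space_at A f \<nu> p H"
  shows "0 < \<alpha> * \<beta>" "sgn_0 f \<nu> p H = sgn \<alpha>"
proof -
  obtain a b where a: "a \<noteq> 0" and H_eq: "H = {y. a \<bullet> y \<le> b}"
    using H unfolding half_space_at_def by blast
  have "frontier H = {y. (y - f p) \<bullet> \<nu> p = 0}"
    using H unfolding half_space_at_def limiting_tangent_plane_def by (elim conjE)
  then have fr_H: "{y. a \<bullet> y = b} = {y. (y - f p) \<bullet> \<nu> p = 0}"
    unfolding H_eq frontier_halfspace_le[OF disjI1[OF a]] .
  define k where "k = a \<bullet> \<nu> p"
  have nn: "\<nu> p \<bullet> \<nu> p = 1" using norm_\<nu>[of p] by (simp add: norm_eq_1)
  have b: "b = a \<bullet> f p"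
  proof -
    have "f p \<in> {y. (y - f p) \<bullet> \<nu> p = 0}" by simp
    then show ?thesis unfolding fr_H[symmetric] by simp
  qed
  have ak: "a = k *\<^sub>R \<nu> p"
  proof -
    \<comment> \<open>The component of \<open>a\<close> inside the limiting tangent plane. Moving
      from \<open>f p\<close> by \<open>v\<close> stays in the frontier of \<open>H\<close>, so
      \<open>a\<close> is orthogonal to \<open>v\<close>, and hence \<open>v\<close>
      vanishes.\<close>
    define v where "v = a - k *\<^sub>R \<nu> p"
    have v1: "v \<bullet> \<nu> p = 0" by (simp add: v_def k_def inner_diff_left nn)
    then have "f p + v \<in> {y. (y - f p) \<bullet> \<nu> p = 0}" by simp
    then have "a \<bullet> v = 0" unfolding fr_H[symmetric] b by (simp add: inner_add_right)
    then have "v \<bullet> v = 0" using v1 by (simp add: v_def inner_diff_left inner_commute)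
    then show ?thesis by (simp add: v_def)
  qed
  have k0: "k \<noteq> 0" using a ak by auto
  have inH: "y \<in> H \<longleftrightarrow> k * ((y - f p) \<bullet> \<nu> p) \<le> 0" for y
    unfolding H_eq b by (subst (1 2) ak) (simp add: inner_diff_left inner_commute algebra_simps)
  have lim: "k * (\<alpha> * (3 + c) + \<beta> * c^2 / 2) \<le> 0" if c: "c \<noteq> -6" for c
  proof -
    let ?\<sigma> = "\<lambda>t. inv_into U \<psi> (vector [t, c * t^2])"
    obtain r where r: "0 < r" "null_curve A f {-r<..<r} ?\<sigma>" "?\<sigma> 0 = p"
      and PU: "\<And>t. \<bar>t\<bar> < r \<Longrightarrow> vector [t, c * t^2] \<in> \<psi> ` U"
      using parabola_null_curve[OF c] by blast
    have "\<forall>a b \<sigma>. a < 0 \<and> 0 < b \<and> null_curve A f {a<..<b} \<sigma> \<and> \<sigma> 0 = p \<longrightarrow> (\<forall>\<^sub>F t in at 0. f (\<sigma> t) \<in> H)"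
      using H unfolding half_space_at_def by (elim conjE)
    from this[rule_format, of "- r" r ?\<sigma>] have "\<forall>\<^sub>F t in at 0. f (?\<sigma> t) \<in> H"
      using r by simp
    moreover have "\<forall>\<^sub>F t in at 0. t \<noteq> (0::real)" by (rule eventually_neq_at_within)
    ultimately have ev: "\<forall>\<^sub>F t in at 0. k * (((in_chart U \<psi> f (vector [t, c * t^2]) - in_chart U \<psi> f 0) \<bullet> in_chart U \<psi> \<nu> 0) / t^4) \<le> 0"
    proof eventually_elim
      case (elim t)
      have "in_chart U \<psi> g 0 = g p" for g :: "'m \<Rightarrow> real^3" using chart_apply[OF pU] by (simp add: \<psi>p)
      moreover have "in_chart U \<psi> f (vector [t, c * t^2]) = f (?\<sigma> t)" by (simp add: in_chart_def)
      moreover have "0 < t^4" using elim(2) by simp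
      ultimately show ?case using elim(1) unfolding inH by (simp add: divide_le_0_iff flip: times_divide_eq_right) (simp add: divide_le_0_iff)
    qed
    have "((\<lambda>t. k * (((in_chart U \<psi> f (vector [t, c * t^2]) - in_chart U \<psi> f 0) \<bullet> in_chart U \<psi> \<nu> 0) / t^4))
       \<longlongrightarrow> k * (\<alpha> * (3 + c) + \<beta> * c^2 / 2)) (at 0)"
      by (intro tendsto_intros height_of_null_curve)
    from tendsto_upperbound[OF this ev] show ?thesis by simp
  qed
  have "k * \<alpha> \<le> 0" using lim[of 0] by simp
  then have ka: "k * \<alpha> < 0" using k0 \<alpha>_nonzero by (simp add: order_le_less)
  \<comment> \<open>Any c < -3 other than -6 would do: there the coefficient 3 + c of \<alpha> is
    negative, so the inequality can hold only if \<open>k * \<beta>\<close> is negative as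
    well.\<close>
  have "k * (8 * \<beta> - \<alpha>) \<le> 0" using lim[of "-4"] by (simp add: algebra_simps)
  then have "k * \<beta> < 0" using ka by (simp add: algebra_simps)
  then show "0 < \<alpha> * \<beta>" using ka by (auto simp: mult_less_0_iff zero_less_mult_iff)
  have "interior H = {y. a \<bullet> y < b}" unfolding H_eq by (rule interior_halfspace_le[OF a])
  then have int: "f p + s *\<^sub>R \<nu> p \<in> interior H \<longleftrightarrow> s * k < 0" for s
    by (simp add: b inner_add_right k_def)
  show "sgn_0 f \<nu> p H = sgn \<alpha>"
  proof (cases "k < 0")
    case True
    have "\<forall>\<^sub>F s in at_right 0. f p + s *\<^sub>R \<nu> p \<in> interior H"
      unfolding int using eventually_at_right_less[of 0] by eventually_elim (simp add: True mult_pos_neg)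
    moreover have "0 < \<alpha>" using True ka by (simp add: mult_less_0_iff)
    ultimately show ?thesis by (simp add: sgn_0_def)
  next
    case False
    then have kp: "0 < k" using k0 by simp
    have "\<not> (\<forall>\<^sub>F s in at_right 0. f p + s *\<^sub>R \<nu> p \<in> interior H)"
    proof
      assume "\<forall>\<^sub>F s in at_right 0. f p + s *\<^sub>R \<nu> p \<in> interior H"
      then have "\<forall>\<^sub>F s in at_right (0::real). False"
        using eventually_at_right_less[of 0] unfolding int by eventually_elim (use kp in \<open>simp add: mult_less_0_iff\<close>)
      then show False by simp
    qed
    moreover have "\<alpha> < 0" using kp ka by (simp add: mult_less_0_iff)
    ultimately show ?thesis by (simp add: sgn_0_def)
  qed
qed

end

section \<open>Curvature and signs at a generic swallowtail\<close>

theorem theorem3p11: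
  fixes A :: "'m::{t2_space, second_countable_topology} chart set"
    and f \<nu> :: "'m \<Rightarrow> real^3"
    and p :: 'm
  assumes "oriented_surface A"
    and "front_with_normal A f \<nu>"
    and "generic_swallowtail A f \<nu> p"
  shows "\<exists>W D\<^sub>1 D\<^sub>2. open W \<and> p \<in> W \<and>
    components (W - singular_set A f) = {D\<^sub>1, D\<^sub>2} \<and> D\<^sub>1 \<noteq> D\<^sub>2 \<and>
    (\<forall>q\<in>W \<inter> singular_set A f. q \<in> closure D\<^sub>1 \<and> q \<in> closure D\<^sub>2 \<and>
       (\<forall>V. open V \<and> q \<in> V \<longrightarrow>
          \<not> bounded (gauss_curvature A f ` (V \<inter> D\<^sub>1)) \<and>
          \<not> bounded (gauss_curvature A f ` (V \<inter> D\<^sub>2)))) \<and>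
    (\<forall>x\<in>D\<^sub>1. gauss_curvature A f x > 0) \<and>
    (\<forall>x\<in>D\<^sub>2. gauss_curvature A f x < 0) \<and>
    (\<forall>\<Delta> H. open \<Delta> \<and> connected \<Delta> \<and> \<Delta> \<noteq> {} \<and> \<Delta> \<subseteq> W - singular_set A f \<and>
       half_space_at A f \<nu> p H \<longrightarrow>
       (\<forall>x\<in>\<Delta>. sgn_0 f \<nu> p H * sgn_domain A f \<nu> W \<Delta> = sgn (gauss_curvature A f x)))"
proof -
  obtain U \<psi> V \<Phi> where nz: "normalizes A f p swallowtail_form U \<psi> V \<Phi>"
    using assms(3) by (auto simp: generic_swallowtail_def swallowtail_def)
  interpret generic_front_swallowtail A f \<nu> p U \<psi> V \<Phi>
    using assms nz by unfold_locales (auto simp: generic_swallowtail_def)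
  obtain d where d: "0 < d" "box_nbhd d \<subseteq> \<psi> ` U"
    "\<And>w. w \<in> box_nbhd d \<Longrightarrow> 0 < B w * (\<alpha> * \<beta>)"
    "\<And>w. w \<in> box_nbhd d \<Longrightarrow> 0 < (Gd 1 w \<bullet> in_chart U \<psi> \<nu> w) * \<alpha>"
    using small_box_nbhd by metis
  \<comment> \<open>The curvature has the sign of \<alpha> \<beta> \<lambda>, so this
    \<open>s\<close> names the half of positive curvature.\<close>
  define s where "s = sgn (\<alpha> * \<beta>)"
  have s: "s = 1 \<or> s = -1" using \<alpha>_nonzero \<beta>_nonzero by (auto simp: s_def sgn_if)
  then have s': "- s = 1 \<or> - s = -1" by auto
  have pn: "p \<in> nbhd d" using pU zero_in_box_nbhd[OF d(1)] by (simp add: nbhd_def \<psi>p)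
  have pos: "gauss_curvature A f x > 0" if "x \<in> half d s" for x
    using curvature_sign[OF d(3) s that] s by (auto simp: s_def[symmetric] sgn_1_pos)
  have neg: "gauss_curvature A f x < 0" if "x \<in> half d (- s)" for x
    using curvature_sign[OF d(3) s' that] s by (auto simp: s_def[symmetric] sgn_1_neg)
  have sign: "sgn_0 f \<nu> p H * sgn_domain A f \<nu> (nbhd d) \<Delta> = sgn (gauss_curvature A f x)"
    if \<Delta>: "connected \<Delta>" "\<Delta> \<subseteq> nbhd d - singular_set A f" and H: "half_space_at A f \<nu> p H" and x: "x \<in> \<Delta>" for \<Delta> H x
  proof -
    obtain t :: real where t: "t = 1 \<or> t = -1" "\<Delta> \<subseteq> half d t" using connected_subset_half[OF \<Delta>] by blast
    have "sgn_domain A f \<nu> (nbhd d) \<Delta> = sgn (t * \<alpha>)" using x by (intro sgn_domain_eq d t) auto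
    also have "\<dots> = t * sgn \<alpha>" using t(1) by auto
    finally have dom: "sgn_domain A f \<nu> (nbhd d) \<Delta> = t * sgn \<alpha>" .
    have "x \<in> half d t" using x t(2) by blast
    from curvature_sign[OF d(3) t(1) this] have "sgn (gauss_curvature A f x) = t"
      using half_space_signs(1)[OF H] by simp
    \<comment> \<open>The sign of \<alpha> enters both factors and cancels, leaving the side
      \<open>t\<close>, which is the sign of the curvature because the half-space forces \<alpha>
      \<beta> to be positive.\<close>
    moreover have "sgn \<alpha> * (t * sgn \<alpha>) = t" using \<alpha>_nonzero by (simp add: sgn_if)
    ultimately show ?thesis unfolding dom half_space_signs(2)[OF H] by simp
  qed
  show ?thesis
  proof (intro exI conjI)
    show "open (nbhd d)" "p \<in> nbhd d" by (fact open_nbhd, fact pn)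
    show "components (nbhd d - singular_set A f) = {half d s, half d (- s)}" "half d s \<noteq> half d (- s)"
      by (fact components_nbhd[OF d(1,2) s])+
    show "\<forall>q\<in>nbhd d \<inter> singular_set A f. q \<in> closure (half d s) \<and> q \<in> closure (half d (- s)) \<and>
       (\<forall>V. open V \<and> q \<in> V \<longrightarrow> \<not> bounded (gauss_curvature A f ` (V \<inter> half d s)) \<and>
          \<not> bounded (gauss_curvature A f ` (V \<inter> half d (- s))))"
      using singular_in_closure[OF d(1-3) s] singular_in_closure[OF d(1-3) s']
        curvature_unbounded[OF d(1-3) s] curvature_unbounded[OF d(1-3) s'] by blast
  qed (use pos neg sign in blast)+
qed

end
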